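(* Fix an integer $r\ge 2$ and positive real constants $\beta,\alpha_1,\alpha_2,\ldots,\alpha_r$ with $\sum_{i=1}^r\alpha_i=1$. Let $\omega=\omega(n)\to\infty$ as $n\to\infty$, and let $p=p(n)\in[0,1]$ satisfy $p\ge \frac{\log n+r\log\log n+\omega}{n}$. Then, with probability tending to $1$ as $n\to\infty$, $$hcp(G_{n,p}^{\boldsymbol\alpha})\supseteq \mathbf{M}_\beta=\{\mathbf{m}\in\mathbf{M}: m_i\ge \beta n \text{ for all } i\in[r]\}.$$
   Context: Write $[k]=\{1,2,\ldots,k\}$. Let $C=\{c_1,\ldots,c_r\}$ be a set of $r$ colors and $\boldsymbol\alpha=(\alpha_1,\ldots,\alpha_r)$. $G_{n,p}^{\boldsymbol\alpha}$ denotes the binomial random graph $G_{n,p}$ on vertex set $[n]$ in which each edge $e$ is independently given a random color $c(e)\in C$ with $\Pr(c(e)=c_i)=\alpha_i$. $\mathbf{M}$ is the set of integer vectors $\mathbf{m}=(m_1,\ldots,m_r)\in[0,n]^r$ with $m_1+\cdots+m_r=n$. For an $n$-vertex graph $G$ with edges colored from $C$, the Hamilton cycle color profile $hcp(G)$ is the set of $\mathbf{m}\in\mathbf{M}$ such that $G$ has a Hamilton cycle that is the concatenation (in this order around the cycle) of $r$ paths $P_1,P_2,\ldots,P_r$, where $P_i$ consists of exactly $m_i$ edges, all of color $c_i$ (if $m_i=0$ then $P_i$ has no edges). *)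

theory Defs
  imports "HOL-Probability.Probability"
begin

definition all_edges :: "nat \<Rightarrow> nat set set" where
  "all_edges n = {e. e \<subseteq> {1..n} \<and> card e = 2}"

definition gnp :: "nat \<Rightarrow> real \<Rightarrow> nat set set pmf" where
  "gnp n p = map_pmf (\<lambda>f. {e \<in> all_edges n. f e})
     (Pi_pmf (all_edges n) False (\<lambda>_. bernoulli_pmf p))"

text \<open>The colour \<open>c\<^sub>i\<close> is represented by its index \<open>i \<in> {1..r}\<close>. The value of
  \<open>embed_pmf\<close> is only meaningful under the hypotheses of the lemma below.\<close>

definition colour_pmf :: "nat \<Rightarrow> (nat \<Rightarrow> real) \<Rightarrow> nat pmf" where
  "colour_pmf r \<alpha> = embed_pmf (\<lambda>i. if i \<in> {1..r} then \<alpha> i else 0)"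

lemma pmf_colour_pmf:
  assumes "\<And>i. i \<in> {1..r} \<Longrightarrow> \<alpha> i \<ge> 0" and "(\<Sum>i=1..r. \<alpha> i) = 1"
  shows "pmf (colour_pmf r \<alpha>) i = (if i \<in> {1..r} then \<alpha> i else 0)"
  unfolding colour_pmf_def
proof (rule pmf_embed_pmf)
  let ?f = "\<lambda>i. if i \<in> {1..r} then \<alpha> i else 0"
  show nn: "0 \<le> ?f x" for x
    using assms(1) by simp
  have "(\<integral>\<^sup>+ x. ennreal (?f x) \<partial>count_space UNIV)
      = (\<integral>\<^sup>+ x. ennreal (\<alpha> x) * indicator {1..r} x \<partial>count_space UNIV)"
    by (intro nn_integral_cong) (auto simp: indicator_def)
  also have "\<dots> = (\<integral>\<^sup>+ x. ennreal (\<alpha> x) \<partial>count_space {1..r})"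
    by (simp add: nn_integral_count_space_indicator)
  also have "\<dots> = (\<Sum>x=1..r. ennreal (\<alpha> x))"
    by (rule nn_integral_count_space_finite) simp
  also have "\<dots> = ennreal (\<Sum>x=1..r. \<alpha> x)"
    using assms(1) by (intro sum_ennreal) auto
  finally show "(\<integral>\<^sup>+ x. ennreal (?f x) \<partial>count_space UNIV) = 1"
    using assms(2) by simp
qed

text \<open>An edge-coloured graph is a pair \<open>(E, c)\<close>; only the values of \<open>c\<close> on \<open>E\<close> matter, and
  \<open>0\<close>, which is not a colour, is the dummy value elsewhere.\<close>

definition coloured_gnp ::
    "nat \<Rightarrow> real \<Rightarrow> nat \<Rightarrow> (nat \<Rightarrow> real) \<Rightarrow> (nat set set \<times> (nat set \<Rightarrow> nat)) pmf" where
  "coloured_gnp n p r \<alpha> = do {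
     E \<leftarrow> gnp n p;
     c \<leftarrow> Pi_pmf E 0 (\<lambda>_. colour_pmf r \<alpha>);
     return_pmf (E, c)
   }"

text \<open>For \<open>vs = [v\<^sub>1, \<dots>, v\<^sub>k]\<close> this is \<open>[{v\<^sub>1, v\<^sub>2}, \<dots>, {v\<^bsub>k-1\<^esub>, v\<^sub>k}, {v\<^sub>k, v\<^sub>1}]\<close>.\<close>

definition cycle_edges :: "nat list \<Rightarrow> nat set list" where
  "cycle_edges vs = map2 (\<lambda>u v. {u, v}) vs (rotate1 vs)"

definition hamilton_cycle :: "nat \<Rightarrow> nat set set \<Rightarrow> nat list \<Rightarrow> bool" where
  "hamilton_cycle n E vs \<longleftrightarrow>
     3 \<le> length vs \<and> distinct vs \<and> set vs = {1..n} \<and> set (cycle_edges vs) \<subseteq> E"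

definition profiles :: "nat \<Rightarrow> nat \<Rightarrow> (nat \<Rightarrow> nat) set" where
  "profiles n r = {m \<in> {1..r} \<rightarrow>\<^sub>E {0..n}. (\<Sum>i=1..r. m i) = n}"

definition profiles_ge :: "nat \<Rightarrow> nat \<Rightarrow> real \<Rightarrow> (nat \<Rightarrow> nat) set" where
  "profiles_ge n r \<beta> = {m \<in> profiles n r. \<forall>i\<in>{1..r}. real (m i) \<ge> \<beta> * real n}"

text \<open>The path \<open>P\<^sub>i\<close> is given by its edge sequence \<open>P i\<close>, a segment of the edge sequence of the
  cycle. The starting vertex of \<open>vs\<close> is arbitrary, so the first segment may start anywhere.\<close>

definition hcp :: "nat \<Rightarrow> nat \<Rightarrow> nat set set \<times> (nat set \<Rightarrow> nat) \<Rightarrow> (nat \<Rightarrow> nat) set" where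
  "hcp n r = (\<lambda>(E, c). {m \<in> profiles n r.
     \<exists>vs P. hamilton_cycle n E vs \<and>
       cycle_edges vs = concat (map P [1..<Suc r]) \<and>
       (\<forall>i\<in>{1..r}. length (P i) = m i \<and> (\<forall>e\<in>set (P i). c e = i))})"

end

theory Submission
  imports Defs "HOL-Real_Asymp.Real_Asymp"
begin

text \<open>The edges are exposed in two rounds, of probability \<open>p1 = (ln n + r ln ln n + w) / n\<close> and at
  least \<open>C / n\<close>. After the first round, let \<open>X\<close> be the set of the vertices that have, in some colour
  \<open>i\<close>, fewer than \<open>\<epsilon> ln n\<close> neighbours in a fixed reservoir \<open>U\<^sub>i\<close> of linear size. With high
  probability \<open>X\<close> is small and sparsely distributed, so every \<open>v \<in> X\<close> has \<open>r + 1\<close> neighbours outside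
  \<open>X\<close> that are adjacent to no other vertex of \<open>X\<close>; two of them see \<open>v\<close> in the same colour and form with
  \<open>v\<close> a monochromatic path. For a given profile \<open>m\<close> choose junctions \<open>a\<^sub>1, \<dots>, a\<^sub>r\<close> and split the
  vertices into classes \<open>V\<^sub>i\<close> of size \<open>m\<^sub>i\<close>, where \<open>V\<^sub>i\<close> contains \<open>a\<^sub>i\<close>, most of \<open>U\<^sub>i\<close> and the paths of
  colour \<open>i\<close>. It suffices to find, for every \<open>i\<close>, a Hamilton cycle of \<open>V\<^sub>i \<union> {a\<^sub>i\<^sub>+\<^sub>1}\<close> in colour \<open>i\<close> through
  a forced matching, which consists of the contracted paths and of the edge \<open>a\<^sub>i a\<^sub>i\<^sub>+\<^sub>1\<close>.
  The graphs of the first round are expanders, so Posa rotations that do not break forced edges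
  yield quadratically many boosters, and the edges of the second round contain enough of them
  with probability \<open>1 - exp (- n)\<close>, which allows a union bound over the profiles.\<close>

section \<open>Rotations and boosters with forced edges\<close>

text \<open>The failure bound of the first round contains a term of order
  \<open>exp (- w n)\<close>, and \<open>w\<close> may grow arbitrarily slowly, so no union bound
  over the polynomially many profiles is affordable there. Hence everything drawn from the first
  round (reservoirs, \<open>X\<close>, the monochromatic paths through \<open>X\<close>, the
  junctions) is fixed before the profile is known, and the profile only decides how the other
  vertices are distributed. A vertex of \<open>X\<close> may have very few edges, so its class is
  dictated by the colour of its path, and it has to lie inside a colour segment. Every other vertex
  has, for each colour, many neighbours that belong to the right class under every profile, so it
  can be put anywhere. Contracting the paths removes \<open>X\<close> at the price of edges that no
  rotation may break; this is why expansion is always measured by vertices outside the forced edges.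
  Since \<open>p\<close> may be far above the threshold while the sparsity estimates need
  logarithmic degrees, the first round is capped and all the excess is left to the second one, where
  only a lower bound matters.\<close>

fun path_edges :: "'a list \<Rightarrow> 'a set list" where
  "path_edges (x # y # xs) = {x, y} # path_edges (y # xs)"
| "path_edges _ = []"

lemma path_edges_append:
  "xs \<noteq> [] \<Longrightarrow> ys \<noteq> [] \<Longrightarrow>
    path_edges (xs @ ys) = path_edges xs @ {last xs, hd ys} # path_edges ys"
proof (induction xs)
  case (Cons x xs)
  then show ?case by (cases xs; cases ys) auto
qed simp

lemma path_edges_Cons: "ys \<noteq> [] \<Longrightarrow> path_edges (x # ys) = {x, hd ys} # path_edges ys"
  by (cases ys) auto

lemma path_edges_rev: "set (path_edges (rev xs)) = set (path_edges xs)"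
proof (induction xs rule: path_edges.induct)
  case (1 x y xs)
  have "set (path_edges (rev (x # y # xs))) = set (path_edges (rev (y # xs) @ [x]))" by simp
  also have "\<dots> = set (path_edges (rev (y # xs))) \<union> {{y, x}}"
    by (subst path_edges_append) auto
  finally show ?case using 1 by auto
qed auto

lemma path_edges_subset: "e \<in> set (path_edges xs) \<Longrightarrow> e \<subseteq> set xs"
  by (induction xs rule: path_edges.induct) auto

lemma path_edges_split:
  "e \<in> set (path_edges xs) \<Longrightarrow> \<exists>as x y bs. xs = as @ x # y # bs \<and> e = {x, y}"
proof (induction xs rule: path_edges.induct)
  case (1 x y xs)
  show ?case
  proof (cases "e = {x, y}")
    case True then show ?thesis by (metis append_Nil)
  next
    case False
    then obtain as u v bs where "y # xs = as @ u # v # bs" "e = {u, v}" using 1 by auto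
    then show ?thesis by (metis append_Cons)
  qed
qed auto

lemma path_edges_neighbours:
  assumes "distinct xs"
  shows "card {w. {v, w} \<in> set (path_edges xs)} \<le> 2"
proof (cases "v \<in> set xs")
  case False
  then have "{w. {v, w} \<in> set (path_edges xs)} = {}" using path_edges_subset by fastforce
  then show ?thesis by simp
next
  case True
  then obtain as bs where xs: "xs = as @ v # bs" by (meson split_list)
  have "{w. {v, w} \<in> set (path_edges xs)} \<subseteq> {last as, hd bs}"
  proof
    fix w assume "w \<in> {w. {v, w} \<in> set (path_edges xs)}"
    then have "{v, w} \<in> set (path_edges xs)" by simp
    then have "{v,w} \<in> set (path_edges as) \<or> {v,w} = {last as, v} \<or> {v,w} = {v, hd bs} \<or> {v,w} \<in> set (path_edges bs)"
      unfolding xs by (cases "as = []"; cases "bs = []")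
        (simp_all add: path_edges_append path_edges_Cons, blast+)
    moreover have "{v,w} \<notin> set (path_edges as)" "{v,w} \<notin> set (path_edges bs)"
      using assms path_edges_subset[of "{v,w}" as] path_edges_subset[of "{v,w}" bs] unfolding xs by auto
    ultimately show "w \<in> {last as, hd bs}" by (auto simp: doubleton_eq_iff)
  qed
  then have "card {w. {v, w} \<in> set (path_edges xs)} \<le> card {last as, hd bs}"
    by (intro card_mono) auto
  also have "\<dots> \<le> 2" by (simp add: card_insert_if)
  finally show ?thesis .
qed

section \<open>Paths that respect forced edges, and their rotations\<close>

text \<open>The edges of \<open>F\<close> stand for contracted pieces and need not be edges of
  \<open>H\<close>. A path may miss a forced edge only by avoiding both of its ends.\<close>

definition forced_path :: "'a set \<Rightarrow> 'a set set \<Rightarrow> 'a set set \<Rightarrow> 'a list \<Rightarrow> bool" where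
  "forced_path Y F H xs \<longleftrightarrow> distinct xs \<and> set xs \<subseteq> Y \<and> set (path_edges xs) \<subseteq> H \<union> F \<and>
     (\<forall>e\<in>F. e \<inter> set xs \<noteq> {} \<longrightarrow> e \<in> set (path_edges xs))"

text \<open>The closing edge is taken from \<open>H\<close>, so that the forced edges lie on the
  path itself and the cycle can later be cut at one of them by splitting the list.\<close>

definition forced_ham :: "'a set \<Rightarrow> 'a set set \<Rightarrow> 'a set set \<Rightarrow> bool" where
  "forced_ham Y F H \<longleftrightarrow> (\<exists>xs. forced_path Y F H xs \<and> set xs = Y \<and> 3 \<le> length xs \<and> {last xs, hd xs} \<in> H)"

lemma forced_path_mono: "forced_path Y F H xs \<Longrightarrow> H \<subseteq> H' \<Longrightarrow> forced_path Y F H' xs"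
  unfolding forced_path_def by auto

lemma forced_ham_mono: "forced_ham Y F H \<Longrightarrow> H \<subseteq> H' \<Longrightarrow> forced_ham Y F H'"
  unfolding forced_ham_def using forced_path_mono by blast

lemma forced_path_rev: "forced_path Y F H xs \<Longrightarrow> forced_path Y F H (rev xs)"
  unfolding forced_path_def by (simp add: path_edges_rev)

lemma forced_path_rotate:
  assumes "forced_path Y F H (as @ u # bs)" "bs \<noteq> []" "{last bs, u} \<in> H" "{u, hd bs} \<notin> F"
  shows "forced_path Y F H (as @ u # rev bs)"
proof -
  let ?xs = "as @ u # bs" and ?ys = "as @ u # rev bs"
  have x: "set (path_edges ?xs) = set (path_edges (as @ [u])) \<union> {{u, hd bs}} \<union> set (path_edges bs)"
    using path_edges_append[of "as @ [u]" bs] assms(2) by auto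
  have y: "set (path_edges ?ys) = set (path_edges (as @ [u])) \<union> {{u, last bs}} \<union> set (path_edges bs)"
    using path_edges_append[of "as @ [u]" "rev bs"] assms(2) by (auto simp: path_edges_rev hd_rev)
  have "{u, last bs} \<in> H" using assms(3) by (simp add: insert_commute)
  then show ?thesis using assms unfolding forced_path_def x y by auto
qed

text \<open>Posa rotation: the head stays, \<open>u\<close> is the pivot, the edge from
  \<open>u\<close> to \<open>hd bs\<close> is given up for the one from \<open>u\<close> to
  \<open>last bs\<close>, and \<open>hd bs\<close> becomes the new end. Only an edge outside
  \<open>F\<close> may be given up.\<close>

inductive rotation :: "'a set set \<Rightarrow> 'a set set \<Rightarrow> 'a list \<Rightarrow> 'a list \<Rightarrow> bool" for F H xs where
  start: "rotation F H xs xs"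
| step: "rotation F H xs (as @ u # bs) \<Longrightarrow> bs \<noteq> [] \<Longrightarrow> {last bs, u} \<in> H \<Longrightarrow> {u, hd bs} \<notin> F
    \<Longrightarrow> rotation F H xs (as @ u # rev bs)"

lemma rotation_forced_path:
  assumes "rotation F H xs zs" "forced_path Y F H xs"
  shows "forced_path Y F H zs \<and> set zs = set xs \<and> length zs = length xs \<and> hd zs = hd xs"
  using assms
proof (induction rule: rotation.induct)
  case (step as u bs)
  then have "forced_path Y F H (as @ u # rev bs)"
    using forced_path_rotate[OF _ step.hyps(2,3,4)] by blast
  then show ?case using step by (cases as) auto
qed auto

definition rotation_ends :: "'a set set \<Rightarrow> 'a set set \<Rightarrow> 'a list \<Rightarrow> 'a set" where
  "rotation_ends F H xs = last ` {zs. rotation F H xs zs}"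

text \<open>A rotation affects path edges only at the pivot, the old end and the new end. If
  \<open>u\<close> were the pivot, the edge given up would join it to an end vertex and, by
  induction, already belong to \<open>xs\<close>, which the last assumption excludes.\<close>

lemma rotation_keeps_edges:
  assumes "rotation F H xs zs" "u \<notin> rotation_ends F H xs"
    and "\<And>v. v \<in> rotation_ends F H xs \<Longrightarrow> {u, v} \<notin> set (path_edges xs)"
  shows "{u, w} \<in> set (path_edges zs) \<longleftrightarrow> {u, w} \<in> set (path_edges xs)"
  using assms
proof (induction arbitrary: w rule: rotation.induct)
  case (step as a bs)
  let ?R = "rotation_ends F H xs"
  have x: "set (path_edges (as @ a # bs)) = set (path_edges (as @ [a])) \<union> {{a, hd bs}} \<union> set (path_edges bs)"
    using path_edges_append[of "as @ [a]" bs] step.hyps by auto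
  have y: "set (path_edges (as @ a # rev bs)) = set (path_edges (as @ [a])) \<union> {{a, last bs}} \<union> set (path_edges bs)"
    using path_edges_append[of "as @ [a]" "rev bs"] step.hyps by (auto simp: path_edges_rev hd_rev)
  have "rotation F H xs (as @ a # rev bs)" using step.hyps by (intro rotation.step)
  then have "last (as @ a # rev bs) \<in> ?R" "last (as @ a # bs) \<in> ?R"
    unfolding rotation_ends_def using step.hyps(1) by blast+
  then have R: "hd bs \<in> ?R" "last bs \<in> ?R" using step.hyps(2) by (auto simp: last_rev)
  have "u \<noteq> a"
  proof
    assume "u = a"
    then have "{u, hd bs} \<in> set (path_edges xs)" using step.IH[of "hd bs"] step.prems x by auto
    then show False using step.prems R by blast
  qed
  then have "{u, w} \<noteq> {a, hd bs}" "{u, w} \<noteq> {a, last bs}"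
    using R step.prems(1) by (auto simp: doubleton_eq_iff)
  then show ?case using step.IH[of w] step.prems x y by auto
qed auto

definition longest_forced_path :: "'a set \<Rightarrow> 'a set set \<Rightarrow> 'a set set \<Rightarrow> 'a list \<Rightarrow> bool" where
  "longest_forced_path Y F H xs \<longleftrightarrow> forced_path Y F H xs \<and>
     (\<forall>ys. forced_path Y F H ys \<longrightarrow> length ys \<le> length xs)"

lemma forced_path_snoc:
  assumes "forced_path Y F H xs" "u \<in> Y" "u \<notin> set xs" "u \<notin> \<Union>F" "xs \<noteq> []" "{last xs, u} \<in> H"
  shows "forced_path Y F H (xs @ [u])"
  using assms path_edges_append[of xs "[u]"] unfolding forced_path_def by auto

text \<open>If no neighbour of \<open>u\<close> on \<open>xs\<close> were an end vertex,
  \<open>u\<close> would keep its path edges under all rotations. But maximality puts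
  \<open>u\<close> on every rotated path, and being unforced it can serve as pivot for the end
  \<open>v\<close>, which turns one of its path neighbours into an end.\<close>

lemma rotation_ends_neighbours:
  assumes xs: "longest_forced_path Y F H xs" "xs \<noteq> []"
    and "v \<in> rotation_ends F H xs" "{u, v} \<in> H" "u \<in> Y" "u \<notin> \<Union>F" "u \<notin> rotation_ends F H xs"
  shows "\<exists>w\<in>rotation_ends F H xs. {w, u} \<in> set (path_edges xs)"
proof (rule ccontr)
  assume neg: "\<not> ?thesis"
  let ?R = "rotation_ends F H xs"
  obtain zs where zs: "rotation F H xs zs" "v = last zs"
    using assms unfolding rotation_ends_def by auto
  have f: "forced_path Y F H zs" "length zs = length xs"
    using rotation_forced_path[OF zs(1)] xs unfolding longest_forced_path_def by auto
  have ne: "zs \<noteq> []" using f assms by auto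
  have "u \<in> set zs"
  proof (rule ccontr)
    assume "u \<notin> set zs"
    then have "forced_path Y F H (zs @ [u])"
      using f assms zs ne by (intro forced_path_snoc) (auto simp: insert_commute)
    then show False using xs f unfolding longest_forced_path_def by fastforce
  qed
  then obtain as bs where s: "zs = as @ u # bs" by (meson split_list)
  have "u \<noteq> v" using assms(3,7) by blast
  then have "bs \<noteq> []" using s zs(2) by auto
  then have l: "last bs = v" using zs(2) s by simp
  have F: "{u, hd bs} \<notin> F" using assms(6) by blast
  have "rotation F H xs (as @ u # rev bs)"
    using zs(1) \<open>bs \<noteq> []\<close> l F assms(4) unfolding s
    by (intro rotation.step) (simp_all add: insert_commute)
  then have "last (as @ u # rev bs) \<in> ?R" unfolding rotation_ends_def by blast
  then have h: "hd bs \<in> ?R" using \<open>bs \<noteq> []\<close> by (auto simp: last_rev)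
  have "{u, hd bs} \<in> set (path_edges zs)"
    using path_edges_append[of "as @ [u]" bs] \<open>bs \<noteq> []\<close> s by auto
  then have "{u, hd bs} \<in> set (path_edges xs)"
    using rotation_keeps_edges[OF zs(1), of u "hd bs"] assms neg by (auto simp: insert_commute)
  then show False using neg h by (auto simp: insert_commute)
qed

section \<open>Expansion, boosters and chains of boosters\<close>

text \<open>\<open>expand\<close> counts only unforced neighbours because these can always serve as
  pivots; \<open>connect\<close> asks for an unforced \<open>y\<close> because a cycle will be
  opened at \<open>y\<close>. Both are monotone in \<open>H\<close>, so they survive the addition of
  boosters.\<close>

locale posa =
  fixes Y :: "'a set" and F H :: "'a set set" and k :: nat
  assumes finite_Y: "finite Y" and Y_ne: "Y \<noteq> {}"
    and F_pair: "\<And>e. e \<in> F \<Longrightarrow> \<exists>x\<in>Y. \<exists>y\<in>Y. x \<noteq> y \<and> e = {x, y}"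
    and F_matching: "\<And>e e'. e \<in> F \<Longrightarrow> e' \<in> F \<Longrightarrow> e \<inter> e' \<noteq> {} \<Longrightarrow> e = e'"
    and k_pos: "1 \<le> k"
    and expand: "\<And>S. S \<subseteq> Y \<Longrightarrow> S \<noteq> {} \<Longrightarrow> card S \<le> k \<Longrightarrow>
      2 * card S < card {u \<in> Y - S - \<Union>F. \<exists>v\<in>S. {u, v} \<in> H}"
    and connect: "\<And>S. S \<subseteq> Y \<Longrightarrow> S \<noteq> {} \<Longrightarrow> k < card (Y - S) \<Longrightarrow>
      \<exists>x\<in>S. \<exists>y\<in>Y - S - \<Union>F. {x, y} \<in> H"
begin

lemma posa_mono:
  assumes "H \<subseteq> H'"
  shows "posa Y F H' k"
proof
  fix S assume S: "S \<subseteq> Y" "S \<noteq> {}" "card S \<le> k"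
  have "card {u \<in> Y - S - \<Union>F. \<exists>v\<in>S. {u, v} \<in> H} \<le> card {u \<in> Y - S - \<Union>F. \<exists>v\<in>S. {u, v} \<in> H'}"
    using finite_Y assms by (intro card_mono) auto
  then show "2 * card S < card {u \<in> Y - S - \<Union>F. \<exists>v\<in>S. {u, v} \<in> H'}"
    using expand[OF S] by simp
next
  fix S assume S: "S \<subseteq> Y" "S \<noteq> {}" "k < card (Y - S)"
  show "\<exists>x\<in>S. \<exists>y\<in>Y - S - \<Union>F. {x, y} \<in> H'" using connect[OF S] assms by blast
next
  fix e assume "e \<in> F" then show "\<exists>x\<in>Y. \<exists>y\<in>Y. x \<noteq> y \<and> e = {x, y}" by (rule F_pair)
next
  fix e e' assume "e \<in> F" "e' \<in> F" "e \<inter> e' \<noteq> {}" then show "e = e'" by (rule F_matching)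
qed (use finite_Y Y_ne k_pos in auto)

lemma forced_path_length: "forced_path Y F H' xs \<Longrightarrow> length xs \<le> card Y"
  unfolding forced_path_def using finite_Y card_mono distinct_card by metis

lemma longest_exists: "\<exists>xs. longest_forced_path Y F H xs"
proof -
  have "forced_path Y F H []" unfolding forced_path_def by auto
  moreover have "\<forall>ys. forced_path Y F H ys \<longrightarrow> length ys < Suc (card Y)"
    using forced_path_length le_imp_less_Suc by blast
  ultimately have "\<exists>x. forced_path Y F H x \<and> (\<forall>y. forced_path Y F H y \<longrightarrow> length y \<le> length x)"
    by (intro ex_has_greatest_nat)
  then show ?thesis unfolding longest_forced_path_def .
qed

lemma longest_nonempty:
  assumes "longest_forced_path Y F H xs"
  shows "xs \<noteq> []"
proof -
  obtain y where "y \<in> Y" using Y_ne by auto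
  then have "2 * card {y} < card {u \<in> Y - {y} - \<Union>F. \<exists>v\<in>{y}. {u, v} \<in> H}"
    using k_pos by (intro expand) auto
  then have "{u \<in> Y - {y} - \<Union>F. \<exists>v\<in>{y}. {u, v} \<in> H} \<noteq> {}" by (metis card.empty not_less0)
  then obtain u where "u \<in> Y - \<Union>F" by blast
  \<comment> \<open>A one-vertex list is a forced path only if its vertex is unforced, hence the
    detour through a neighbour of \<open>y\<close>.\<close>
  then have "forced_path Y F H [u]" unfolding forced_path_def by auto
  then show ?thesis using assms unfolding longest_forced_path_def by fastforce
qed

lemma rotation_ends_subset:
  assumes "longest_forced_path Y F H xs"
  shows "rotation_ends F H xs \<subseteq> Y"
proof
  fix v assume "v \<in> rotation_ends F H xs"
  then obtain zs where zs: "rotation F H xs zs" "v = last zs" unfolding rotation_ends_def by auto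
  have "forced_path Y F H zs" "length zs = length xs"
    using rotation_forced_path[OF zs(1)] assms unfolding longest_forced_path_def by auto
  then show "v \<in> Y" using longest_nonempty[OF assms] zs(2)
    unfolding forced_path_def by (metis last_in_set length_0_conv subset_iff)
qed

text \<open>Posa's count: a small set of end vertices has more than twice as many unforced
  neighbours, yet each of these is next to an end vertex on \<open>xs\<close>, where a vertex has at
  most two neighbours.\<close>

lemma rotation_ends_large:
  assumes "longest_forced_path Y F H xs"
  shows "k < card (rotation_ends F H xs)"
proof (rule ccontr)
  let ?R = "rotation_ends F H xs"
  let ?N = "{u \<in> Y - ?R - \<Union>F. \<exists>v\<in>?R. {u, v} \<in> H}"
  assume neg: "\<not> k < card ?R"
  have fin: "finite ?R" using rotation_ends_subset[OF assms] finite_Y finite_subset by blast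
  have "last xs \<in> ?R" unfolding rotation_ends_def using rotation.start by blast
  then have e: "2 * card ?R < card ?N" using neg rotation_ends_subset[OF assms] by (intro expand) auto
  have "?N \<subseteq> (\<Union>w\<in>?R. {u. {w, u} \<in> set (path_edges xs)})"
    using rotation_ends_neighbours[OF assms longest_nonempty[OF assms]] by fastforce
  moreover have "finite (\<Union>w\<in>?R. {u. {w, u} \<in> set (path_edges xs)})"
  proof (intro finite_UN_I[OF fin])
    fix w
    have "{u. {w, u} \<in> set (path_edges xs)} \<subseteq> set xs" using path_edges_subset by fastforce
    then show "finite {u. {w, u} \<in> set (path_edges xs)}" using finite_subset by blast
  qed
  ultimately have "card ?N \<le> card (\<Union>w\<in>?R. {u. {w, u} \<in> set (path_edges xs)})"
    by (intro card_mono)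
  also have "\<dots> \<le> (\<Sum>w\<in>?R. card {u. {w, u} \<in> set (path_edges xs)})"
    using fin by (rule card_UN_le)
  also have "\<dots> \<le> (\<Sum>w\<in>?R. 2)"
    using assms by (intro sum_mono path_edges_neighbours)
      (auto simp: longest_forced_path_def forced_path_def)
  finally show False using e by simp
qed

text \<open>The path contains all of its rotation ends. It also contains the unforced neighbours of
  its last vertex, at least three of them, since otherwise it could be extended; this gives length 3
  even for \<open>k = 1\<close>.\<close>

lemma longest_length:
  assumes "longest_forced_path Y F H xs"
  shows "3 \<le> length xs" "k < length xs"
proof -
  let ?R = "rotation_ends F H xs"
  have sub: "?R \<subseteq> set xs"
  proof
    fix v assume "v \<in> ?R"
    then obtain zs where zs: "rotation F H xs zs" "v = last zs" unfolding rotation_ends_def by auto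
    have "set zs = set xs" "length zs = length xs"
      using rotation_forced_path[OF zs(1)] assms unfolding longest_forced_path_def by auto
    then show "v \<in> set xs" using longest_nonempty[OF assms] zs(2)
      by (metis last_in_set length_0_conv)
  qed
  have d: "distinct xs" using assms unfolding longest_forced_path_def forced_path_def by auto
  have "card ?R \<le> length xs" using card_mono[OF _ sub] distinct_card[OF d] by auto
  then show "k < length xs" using rotation_ends_large[OF assms] by simp
  let ?v = "last xs"
  have v: "?v \<in> Y" using assms longest_nonempty[OF assms]
    unfolding longest_forced_path_def forced_path_def by auto
  let ?N = "{u \<in> Y - {?v} - \<Union>F. \<exists>v\<in>{?v}. {u, v} \<in> H}"
  have N: "2 * card {?v} < card ?N" using v k_pos by (intro expand) auto
  have "?N \<subseteq> set xs"
  proof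
    fix u assume u: "u \<in> ?N"
    show "u \<in> set xs"
    proof (rule ccontr)
      assume "u \<notin> set xs"
      then have "forced_path Y F H (xs @ [u])"
        using u assms longest_nonempty[OF assms] unfolding longest_forced_path_def
        by (intro forced_path_snoc) (auto simp: insert_commute)
      then show False using assms unfolding longest_forced_path_def by fastforce
    qed
  qed
  then have "card ?N \<le> card (set xs)" by (intro card_mono) simp_all
  then have "card ?N \<le> length xs" using distinct_card[OF d] by simp
  then show "3 \<le> length xs" using N by simp
qed

text \<open>The \<open>l\<close>-quantification says that the maximal length of a forced path grows.\<close>

definition boosters :: "'a set set \<Rightarrow> 'a set set" where
  "boosters H' = {e. e \<subseteq> Y \<and> card e = 2 \<and> (forced_ham Y F (insert e H') \<or>
     (\<forall>l. (\<exists>xs. forced_path Y F H' xs \<and> l \<le> length xs) \<longrightarrow>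
          (\<exists>xs. forced_path Y F (insert e H') xs \<and> l < length xs)))}"

text \<open>The new edge closes a longest path to a cycle. If the cycle misses a vertex,
  \<open>connect\<close> leads from outside to an unforced \<open>y\<close> on it; opening the cycle
  at \<open>y\<close> and stepping out gives a longer forced path.\<close>

lemma closing_edge_booster:
  assumes "longest_forced_path Y F H xs"
  shows "{last xs, hd xs} \<in> boosters H"
proof -
  let ?e = "{last xs, hd xs}"
  let ?H = "insert ?e H"
  have fp: "forced_path Y F H xs" and mx: "\<And>ys. forced_path Y F H ys \<Longrightarrow> length ys \<le> length xs"
    using assms unfolding longest_forced_path_def by auto
  have d: "distinct xs" "set xs \<subseteq> Y" using fp unfolding forced_path_def by auto
  have len: "3 \<le> length xs" "k < length xs" using longest_length[OF assms] by auto
  have ne: "xs \<noteq> []" using len by auto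
  have "hd xs \<noteq> last xs" using d len
    by (cases xs) auto
  then have e2: "?e \<subseteq> Y" "card ?e = 2" using d ne by auto
  have fp': "forced_path Y F ?H xs" using forced_path_mono[OF fp] by blast
  show ?thesis
  proof (cases "set xs = Y")
    case True
    then have "forced_ham Y F ?H" unfolding forced_ham_def using fp' len by auto
    then show ?thesis unfolding boosters_def using e2 by auto
  next
    case False
    let ?S = "Y - set xs"
    have "Y - ?S = set xs" using d by auto
    then have "k < card (Y - ?S)" using len distinct_card[OF d(1)] by simp
    moreover have "?S \<noteq> {}" using False d by auto
    ultimately obtain x y where xy: "x \<in> ?S" "y \<in> set xs - \<Union>F" "{x, y} \<in> H"
      using connect[of ?S] \<open>Y - ?S = set xs\<close> by auto
    then obtain as bs where s: "xs = as @ y # bs" by (metis DiffD1 split_list)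
    \<comment> \<open>The cycle opened just behind \<open>y\<close>: the edge given up contains
      \<open>y\<close> and so is not forced. For \<open>bs = []\<close> this is \<open>xs\<close>
      itself.\<close>
    define c where "c = bs @ as @ [y]"
    have clos: "set (path_edges c) \<subseteq> insert ?e (set (path_edges xs))"
      and clos2: "\<And>e. e \<in> set (path_edges xs) \<Longrightarrow> y \<notin> e \<Longrightarrow> e \<in> set (path_edges c)"
    proof -
      consider "as = []" | "bs = []" | "as \<noteq> []" "bs \<noteq> []" by blast
      then have "set (path_edges c) \<subseteq> insert ?e (set (path_edges xs)) \<and>
        (\<forall>e. e \<in> set (path_edges xs) \<longrightarrow> y \<notin> e \<longrightarrow> e \<in> set (path_edges c))"
      proof cases
        case 1
        then have "bs \<noteq> []" using s len by auto
        then show ?thesis unfolding c_def using s 1 by (auto simp: path_edges_append path_edges_Cons)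
      next
        case 2
        then show ?thesis unfolding c_def using s by auto
      next
        case 3
        then show ?thesis unfolding c_def using s
          by (auto simp: path_edges_append path_edges_Cons insert_commute)
      qed
      then show "set (path_edges c) \<subseteq> insert ?e (set (path_edges xs))"
        "\<And>e. e \<in> set (path_edges xs) \<Longrightarrow> y \<notin> e \<Longrightarrow> e \<in> set (path_edges c)" by blast+
    qed
    have sc: "set c = set xs" "distinct c" "length c = length xs" "last c = y"
      unfolding c_def using s d by auto
    have fc: "forced_path Y F ?H c"
      unfolding forced_path_def
    proof (intro conjI ballI impI)
      show "set (path_edges c) \<subseteq> ?H \<union> F" using clos fp unfolding forced_path_def by auto
      fix e assume e: "e \<in> F" "e \<inter> set c \<noteq> {}"
      then have "e \<in> set (path_edges xs)" using fp sc(1) unfolding forced_path_def by simp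
      then show "e \<in> set (path_edges c)" using clos2 e xy by blast
    qed (use sc d in auto)
    have cne: "c \<noteq> []" unfolding c_def by simp
    have xnc: "x \<notin> set c" using xy sc(1) by blast
    have "\<exists>ys. forced_path Y F ?H ys \<and> length xs < length ys"
    proof (cases "x \<in> \<Union>F")
      case False
      have "forced_path Y F ?H (c @ [x])"
        using False fc xy xnc sc by (intro forced_path_snoc) (auto simp: insert_commute)
      then show ?thesis using sc by (metis length_append_singleton lessI)
    next
      case True
      \<comment> \<open>A forced \<open>x\<close> must be entered together with its partner, which
        is off the cycle too because forced edges are used entirely or not at all.\<close>
      then obtain f where f: "f \<in> F" "x \<in> f" by auto
      then obtain x' where x': "f = {x, x'}" "x' \<in> Y" "x \<noteq> x'" using F_pair[of f]
        by (metis doubleton_eq_iff insertE singletonD)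
      have x'n: "x' \<notin> set c"
      proof
        assume "x' \<in> set c"
        then have "f \<in> set (path_edges c)" using fc f x' unfolding forced_path_def by auto
        then show False using path_edges_subset[of f c] f xnc by auto
      qed
      have pe: "set (path_edges (c @ [x, x'])) = set (path_edges c) \<union> {{y, x}, {x, x'}}"
        using path_edges_append[OF cne, of "[x,x']"] sc(4) by auto
      have "forced_path Y F ?H (c @ [x, x'])"
        unfolding forced_path_def
      proof (intro conjI ballI impI)
        show "distinct (c @ [x, x'])" using sc xnc x'n x' by auto
        show "set (c @ [x, x']) \<subseteq> Y" using sc d x' xy by auto
        show "set (path_edges (c @ [x, x'])) \<subseteq> ?H \<union> F"
          using pe fc f x' xy unfolding forced_path_def by (auto simp: insert_commute)
        fix e assume e: "e \<in> F" "e \<inter> set (c @ [x, x']) \<noteq> {}"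
        show "e \<in> set (path_edges (c @ [x, x']))"
        proof (cases "e \<inter> set c = {}")
          case True
          then have "e \<inter> f \<noteq> {}" using e x' by auto
          then have "e = f" using F_matching e f by auto
          then show ?thesis using pe x' by auto
        next
          case False
          then show ?thesis using fc e pe unfolding forced_path_def by auto
        qed
      qed
      moreover have "length xs < length (c @ [x, x'])" using sc(3) by simp
      ultimately show ?thesis by blast
    qed
    then obtain ys where ys: "forced_path Y F ?H ys" "length xs < length ys" by blast
    have "\<exists>zs. forced_path Y F ?H zs \<and> l < length zs"
      if "forced_path Y F H zs" "l \<le> length zs" for l zs
      using mx[OF that(1)] that(2) ys by (intro exI[of _ ys]) auto
    then show ?thesis unfolding boosters_def using e2 by blast
  qed
qed

text \<open>Rotate twice: more than \<open>k\<close> ends \<open>v\<close> with the head fixed, then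
  for each \<open>v\<close> more than \<open>k\<close> ends of paths starting at \<open>v\<close>.
  Each resulting pair closes a longest path, and an unordered pair arises from at most two ordered
  ones.\<close>

lemma card_boosters: "k * k \<le> 2 * card (boosters H)"
proof -
  obtain xs where xs: "longest_forced_path Y F H xs" using longest_exists by auto
  let ?R = "rotation_ends F H xs"
  define Z where "Z v = (SOME zs. rotation F H xs zs \<and> last zs = v)" for v
  have Z: "rotation F H xs (Z v) \<and> last (Z v) = v" if "v \<in> ?R" for v
    unfolding Z_def using that someI_ex[of "\<lambda>zs. rotation F H xs zs \<and> last zs = v"]
    unfolding rotation_ends_def by blast
  have L: "longest_forced_path Y F H (rev (Z v))" if "v \<in> ?R" for v
    using rotation_forced_path[OF conjunct1[OF Z[OF that]], of Y] xs forced_path_rev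
    unfolding longest_forced_path_def by (metis length_rev)
  define D where "D = Sigma ?R (\<lambda>v. rotation_ends F H (rev (Z v)))"
  have fin: "finite ?R" "\<And>v. v \<in> ?R \<Longrightarrow> finite (rotation_ends F H (rev (Z v)))"
    using rotation_ends_subset[OF xs] rotation_ends_subset[OF L] finite_Y finite_subset by blast+
  have "k * k \<le> card ?R * k" using rotation_ends_large[OF xs] by simp
  also have "\<dots> = (\<Sum>v\<in>?R. k)" by simp
  also have "\<dots> \<le> (\<Sum>v\<in>?R. card (rotation_ends F H (rev (Z v))))"
    using rotation_ends_large[OF L] by (intro sum_mono) (auto intro: less_imp_le)
  also have "\<dots> = card D" unfolding D_def using fin by (subst card_SigmaI) auto
  finally have kk: "k * k \<le> card D" .
  have finD: "finite D" unfolding D_def using fin by auto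
  have "boosters H \<subseteq> Pow Y" unfolding boosters_def by auto
  then have finB: "finite (boosters H)" using finite_Y finite_subset by blast
  have img: "(\<lambda>(v, w). {w, v}) ` D \<subseteq> boosters H"
  proof clarify
    fix v w assume "(v, w) \<in> D"
    then have v: "v \<in> ?R" and w: "w \<in> rotation_ends F H (rev (Z v))" unfolding D_def by auto
    obtain zs where zs: "rotation F H (rev (Z v)) zs" "w = last zs"
      using w unfolding rotation_ends_def by auto
    have r: "forced_path Y F H zs" "length zs = length (rev (Z v))" "hd zs = hd (rev (Z v))"
      using rotation_forced_path[OF zs(1)] L[OF v] unfolding longest_forced_path_def by auto
    have "longest_forced_path Y F H zs" using r L[OF v] unfolding longest_forced_path_def by auto
    then have "{last zs, hd zs} \<in> boosters H" by (rule closing_edge_booster)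
    moreover have "hd zs = v" using r Z[OF v] by (simp add: hd_rev)
    ultimately show "{w, v} \<in> boosters H" using zs by simp
  qed
  have "D \<subseteq> (\<Union>e\<in>boosters H. {(v, w). {w, v} = e})" using img by auto
  moreover have fe: "finite {(v, w). {w, v} = e} \<and> card {(v, w). {w, v} = e} \<le> 2"
    if "e \<in> boosters H" for e
  proof -
    obtain a b where ab: "e = {a, b}" using \<open>e \<in> boosters H\<close> unfolding boosters_def card_2_iff by auto
    then have "{(v, w). {w, v} = e} \<subseteq> {(a, b), (b, a)}" by (auto simp: doubleton_eq_iff)
    then have "finite {(v, w). {w, v} = e}" "card {(v, w). {w, v} = e} \<le> card {(a, b), (b, a)}"
      by (auto intro: finite_subset card_mono)
    moreover have "card {(a, b), (b, a)} \<le> 2"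
      using card_insert_le_m1[of 2 "{(b, a)}" "(a, b)"] by simp
    ultimately show ?thesis by linarith
  qed
  ultimately have "card D \<le> card (\<Union>e\<in>boosters H. {(v, w). {w, v} = e})"
    using finB by (intro card_mono) auto
  also have "\<dots> \<le> (\<Sum>e\<in>boosters H. card {(v, w). {w, v} = e})" by (rule card_UN_le[OF finB])
  also have "\<dots> \<le> (\<Sum>e\<in>boosters H. 2)" using fe by (intro sum_mono) auto
  finally show ?thesis using kk by simp
qed

text \<open>Adding boosters from \<open>G\<close> one at a time lengthens the longest forced path
  each time, so this stops within \<open>card Y\<close> steps. Instead of a sequence, the proof
  takes a largest \<open>T\<close> whose size is at most the length of some forced path of
  \<open>H \<union> T\<close>.\<close>

lemma booster_chain:
  assumes "finite G" "\<not> forced_ham Y F (H \<union> G)"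
  shows "\<exists>T\<subseteq>G. card T \<le> card Y \<and> G \<inter> boosters (H \<union> T) = {}"
proof -
  define Q where "Q T \<longleftrightarrow> T \<subseteq> G \<and> (\<exists>xs. forced_path Y F (H \<union> T) xs \<and> card T \<le> length xs)" for T
  have "Q {}" unfolding Q_def by (auto intro!: exI[of _ "[]"] simp: forced_path_def)
  moreover have bd: "card T \<le> card Y" if "Q T" for T
    using that forced_path_length unfolding Q_def by (meson order_trans)
  moreover have "\<forall>T. Q T \<longrightarrow> card T < Suc (card Y)" using bd le_imp_less_Suc by blast
  ultimately have "\<exists>T. Q T \<and> (\<forall>T'. Q T' \<longrightarrow> card T' \<le> card T)" by (intro ex_has_greatest_nat)
  then obtain T where T: "Q T" and mx: "\<And>T'. Q T' \<Longrightarrow> card T' \<le> card T" by blast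
  have fT: "finite T" using T assms finite_subset unfolding Q_def by blast
  have "G \<inter> boosters (H \<union> T) = {}"
  proof (rule ccontr)
    assume "G \<inter> boosters (H \<union> T) \<noteq> {}"
    then obtain e where e: "e \<in> G" "e \<in> boosters (H \<union> T)" by blast
    have "\<not> forced_ham Y F (insert e (H \<union> T))"
    proof
      assume "forced_ham Y F (insert e (H \<union> T))"
      then have "forced_ham Y F (H \<union> G)"
        by (rule forced_ham_mono) (use e T in \<open>auto simp: Q_def\<close>)
      then show False using assms by simp
    qed
    then have b: "\<And>l xs. forced_path Y F (H \<union> T) xs \<Longrightarrow> l \<le> length xs \<Longrightarrow>
       \<exists>xs. forced_path Y F (insert e (H \<union> T)) xs \<and> l < length xs"
      using e unfolding boosters_def by blast
    have ins: "insert e (H \<union> T) = H \<union> insert e T" by auto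
    show False
    proof (cases "e \<in> H \<union> T")
      case True
      \<comment> \<open>A booster that is already present would make the longest path shorter than
        another one.\<close>
      then have "insert e (H \<union> T) = H \<union> T" by auto
      then have b': "\<And>xs. forced_path Y F (H \<union> T) xs \<Longrightarrow>
        \<exists>ys. forced_path Y F (H \<union> T) ys \<and> length xs < length ys" using b by (metis order_refl)
      obtain xs where "longest_forced_path Y F (H \<union> T) xs"
        using posa.longest_exists[OF posa_mono[of "H \<union> T"]] by auto
      then show False using b' unfolding longest_forced_path_def by (meson leD)
    next
      case False
      obtain xs where "forced_path Y F (H \<union> T) xs" "card T \<le> length xs" using T unfolding Q_def by auto
      from b[OF this] obtain ys where "forced_path Y F (H \<union> insert e T) ys" "card T < length ys"
        unfolding ins by blast
      then have "Q (insert e T)" using T e fT False unfolding Q_def by auto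
      then show False using mx[of "insert e T"] fT False by auto
    qed
  qed
  then show ?thesis using T bd unfolding Q_def by blast
qed

end

section \<open>From forced Hamilton cycles to colour profiles\<close>

text \<open>Cutting the forced edge \<open>{a, b}\<close> out of the cycle leaves a Hamilton path
  with prescribed ends. Applied to the two junctions of a colour, this is where the artificial
  junction edge disappears.\<close>

lemma forced_ham_cut:
  assumes "forced_ham Y F H" "{a, b} \<in> F" "\<And>e. e \<in> F \<Longrightarrow> e \<noteq> {} \<and> e \<subseteq> Y"
  shows "\<exists>ps. distinct ps \<and> set ps = Y \<and> ps \<noteq> [] \<and> hd ps = a \<and> last ps = b \<and>
    set (path_edges ps) \<subseteq> H \<union> (F - {{a, b}}) \<and> F - {{a, b}} \<subseteq> set (path_edges ps)"
proof -
  obtain xs where xs: "forced_path Y F H xs" "set xs = Y" "{last xs, hd xs} \<in> H"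
    using assms(1) unfolding forced_ham_def by auto
  have d: "distinct xs" and sub: "set (path_edges xs) \<subseteq> H \<union> F" using xs unfolding forced_path_def by auto
  have FF: "F \<subseteq> set (path_edges xs)"
  proof
    fix e assume "e \<in> F"
    then have "e \<inter> set xs \<noteq> {}" using assms(3)[of e] xs(2) by auto
    then show "e \<in> set (path_edges xs)" using xs(1) \<open>e \<in> F\<close> unfolding forced_path_def by auto
  qed
  obtain as x y bs where s: "xs = as @ x # y # bs" and ab: "{a, b} = {x, y}"
    using path_edges_split[of "{a, b}" xs] FF assms(2) by blast
  define ps where "ps = (y # bs) @ (as @ [x])"
  have p: "set (path_edges ps) = set (path_edges (y # bs)) \<union> {{last xs, hd xs}} \<union> set (path_edges (as @ [x]))"
    unfolding ps_def s by (subst path_edges_append) (auto simp: hd_append)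
  have "path_edges xs = path_edges (as @ [x]) @ {x, y} # path_edges (y # bs)"
    unfolding s using path_edges_append[of "as @ [x]" "y # bs"] by simp
  then have q: "set (path_edges xs) = set (path_edges (as @ [x])) \<union> {{x, y}} \<union> set (path_edges (y # bs))"
    by auto
  have n: "{x, y} \<notin> set (path_edges (as @ [x]))" "{x, y} \<notin> set (path_edges (y # bs))"
    using d path_edges_subset[of "{x,y}" "as @ [x]"] path_edges_subset[of "{x,y}" "y # bs"]
    unfolding s by auto
  have 1: "set (path_edges ps) \<subseteq> H \<union> (F - {{a, b}})" "F - {{a, b}} \<subseteq> set (path_edges ps)"
    using sub FF n xs(3) unfolding p q ab by auto
  have 2: "distinct ps" "set ps = Y" "ps \<noteq> []" "hd ps = y" "last ps = x"
    using d xs(2) unfolding ps_def s by auto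
  from ab consider "a = y" "b = x" | "a = x" "b = y" by (auto simp: doubleton_eq_iff)
  then show ?thesis
  proof cases
    case 1
    then show ?thesis using \<open>set (path_edges ps) \<subseteq> H \<union> (F - {{a, b}})\<close> \<open>F - {{a, b}} \<subseteq> set (path_edges ps)\<close> 2
      by (intro exI[of _ ps]) simp
  next
    case 2
    then show ?thesis using 1 \<open>distinct ps\<close> \<open>set ps = Y\<close> \<open>ps \<noteq> []\<close> \<open>hd ps = y\<close> \<open>last ps = x\<close>
      by (intro exI[of _ "rev ps"]) (simp add: path_edges_rev hd_rev last_rev)
  qed
qed

text \<open>Undoes the contraction by inserting \<open>v\<close> between \<open>x v\<close> and
  \<open>y v\<close>. The contracted edges are removed from the bound on the new edge set because
  they need not be edges of the graph; the last assumption keeps each of them from being subdivided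
  twice.\<close>

lemma subdivide_path:
  assumes "finite Z" "distinct ps" "ps \<noteq> []" "Z \<inter> set ps = {}"
    and "\<And>v. v \<in> Z \<Longrightarrow> {x v, y v} \<in> set (path_edges ps)"
    and "\<And>v w. v \<in> Z \<Longrightarrow> w \<in> Z \<Longrightarrow> {x v, y v} = {x w, y w} \<Longrightarrow> v = w"
  shows "\<exists>qs. distinct qs \<and> qs \<noteq> [] \<and> set qs = set ps \<union> Z \<and> hd qs = hd ps \<and> last qs = last ps \<and>
    set (path_edges qs) \<subseteq> (set (path_edges ps) - (\<lambda>v. {x v, y v}) ` Z) \<union> (\<Union>v\<in>Z. {{v, x v}, {v, y v}})"
  using assms
proof (induction Z arbitrary: ps rule: finite_induct)
  case empty
  then show ?case by (intro exI[of _ ps]) auto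
next
  case (insert v Z)
  obtain as a b bs where s: "ps = as @ a # b # bs" and ab: "{x v, y v} = {a, b}"
    using path_edges_split[of "{x v, y v}" ps] insert.prems(4)[of v] by auto
  define ps' where "ps' = as @ a # v # b # bs"
  have "path_edges ps = path_edges (as @ [a]) @ {a, b} # path_edges (b # bs)"
    unfolding s using path_edges_append[of "as @ [a]" "b # bs"] by simp
  then have p: "set (path_edges ps) = set (path_edges (as @ [a])) \<union> {{a, b}} \<union> set (path_edges (b # bs))"
    by auto
  have "path_edges ps' = path_edges (as @ [a]) @ {a, v} # {v, b} # path_edges (b # bs)"
    unfolding ps'_def using path_edges_append[of "as @ [a]" "v # b # bs"] by simp
  then have p': "set (path_edges ps') = set (path_edges (as @ [a])) \<union> {{a, v}, {v, b}} \<union> set (path_edges (b # bs))"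
    by auto
  have n: "{a, b} \<notin> set (path_edges (as @ [a]))" "{a, b} \<notin> set (path_edges (b # bs))"
    using insert.prems(1) path_edges_subset[of "{a,b}" "as @ [a]"] path_edges_subset[of "{a,b}" "b # bs"]
    unfolding s by auto
  have "\<exists>qs. distinct qs \<and> qs \<noteq> [] \<and> set qs = set ps' \<union> Z \<and> hd qs = hd ps' \<and> last qs = last ps' \<and>
    set (path_edges qs) \<subseteq> (set (path_edges ps') - (\<lambda>v. {x v, y v}) ` Z) \<union> (\<Union>v\<in>Z. {{v, x v}, {v, y v}})"
  proof (rule insert.IH)
    show "distinct ps'" using insert.prems(1,3) unfolding ps'_def s by auto
    show "Z \<inter> set ps' = {}" using insert.prems(3) insert.hyps unfolding ps'_def s by auto
    fix w assume w: "w \<in> Z"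
    then have "{x w, y w} \<noteq> {a, b}" using insert.prems(5)[of v w] insert.hyps ab by auto
    then show "{x w, y w} \<in> set (path_edges ps')" using insert.prems(4)[of w] w unfolding p p' by auto
  qed (use insert.prems in \<open>auto simp: ps'_def\<close>)
  then obtain qs where qs: "distinct qs" "qs \<noteq> []" "set qs = set ps' \<union> Z" "hd qs = hd ps'" "last qs = last ps'"
    "set (path_edges qs) \<subseteq> (set (path_edges ps') - (\<lambda>v. {x v, y v}) ` Z) \<union> (\<Union>v\<in>Z. {{v, x v}, {v, y v}})"
    by blast
  have e: "set (path_edges ps') \<subseteq> (set (path_edges ps) - {{x v, y v}}) \<union> {{v, x v}, {v, y v}}"
  proof -
    have "{a, v} \<in> {{v, x v}, {v, y v}}" "{v, b} \<in> {{v, x v}, {v, y v}}"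
      using ab by (auto simp: doubleton_eq_iff insert_commute)
    then show ?thesis using n unfolding p p' ab by auto
  qed
  have "set (path_edges qs) \<subseteq> (set (path_edges ps) - (\<lambda>v. {x v, y v}) ` insert v Z) \<union>
     (\<Union>v\<in>insert v Z. {{v, x v}, {v, y v}})"
  proof
    fix q assume "q \<in> set (path_edges qs)"
    then consider "q \<in> set (path_edges ps')" "q \<notin> (\<lambda>v. {x v, y v}) ` Z" | "q \<in> (\<Union>v\<in>Z. {{v, x v}, {v, y v}})"
      using qs(6) by blast
    then show "q \<in> (set (path_edges ps) - (\<lambda>v. {x v, y v}) ` insert v Z) \<union> (\<Union>v\<in>insert v Z. {{v, x v}, {v, y v}})"
    proof cases
      case 1
      then have "q \<in> set (path_edges ps) \<and> q \<noteq> {x v, y v} \<or> q \<in> {{v, x v}, {v, y v}}" using e by blast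
      then show ?thesis using 1(2) by blast
    qed blast
  qed
  moreover have "set qs = set ps \<union> insert v Z" "hd qs = hd ps" "last qs = last ps"
    using qs unfolding ps'_def s by (auto simp: hd_append)
  ultimately show ?case using qs(1,2) by blast
qed

text \<open>Consecutive paths share one vertex; \<open>butlast\<close> keeps it only once, and no
  edge is lost.\<close>

lemma path_edges_concat:
  assumes "pss \<noteq> []" "\<And>p. p \<in> set pss \<Longrightarrow> 2 \<le> length p"
    and "\<And>j. Suc j < length pss \<Longrightarrow> last (pss ! j) = hd (pss ! Suc j)"
  shows "path_edges (concat (map butlast pss) @ [last (last pss)]) = concat (map path_edges pss)"
  using assms
proof (induction pss)
  case (Cons p pss)
  have p2: "2 \<le> length p" using Cons.prems by auto
  show ?case
  proof (cases pss)
    case Nil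
    then show ?thesis using p2 by (cases p) auto
  next
    case (Cons q qss)
    let ?w = "concat (map butlast pss) @ [last (last pss)]"
    have IH: "path_edges ?w = concat (map path_edges pss)"
    proof (rule Cons.IH)
      fix j assume "Suc j < length pss"
      then show "last (pss ! j) = hd (pss ! Suc j)" using Cons.prems(3)[of "Suc j"] by auto
    qed (use Cons.prems Cons in auto)
    have "2 \<le> length q" using Cons.prems(2)[of q] Cons by auto
    then have "butlast q \<noteq> []" "hd (butlast q) = hd q" by (cases q; auto)+
    then have "hd ?w = hd q" using Cons by auto
    also have "\<dots> = last p" using Cons.prems(3)[of 0] Cons by auto
    finally have h: "hd ?w = last p" .
    have bp: "butlast p \<noteq> []" using p2 by (cases p) auto
    have "path_edges (butlast p @ ?w) = path_edges (butlast p) @ {last (butlast p), last p} # path_edges ?w"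
      using path_edges_append[OF bp, of ?w] h by simp
    also have "\<dots> = path_edges (butlast p @ [last p]) @ path_edges ?w"
      using path_edges_append[OF bp, of "[last p]"] by simp
    also have "butlast p @ [last p] = p" using p2 by (cases p) auto
    finally show ?thesis using IH Cons by simp
  qed
qed simp

lemma cycle_edges_eq: "vs \<noteq> [] \<Longrightarrow> cycle_edges vs = path_edges (vs @ [hd vs])"
proof -
  have *: "path_edges (x # xs @ [z]) = map2 (\<lambda>u v. {u, v}) (x # xs) (xs @ [z])" for x z and xs :: "nat list"
    by (induction xs arbitrary: x) auto
  assume "vs \<noteq> []"
  then obtain x xs where "vs = x # xs" by (cases vs) auto
  then show ?thesis unfolding cycle_edges_def using *[of x xs x] by simp
qed

text \<open>Classes are filled one at a time, avoiding the prescribed parts \<open>B i\<close> of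
  those still to come; these take at most their share of \<open>sum m I\<close>, so enough room is
  left.\<close>

lemma extend_to_partition:
  assumes "finite I" "finite A" "\<And>i. i \<in> I \<Longrightarrow> B i \<subseteq> A" "\<And>i. i \<in> I \<Longrightarrow> card (B i) \<le> m i"
    and "\<And>i j. i \<in> I \<Longrightarrow> j \<in> I \<Longrightarrow> i \<noteq> j \<Longrightarrow> B i \<inter> B j = {}" and "sum m I = card A"
  shows "\<exists>V. (\<forall>i\<in>I. B i \<subseteq> V i \<and> card (V i) = m i) \<and> (\<Union>i\<in>I. V i) = A \<and>
    (\<forall>i\<in>I. \<forall>j\<in>I. i \<noteq> j \<longrightarrow> V i \<inter> V j = {})"
  using assms
proof (induction I arbitrary: A rule: finite_induct)
  case empty
  then show ?case by auto
next
  case (insert j I)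
  let ?R = "\<Union>i\<in>I. B i"
  have Rsub: "?R \<subseteq> A" using insert.prems(2) by auto
  have fin: "finite ?R" using Rsub insert.prems(1) finite_subset by blast
  have "card ?R \<le> (\<Sum>i\<in>I. card (B i))" by (rule card_UN_le[OF insert.hyps(1)])
  also have "\<dots> \<le> sum m I" using insert.prems(3) by (intro sum_mono) auto
  finally have "card ?R + m j \<le> card A" using insert.prems(5) insert.hyps by simp
  then have c: "m j \<le> card (A - ?R)" using card_Diff_subset[OF fin Rsub] by linarith
  have Bj: "B j \<subseteq> A - ?R" using insert.prems(2)[of j] insert.prems(4)[of j] insert.hyps(2) by auto
  have "finite (A - ?R)" using insert.prems(1) by auto
  then obtain Vj where Vj: "B j \<subseteq> Vj" "Vj \<subseteq> A - ?R" "card Vj = m j"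
    using exists_subset_between[of "B j" "m j" "A - ?R"] insert.prems(3)[of j] c Bj by auto
  have "\<exists>V. (\<forall>i\<in>I. B i \<subseteq> V i \<and> card (V i) = m i) \<and> (\<Union>i\<in>I. V i) = A - Vj \<and>
    (\<forall>i\<in>I. \<forall>j\<in>I. i \<noteq> j \<longrightarrow> V i \<inter> V j = {})"
  proof (rule insert.IH)
    have "card (A - Vj) = card A - m j"
      using Vj insert.prems(1) by (metis card_Diff_subset finite_subset Diff_subset order_trans)
    then show "sum m I = card (A - Vj)" using insert.prems(5) insert.hyps by simp
  qed (use insert.prems Vj in auto)
  then obtain V where V: "\<forall>i\<in>I. B i \<subseteq> V i \<and> card (V i) = m i" "(\<Union>i\<in>I. V i) = A - Vj"
    "\<forall>i\<in>I. \<forall>j\<in>I. i \<noteq> j \<longrightarrow> V i \<inter> V j = {}" by (elim exE conjE)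
  let ?V = "V(j := Vj)"
  have e: "\<And>i. i \<in> I \<Longrightarrow> ?V i = V i" using insert.hyps by auto
  have d: "\<And>i. i \<in> I \<Longrightarrow> V i \<inter> Vj = {}" using V(2) by auto
  have "(\<Union>i\<in>I. ?V i) = (\<Union>i\<in>I. V i)" using e by (rule SUP_cong[OF HOL.refl])
  then have "(\<Union>i\<in>insert j I. ?V i) = Vj \<union> (\<Union>i\<in>I. V i)"
    by (simp only: UN_insert fun_upd_same)
  then have "(\<Union>i\<in>insert j I. ?V i) = A" using V(2) Vj(2) by auto
  moreover have "\<forall>i\<in>insert j I. B i \<subseteq> ?V i \<and> card (?V i) = m i" using V(1) Vj e by auto
  moreover have "\<forall>i\<in>insert j I. \<forall>j'\<in>insert j I. i \<noteq> j' \<longrightarrow> ?V i \<inter> ?V j' = {}"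
    using V(3) d e by (auto simp: Int_commute)
  ultimately show ?case by blast
qed

section \<open>Structure of a good first round\<close>

text \<open>From here on one function carries the graph and its colouring: the value 0 means that
  the edge is absent, a positive value is its colour.\<close>

definition nbrs :: "nat \<Rightarrow> (nat set \<Rightarrow> nat) \<Rightarrow> nat \<Rightarrow> nat set" where
  "nbrs n f v = {u \<in> {1..n}. u \<noteq> v \<and> f {v, u} \<noteq> 0}"

definition cnbrs :: "nat \<Rightarrow> (nat set \<Rightarrow> nat) \<Rightarrow> nat \<Rightarrow> nat \<Rightarrow> nat set" where
  "cnbrs n f i v = {u \<in> {1..n}. u \<noteq> v \<and> f {v, u} = i}"

text \<open>\<open>X\<close> is the set of vertices that have few neighbours of some colour \<open>i\<close> in the reservoir \<open>U i\<close>.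
  Sets of at most \<open>k\<close> vertices expand, and two disjoint sets of at least \<open>s\<close> vertices are joined
  in every colour; \<open>b\<close> is a lower bound for the class sizes \<open>m\<^sub>i\<close>.\<close>

locale good_colouring =
  fixes n r :: nat and f :: "nat set \<Rightarrow> nat" and U :: "nat \<Rightarrow> nat set" and X :: "nat set"
    and K1 K2 d k b s :: nat
  assumes r2: "2 \<le> r" and n3: "3 \<le> n"
    and f_le: "\<And>e. e \<in> all_edges n \<Longrightarrow> f e \<le> r"
    and U_sub: "\<And>i. i \<in> {1..r} \<Longrightarrow> U i \<subseteq> {1..n}"
    and U_disj: "\<And>i j. i \<in> {1..r} \<Longrightarrow> j \<in> {1..r} \<Longrightarrow> i \<noteq> j \<Longrightarrow> U i \<inter> U j = {}"
    and X_sub: "X \<subseteq> {1..n}"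
    and mindeg: "\<And>v. v \<in> X \<Longrightarrow> r + 1 \<le> card (nbrs n f v)"
    and star: "\<And>v. v \<in> {1..n} \<Longrightarrow> card (nbrs n f v \<inter> X) \<le> K1"
    and spider: "\<And>v. v \<in> {1..n} \<Longrightarrow> card {z \<in> nbrs n f v - X. \<exists>x\<in>X. x \<noteq> v \<and> z \<in> nbrs n f x} \<le> K2"
    and small: "\<And>v. v \<in> X \<Longrightarrow> card (nbrs n f v) < K1 + K2 + r + 1 \<Longrightarrow>
      nbrs n f v \<inter> X = {} \<and> (\<forall>z\<in>nbrs n f v. \<forall>x\<in>X. z \<in> nbrs n f x \<longrightarrow> x = v)"
    and typical: "\<And>v i. v \<in> {1..n} - X \<Longrightarrow> i \<in> {1..r} \<Longrightarrow> d + K1 + K2 \<le> card (cnbrs n f i v \<inter> U i)"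
    and sparse: "\<And>T. T \<subseteq> {1..n} \<Longrightarrow> T \<noteq> {} \<Longrightarrow> card T \<le> 3 * k \<Longrightarrow>
      6 * card {e \<in> all_edges n. e \<subseteq> T \<and> f e \<noteq> 0} < d * card T"
    and crossing: "\<And>S S' i. S \<subseteq> {1..n} \<Longrightarrow> S' \<subseteq> {1..n} \<Longrightarrow> S \<inter> S' = {} \<Longrightarrow> s \<le> card S \<Longrightarrow> s \<le> card S' \<Longrightarrow>
      i \<in> {1..r} \<Longrightarrow> \<exists>x\<in>S. \<exists>y\<in>S'. f {x, y} = i"
    and k_pos: "1 \<le> k" and k_large: "s + 2 * card X + 2 \<le> k"
    and b_large: "\<And>i. i \<in> {1..r} \<Longrightarrow> card (U i) + 3 * card X + 1 \<le> b"
    and n_large: "card (\<Union>i\<in>{1..r}. U i) + 3 * card X + r \<le> n"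
begin

abbreviation "N \<equiv> nbrs n f"

lemma finite_X: "finite X" using X_sub finite_subset by blast

lemma N_sub: "N v \<subseteq> {1..n}" unfolding nbrs_def by auto

lemma finite_N: "finite (N v)" using N_sub finite_subset by blast

definition private_nbrs :: "nat \<Rightarrow> nat set" where
  "private_nbrs v = {y \<in> N v - X. \<forall>x\<in>X. y \<in> N x \<longrightarrow> x = v}"

text \<open>A vertex of degree at least \<open>K1 + K2 + r + 1\<close> loses at most
  \<open>K1\<close> neighbours in \<open>X\<close> and at most \<open>K2\<close> neighbours shared
  with other vertices of \<open>X\<close>. A vertex of smaller degree cannot afford any loss, and by
  \<open>small\<close> it suffers none.\<close>

lemma card_private_nbrs:
  assumes "v \<in> X"
  shows "r + 1 \<le> card (private_nbrs v)"
proof (cases "card (N v) < K1 + K2 + r + 1")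
  case True
  then have "private_nbrs v = N v" using small[OF assms] unfolding private_nbrs_def by auto
  then show ?thesis using mindeg[OF assms] by simp
next
  case False
  let ?Z = "{z \<in> N v - X. \<exists>x\<in>X. x \<noteq> v \<and> z \<in> N x}"
  have v: "v \<in> {1..n}" using assms X_sub by auto
  have "N v \<subseteq> private_nbrs v \<union> (N v \<inter> X) \<union> ?Z" unfolding private_nbrs_def by auto
  moreover have fin: "finite (private_nbrs v)" "finite (N v \<inter> X)" "finite ?Z"
    using finite_N unfolding private_nbrs_def by auto
  ultimately have "card (N v) \<le> card (private_nbrs v \<union> (N v \<inter> X) \<union> ?Z)"
    by (intro card_mono) auto
  also have "\<dots> \<le> card (private_nbrs v \<union> (N v \<inter> X)) + card ?Z" by (rule card_Un_le)
  also have "\<dots> \<le> card (private_nbrs v) + card (N v \<inter> X) + card ?Z" using card_Un_le by simp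
  finally show ?thesis using False star[OF v] spider[OF v] by linarith
qed

text \<open>Pigeonhole: two of the \<open>r + 1\<close> private neighbours are joined to \<open>v\<close> in the same colour. This is
  where the minimum degree \<open>r + 1\<close>, hence the term \<open>r log log n\<close> in the threshold, is needed.\<close>

lemma cherry_exists:
  assumes "v \<in> X"
  shows "\<exists>i x y. i \<in> {1..r} \<and> x \<noteq> y \<and> x \<in> private_nbrs v \<and> y \<in> private_nbrs v \<and> f {v, x} = i \<and> f {v, y} = i"
proof -
  have "(\<lambda>u. f {v, u}) ` private_nbrs v \<subseteq> {1..r}"
  proof
    fix c assume "c \<in> (\<lambda>u. f {v, u}) ` private_nbrs v"
    then obtain u where u: "u \<in> {1..n}" "u \<noteq> v" "f {v, u} \<noteq> 0" "c = f {v, u}"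
      unfolding private_nbrs_def nbrs_def by auto
    have "{v, u} \<in> all_edges n" unfolding all_edges_def using u assms X_sub by auto
    then show "c \<in> {1..r}" using f_le[of "{v, u}"] u by auto
  qed
  then have "\<not> inj_on (\<lambda>u. f {v, u}) (private_nbrs v)"
    using card_private_nbrs[OF assms] card_inj_on_le[of "\<lambda>u. f {v, u}" "private_nbrs v" "{1..r}"] by auto
  then obtain x y where xy: "x \<in> private_nbrs v" "y \<in> private_nbrs v" "f {v, x} = f {v, y}" "x \<noteq> y"
    unfolding inj_on_def by auto
  moreover have "f {v, x} \<in> {1..r}" using \<open>(\<lambda>u. f {v, u}) ` private_nbrs v \<subseteq> {1..r}\<close> xy by blast
  ultimately show ?thesis by metis
qed

definition cherry :: "nat \<Rightarrow> nat \<times> nat \<times> nat" where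
  "cherry v = (SOME (i, x, y). i \<in> {1..r} \<and> x \<noteq> y \<and> x \<in> private_nbrs v \<and> y \<in> private_nbrs v \<and> f {v, x} = i \<and> f {v, y} = i)"
definition "cc v = fst (cherry v)"
definition "cx v = fst (snd (cherry v))"
definition "cy v = snd (snd (cherry v))"

lemma cherry:
  assumes "v \<in> X"
  shows "cc v \<in> {1..r}" "cx v \<noteq> cy v" "cx v \<in> private_nbrs v" "cy v \<in> private_nbrs v"
    "f {v, cx v} = cc v" "f {v, cy v} = cc v"
proof -
  have "case cherry v of (i, x, y) \<Rightarrow> i \<in> {1..r} \<and> x \<noteq> y \<and> x \<in> private_nbrs v \<and> y \<in> private_nbrs v \<and> f {v, x} = i \<and> f {v, y} = i"
    unfolding cherry_def using cherry_exists[OF assms]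
    by (intro someI_ex[of "\<lambda>(i, x, y). i \<in> {1..r} \<and> x \<noteq> y \<and> x \<in> private_nbrs v \<and> y \<in> private_nbrs v \<and> f {v, x} = i \<and> f {v, y} = i"]) auto
  then show "cc v \<in> {1..r}" "cx v \<noteq> cy v" "cx v \<in> private_nbrs v" "cy v \<in> private_nbrs v"
    "f {v, cx v} = cc v" "f {v, cy v} = cc v"
    unfolding cc_def cx_def cy_def by (auto split: prod.splits)
qed

text \<open>Privacy gives each end a unique owner in \<open>X\<close>, so the contracted paths form
  a matching.\<close>

lemma private_nbrs_disjoint:
  assumes "v \<in> X" "z \<in> private_nbrs v" "z \<in> private_nbrs w"
  shows "v = w"
proof -
  have "z \<in> N v" using assms(2) unfolding private_nbrs_def by simp
  moreover have "\<forall>x\<in>X. z \<in> N x \<longrightarrow> x = w" using assms(3) unfolding private_nbrs_def by simp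
  ultimately show ?thesis using assms(1) by simp
qed

definition "ends = cx ` X \<union> cy ` X"

lemma ends_owner:
  assumes "z \<in> ends"
  shows "\<exists>v\<in>X. z \<in> private_nbrs v"
proof -
  obtain v where "v \<in> X" "z = cx v \<or> z = cy v" using assms unfolding ends_def by auto
  then show ?thesis using cherry(3)[of v] cherry(4)[of v] by auto
qed

lemma ends_sub: "ends \<subseteq> {1..n} - X"
proof
  fix z assume "z \<in> ends"
  then obtain v where "z \<in> private_nbrs v" using ends_owner by auto
  then show "z \<in> {1..n} - X" using N_sub[of v] unfolding private_nbrs_def by auto
qed

lemma finite_ends: "finite ends" unfolding ends_def using finite_X by auto

lemma card_ends: "card ends \<le> 2 * card X"
proof -
  have "card ends \<le> card (cx ` X) + card (cy ` X)" unfolding ends_def by (rule card_Un_le)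
  also have "\<dots> \<le> 2 * card X" using card_image_le[OF finite_X, of cx] card_image_le[OF finite_X, of cy] by simp
  finally show ?thesis .
qed

text \<open>The ends are taken out because each of them must go to the class of its owner's colour,
  which need not be \<open>i\<close>.\<close>

definition "core i = U i - X - ends"

text \<open>An end adjacent to \<open>v\<close> is a private neighbour of some vertex of
  \<open>X\<close> other than \<open>v\<close>, hence among the at most \<open>K2\<close> vertices
  counted by \<open>spider\<close>. So passing from \<open>U i\<close> to \<open>core i\<close>
  costs at most \<open>K1 + K2\<close>.\<close>

lemma card_core_nbrs:
  assumes "v \<in> {1..n} - X" "i \<in> {1..r}"
  shows "d \<le> card (cnbrs n f i v \<inter> core i)"
proof -
  let ?Z = "{z \<in> N v - X. \<exists>x\<in>X. x \<noteq> v \<and> z \<in> N x}"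
  let ?A = "cnbrs n f i v \<inter> U i"
  have sub: "cnbrs n f i v \<subseteq> N v" using assms unfolding cnbrs_def nbrs_def by auto
  have fin: "finite (cnbrs n f i v)" unfolding cnbrs_def by auto
  have "?A \<subseteq> (cnbrs n f i v \<inter> core i) \<union> (N v \<inter> X) \<union> ?Z"
  proof
    fix z assume z: "z \<in> ?A"
    show "z \<in> (cnbrs n f i v \<inter> core i) \<union> (N v \<inter> X) \<union> ?Z"
    proof (cases "z \<in> ends")
      case True
      then obtain x where "x \<in> X" "z \<in> private_nbrs x" using ends_owner by auto
      then show ?thesis using z sub assms(1) unfolding private_nbrs_def by auto
    next
      case False
      then show ?thesis using z sub unfolding core_def by auto
    qed
  qed
  then have "card ?A \<le> card ((cnbrs n f i v \<inter> core i) \<union> (N v \<inter> X) \<union> ?Z)"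
    using fin finite_N by (intro card_mono) auto
  also have "\<dots> \<le> card ((cnbrs n f i v \<inter> core i) \<union> (N v \<inter> X)) + card ?Z" by (rule card_Un_le)
  also have "\<dots> \<le> card (cnbrs n f i v \<inter> core i) + card (N v \<inter> X) + card ?Z" using card_Un_le by simp
  finally show ?thesis using typical[OF assms] star[of v] spider[of v] assms(1) by simp
qed

lemma junctions_exist:
  "\<exists>a. inj_on a {1..r} \<and> a ` {1..r} \<subseteq> {1..n} - (\<Union>i\<in>{1..r}. U i) - X - ends"
proof -
  let ?W = "{1..n} - (\<Union>i\<in>{1..r}. U i) - X - ends"
  let ?D = "(\<Union>i\<in>{1..r}. U i) \<union> X \<union> ends"
  have "card ?D \<le> card (\<Union>i\<in>{1..r}. U i) + card X + card ends"
    using card_Un_le[of "(\<Union>i\<in>{1..r}. U i) \<union> X" ends] card_Un_le[of "\<Union>i\<in>{1..r}. U i" X] by linarith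
  then have "card ?D + r \<le> n" using card_ends n_large by linarith
  moreover have "?D \<subseteq> {1..n}" using U_sub X_sub ends_sub by blast
  moreover have "?W = {1..n} - ?D" by auto
  ultimately have "r \<le> card ?W" using card_Diff_subset[of ?D "{1..n}"] finite_subset[of ?D "{1..n}"] by simp
  then obtain f where "f ` {1..r} \<subseteq> ?W" "inj_on f {1..r}"
    using card_le_inj[of "{1..r}" ?W] by auto
  then show ?thesis by blast
qed

definition "junction = (SOME a. inj_on a {1..r} \<and> a ` {1..r} \<subseteq> {1..n} - (\<Union>i\<in>{1..r}. U i) - X - ends)"

lemma junction:
  "inj_on junction {1..r}" "\<And>i. i \<in> {1..r} \<Longrightarrow> junction i \<in> {1..n} - (\<Union>i\<in>{1..r}. U i) - X - ends"
proof -
  have "inj_on junction {1..r} \<and> junction ` {1..r} \<subseteq> {1..n} - (\<Union>i\<in>{1..r}. U i) - X - ends"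
    unfolding junction_def using junctions_exist by (rule someI_ex)
  then show "inj_on junction {1..r}" "\<And>i. i \<in> {1..r} \<Longrightarrow> junction i \<in> {1..n} - (\<Union>i\<in>{1..r}. U i) - X - ends"
    by blast+
qed

definition "succ_colour i = (if i = r then 1 else Suc i)"

lemma succ_colour: "i \<in> {1..r} \<Longrightarrow> succ_colour i \<in> {1..r}" "i \<in> {1..r} \<Longrightarrow> succ_colour i \<noteq> i"
  using r2 unfolding succ_colour_def by auto

definition "owned i = {v \<in> X. cc v = i}"

text \<open>The vertices whose class is settled before the profile is known.\<close>

definition "base i = core i \<union> owned i \<union> cx ` owned i \<union> cy ` owned i \<union> {junction i}"

lemma owned_sub: "owned i \<subseteq> X" and finite_owned: "finite (owned i)"
  unfolding owned_def using finite_X by auto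

lemma base_sub: "i \<in> {1..r} \<Longrightarrow> base i \<subseteq> {1..n}"
proof
  fix z assume i: "i \<in> {1..r}" and "z \<in> base i"
  then consider "z \<in> core i" | "z \<in> owned i" | "z \<in> ends" | "z = junction i"
    unfolding base_def ends_def owned_def by auto
  then show "z \<in> {1..n}"
  proof cases
    case 1 then show ?thesis using U_sub[OF i] unfolding core_def by auto
  next
    case 2 then show ?thesis using X_sub unfolding owned_def by auto
  next
    case 3 then show ?thesis using ends_sub by auto
  next
    case 4 then show ?thesis using junction(2)[OF i] by simp
  qed
qed

lemma card_base:
  assumes "i \<in> {1..r}"
  shows "card (base i) \<le> b"
proof -
  have o: "card (owned i) \<le> card X" using owned_sub finite_X by (intro card_mono)
  have "card (base i) \<le> card (core i) + card (owned i) + card (cx ` owned i) + card (cy ` owned i) + 1"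
    unfolding base_def
    using card_Un_le[of "core i \<union> owned i \<union> cx ` owned i \<union> cy ` owned i" "{junction i}"]
      card_Un_le[of "core i \<union> owned i \<union> cx ` owned i" "cy ` owned i"]
      card_Un_le[of "core i \<union> owned i" "cx ` owned i"] card_Un_le[of "core i" "owned i"] by simp
  also have "card (cx ` owned i) \<le> card X" using card_image_le[OF finite_owned] o le_trans by blast
  also have "card (cy ` owned i) \<le> card X" using card_image_le[OF finite_owned] o le_trans by blast
  also have "card (core i) \<le> card (U i)" unfolding core_def
    using finite_subset[OF U_sub[OF assms]] by (intro card_mono) auto
  finally show ?thesis using o b_large[OF assms] by linarith
qed

lemma owned_ends: "v \<in> owned i \<Longrightarrow> cx v \<in> ends" "v \<in> owned i \<Longrightarrow> cy v \<in> ends"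
  using owned_sub unfolding ends_def by auto

lemma cherry_ends_owner:
  assumes "v \<in> X" "w \<in> X" "{cx v, cy v} \<inter> {cx w, cy w} \<noteq> {}"
  shows "v = w"
proof -
  obtain z where z: "z = cx v \<or> z = cy v" "z = cx w \<or> z = cy w" using assms(3) by auto
  have "z \<in> private_nbrs v" using z(1) cherry(3,4)[OF assms(1)] by metis
  moreover have "z \<in> private_nbrs w" using z(2) cherry(3,4)[OF assms(2)] by metis
  ultimately show ?thesis using private_nbrs_disjoint[OF assms(1)] by simp
qed

lemma base_disj:
  assumes "i \<in> {1..r}" "j \<in> {1..r}" "i \<noteq> j"
  shows "base i \<inter> base j = {}"
proof -
  have 2: "owned i \<inter> owned j = {}" using assms unfolding owned_def by auto
  have 3: "junction i \<noteq> junction j" using inj_onD[OF junction(1) _ assms(1,2)] assms(3) by blast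
  have XE: "X \<inter> ends = {}" using ends_sub by auto
  \<comment> \<open>Membership in \<open>X\<close> and in \<open>ends\<close>, and for junctions
    also the distance from the reservoirs, tells the four kinds of vertices apart, so only vertices
    of the same kind remain to be compared.\<close>
  have kind: "(z \<in> U l \<and> z \<notin> X \<and> z \<notin> ends) \<or> (z \<in> owned l \<and> z \<in> X \<and> z \<notin> ends) \<or>
      (z \<in> cx ` owned l \<union> cy ` owned l \<and> z \<in> ends \<and> z \<notin> X) \<or>
      (z = junction l \<and> z \<notin> X \<and> z \<notin> ends \<and> z \<notin> U i \<and> z \<notin> U j)"
    if l: "l \<in> {1..r}" and z: "z \<in> base l" for l z
  proof -
    from z consider "z \<in> core l" | "z \<in> owned l" | "z \<in> cx ` owned l \<union> cy ` owned l" | "z = junction l"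
      unfolding base_def by auto
    then show ?thesis
    proof cases
      case 1 then show ?thesis unfolding core_def by simp
    next
      case 2
      then have "z \<in> X" using owned_sub by auto
      then show ?thesis using 2 XE by auto
    next
      case 3
      then have "z \<in> ends" using owned_ends by auto
      then show ?thesis using 3 XE by auto
    next
      case 4
      then show ?thesis using junction(2)[OF l] assms(1,2) by simp
    qed
  qed
  have 4: False if z: "z \<in> cx ` owned i \<union> cy ` owned i" "z \<in> cx ` owned j \<union> cy ` owned j" for z
  proof -
    obtain v where v: "v \<in> owned i" "z = cx v \<or> z = cy v" using z(1) by auto
    obtain w where w: "w \<in> owned j" "z = cx w \<or> z = cy w" using z(2) by auto
    have "v \<in> X" "w \<in> X" using v w unfolding owned_def by auto
    then have "v = w" using cherry_ends_owner[of v w] v w by auto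
    then show False using v w 2 by auto
  qed
  have 5: False if "z \<in> U i" "z \<in> U j" for z using U_disj[OF assms] that by auto
  have 6: False if "z \<in> owned i" "z \<in> owned j" for z using 2 that by auto
  show ?thesis
  proof (rule ccontr)
    assume "base i \<inter> base j \<noteq> {}"
    then obtain z where z: "z \<in> base i" "z \<in> base j" by auto
    show False
      using kind[OF assms(1) z(1)] kind[OF assms(2) z(2)] 3 4[of z] 5[of z] 6[of z] by argo
  qed
qed

lemma classes_exist:
  assumes "m \<in> profiles n r" "\<And>i. i \<in> {1..r} \<Longrightarrow> b \<le> m i"
  shows "\<exists>V. (\<forall>i\<in>{1..r}. base i \<subseteq> V i \<and> card (V i) = m i) \<and> (\<Union>i\<in>{1..r}. V i) = {1..n} \<and>
    (\<forall>i\<in>{1..r}. \<forall>j\<in>{1..r}. i \<noteq> j \<longrightarrow> V i \<inter> V j = {})"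
proof (rule extend_to_partition)
  show "\<And>i. i \<in> {1..r} \<Longrightarrow> card (base i) \<le> m i" using card_base assms(2) le_trans by blast
  show "sum m {1..r} = card {1..n}" using assms(1) unfolding profiles_def by auto
qed (use base_sub base_disj in auto)

end

section \<open>Hamilton paths in the classes of one profile\<close>

locale good_classes = good_colouring +
  fixes V :: "nat \<Rightarrow> nat set"
  assumes V_base: "\<And>i. i \<in> {1..r} \<Longrightarrow> base i \<subseteq> V i"
    and V_union: "(\<Union>i\<in>{1..r}. V i) = {1..n}"
    and V_disj: "\<And>i j. i \<in> {1..r} \<Longrightarrow> j \<in> {1..r} \<Longrightarrow> i \<noteq> j \<Longrightarrow> V i \<inter> V j = {}"
begin

text \<open>The edge \<open>{cx v, cy v}\<close> stands for the path \<open>cx v, v, cy v\<close>. The edge joining the two junctions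
  turns the Hamilton path from one junction to the next that is wanted into a Hamilton cycle.\<close>

definition "Y i = (V i - X) \<union> {junction (succ_colour i)}"
definition "F i = (\<lambda>v. {cx v, cy v}) ` owned i \<union> {{junction i, junction (succ_colour i)}}"
definition "H i = {e \<in> all_edges n. e \<subseteq> Y i \<and> f e = i}"

lemma Y_sub: "i \<in> {1..r} \<Longrightarrow> Y i \<subseteq> {1..n} - X"
proof
  fix z assume i: "i \<in> {1..r}" and "z \<in> Y i"
  then consider "z \<in> V i" "z \<notin> X" | "z = junction (succ_colour i)" unfolding Y_def by auto
  then show "z \<in> {1..n} - X"
  proof cases
    case 1 then show ?thesis using V_union i by auto
  next
    case 2 then show ?thesis using junction(2)[OF succ_colour(1)[OF i]] by simp
  qed
qed

lemma finite_Y: "i \<in> {1..r} \<Longrightarrow> finite (Y i)"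
  using Y_sub finite_subset by blast

lemma finite_V: "i \<in> {1..r} \<Longrightarrow> finite (V i)"
  using UN_upper[of i "{1..r}" V] V_union finite_subset[of "V i" "{1..n}"] by simp

lemma junction_V: "i \<in> {1..r} \<Longrightarrow> junction i \<in> V i" using V_base[of i] unfolding base_def by auto

lemma junction_Y: "i \<in> {1..r} \<Longrightarrow> junction i \<in> Y i"
  using junction_V[of i] junction(2)[of i] unfolding Y_def by auto

text \<open>Every vertex of \<open>X\<close> already lies in the base of its own colour and the
  classes are disjoint, so filling up the classes has added none.\<close>

lemma owned_V: "i \<in> {1..r} \<Longrightarrow> V i \<inter> X = owned i"
proof -
  assume i: "i \<in> {1..r}"
  have "owned i \<subseteq> V i \<inter> X" using V_base[OF i] owned_sub unfolding base_def by auto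
  moreover have "V i \<inter> X \<subseteq> owned i"
  proof
    fix v assume v: "v \<in> V i \<inter> X"
    then have c: "cc v \<in> {1..r}" using cherry by auto
    have "v \<in> owned (cc v)" using v unfolding owned_def by auto
    then have "v \<in> V (cc v)" using V_base[OF c] unfolding base_def by auto
    then have "cc v = i" using V_disj[OF c i] v by auto
    then show "v \<in> owned i" using v unfolding owned_def by auto
  qed
  ultimately show ?thesis by auto
qed

lemma ends_Y: "i \<in> {1..r} \<Longrightarrow> v \<in> owned i \<Longrightarrow> cx v \<in> Y i \<and> cy v \<in> Y i"
proof -
  assume i: "i \<in> {1..r}" and v: "v \<in> owned i"
  have "cx v \<in> base i" "cy v \<in> base i" using v unfolding base_def by auto
  moreover have "cx v \<notin> X" "cy v \<notin> X" using owned_ends[OF v] ends_sub by auto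
  ultimately show ?thesis using V_base[OF i] unfolding Y_def by auto
qed

lemma Union_F: "\<Union>(F i) \<subseteq> ends \<union> {junction i, junction (succ_colour i)}"
  using owned_ends unfolding F_def by auto

lemma F_pair:
  assumes "i \<in> {1..r}" "e \<in> F i"
  shows "\<exists>x\<in>Y i. \<exists>y\<in>Y i. x \<noteq> y \<and> e = {x, y}"
proof -
  have "junction (succ_colour i) \<in> Y i" unfolding Y_def by auto
  moreover have "junction i \<noteq> junction (succ_colour i)"
    using junction(1) succ_colour[OF assms(1)] assms(1) unfolding inj_on_def by metis
  ultimately have "\<exists>x\<in>Y i. \<exists>y\<in>Y i. x \<noteq> y \<and> {junction i, junction (succ_colour i)} = {x, y}"
    using junction_Y[OF assms(1)] by blast
  moreover have "\<exists>x\<in>Y i. \<exists>y\<in>Y i. x \<noteq> y \<and> {cx v, cy v} = {x, y}" if "v \<in> owned i" for v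
    using ends_Y[OF assms(1) that] cherry(2)[of v] that owned_sub[of i] by blast
  moreover have "e = {junction i, junction (succ_colour i)} \<or> (\<exists>v\<in>owned i. e = {cx v, cy v})"
    using assms(2) unfolding F_def by auto
  ultimately show ?thesis by metis
qed

lemma F_matching:
  assumes i: "i \<in> {1..r}" and e: "e \<in> F i" "e' \<in> F i" "e \<inter> e' \<noteq> {}"
  shows "e = e'"
proof -
  let ?j = "{junction i, junction (succ_colour i)}"
  have j: "?j \<inter> ends = {}" using junction(2)[OF i] junction(2)[OF succ_colour(1)[OF i]] by auto
  have o: "{cx v, cy v} \<subseteq> ends" if "v \<in> owned i" for v using owned_ends that by auto
  have "e = ?j \<or> (\<exists>v\<in>owned i. e = {cx v, cy v})" "e' = ?j \<or> (\<exists>v\<in>owned i. e' = {cx v, cy v})"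
    using e(1,2) unfolding F_def by auto
  then consider "e = ?j" "e' = ?j" | v where "v \<in> owned i" "e = {cx v, cy v}" "e' = ?j"
    | v where "v \<in> owned i" "e' = {cx v, cy v}" "e = ?j"
    | v w where "v \<in> owned i" "w \<in> owned i" "e = {cx v, cy v}" "e' = {cx w, cy w}"
    by metis
  then show ?thesis
  proof cases
    case 1 then show ?thesis by simp
  next
    case 2 then show ?thesis using e(3) o[of v] j by blast
  next
    case 3 then show ?thesis using e(3) o[of v] j by blast
  next
    case 4
    then have "v \<in> X" "w \<in> X" unfolding owned_def by auto
    then have "v = w" using e(3) cherry_ends_owner[of v w] 4 by auto
    then show ?thesis using 4 by simp
  qed
qed

lemma core_Y: "i \<in> {1..r} \<Longrightarrow> core i \<subseteq> Y i - \<Union>(F i)"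
proof -
  assume i: "i \<in> {1..r}"
  have "core i \<subseteq> Y i" using V_base[OF i] unfolding Y_def base_def core_def by auto
  moreover have "core i \<inter> (ends \<union> {junction i, junction (succ_colour i)}) = {}"
    using junction(2)[OF i] junction(2)[OF succ_colour(1)[OF i]] i unfolding core_def by auto
  ultimately show ?thesis using Union_F[of i] by blast
qed

text \<open>If \<open>S\<close> had at most \<open>2 * card S\<close> such neighbours, adjoining
  them would give a set \<open>T\<close> of at most \<open>3 * card S\<close> vertices that contains
  all core neighbours of \<open>S\<close>. Its at least \<open>d * card S / 2\<close> edges are too
  many for \<open>sparse\<close>. Core vertices are unforced, so excluding the forced ones costs no
  degree.\<close>

lemma expansion:
  assumes i: "i \<in> {1..r}" and S: "S \<subseteq> Y i" "S \<noteq> {}" "card S \<le> k"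
  shows "2 * card S < card {u \<in> Y i - S - \<Union>(F i). \<exists>v\<in>S. {u, v} \<in> H i}"
proof (rule ccontr)
  let ?M = "{u \<in> Y i - S - \<Union>(F i). \<exists>v\<in>S. {u, v} \<in> H i}"
  assume "\<not> 2 * card S < card ?M"
  then have M: "card ?M \<le> 2 * card S" by simp
  define T where "T = S \<union> ?M"
  define ET where "ET = {e \<in> all_edges n. e \<subseteq> T \<and> f e \<noteq> 0}"
  have fS: "finite S" using S finite_Y[OF i] finite_subset by blast
  have cT: "card T \<le> 3 * card S" unfolding T_def using card_Un_le[of S ?M] M by linarith
  have Tsub: "T \<subseteq> Y i" unfolding T_def using S by auto
  then have Tn: "T \<subseteq> {1..n}" using Y_sub[OF i] by auto
  have fT: "finite T" using Tn finite_subset by blast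
  have "ET \<subseteq> Pow T" unfolding ET_def by auto
  then have fET: "finite ET" using fT finite_subset by blast
  have deg: "d \<le> card {e \<in> ET. v \<in> e}" if v: "v \<in> S" for v
  proof -
    have vT: "v \<in> {1..n} - X" using v S Y_sub[OF i] by auto
    let ?C = "cnbrs n f i v \<inter> core i"
    have C: "u \<in> T \<and> {v, u} \<in> ET" if u: "u \<in> ?C" for u
    proof -
      have u': "u \<noteq> v" "f {v, u} = i" "u \<in> {1..n}" "u \<in> Y i - \<Union>(F i)"
        using u core_Y[OF i] unfolding cnbrs_def by auto
      then have e: "{v, u} \<in> all_edges n" "{v, u} \<subseteq> Y i" unfolding all_edges_def using vT v S by auto
      then have "{u, v} \<in> H i" unfolding H_def using u' by (auto simp: insert_commute)
      then have "u \<in> T" unfolding T_def using u' v by auto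
      moreover have "v \<in> T" unfolding T_def using v by auto
      ultimately show ?thesis using e u' i unfolding ET_def by auto
    qed
    have "inj_on (\<lambda>u. {v, u}) ?C" by (auto simp: inj_on_def doubleton_eq_iff)
    moreover have "(\<lambda>u. {v, u}) ` ?C \<subseteq> {e \<in> ET. v \<in> e}" using C by auto
    ultimately have "card ?C \<le> card {e \<in> ET. v \<in> e}" using fET by (intro card_inj_on_le) auto
    then show ?thesis using card_core_nbrs[OF vT i] by linarith
  qed
  have "d * card S \<le> (\<Sum>v\<in>S. card {e \<in> ET. v \<in> e})"
    using sum_bounded_below[of S d "\<lambda>v. card {e \<in> ET. v \<in> e}"] deg by (simp add: mult.commute)
  also have "\<dots> = (\<Sum>e\<in>ET. card {v \<in> S. v \<in> e})"
    using fS fET by (intro sum_multicount_gen) auto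
  also have "\<dots> \<le> (\<Sum>e\<in>ET. 2)"
  proof (intro sum_mono)
    fix e assume "e \<in> ET"
    then have "card e = 2" unfolding ET_def all_edges_def by auto
    then have "finite e" by (metis card.infinite zero_neq_numeral)
    then show "card {v \<in> S. v \<in> e} \<le> 2" using card_mono[of e "{v \<in> S. v \<in> e}"] \<open>card e = 2\<close> by auto
  qed
  finally have "d * card S \<le> 2 * card ET" by simp
  moreover have "6 * card ET < d * card T"
    unfolding ET_def using Tn S cT by (intro sparse) (auto simp: T_def)
  moreover have "d * card T \<le> d * (3 * card S)" using cT by (rule mult_le_mono2)
  ultimately show False by linarith
qed

text \<open>For \<open>connect\<close>, a small \<open>S\<close> expands, and a large one is joined
  to the rest of \<open>Y i\<close> by \<open>crossing\<close>; \<open>k_large\<close> makes up for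
  the at most \<open>2 * card X + 2\<close> forced vertices that are taken out of the rest.\<close>

lemma posa: "i \<in> {1..r} \<Longrightarrow> posa (Y i) (F i) (H i) k"
proof
  assume i: "i \<in> {1..r}"
  show "finite (Y i)" using finite_Y[OF i] .
  show "Y i \<noteq> {}" unfolding Y_def by auto
  show "1 \<le> k" by (rule k_pos)
  show "\<And>e. e \<in> F i \<Longrightarrow> \<exists>x\<in>Y i. \<exists>y\<in>Y i. x \<noteq> y \<and> e = {x, y}" using F_pair[OF i] .
  show "\<And>e e'. e \<in> F i \<Longrightarrow> e' \<in> F i \<Longrightarrow> e \<inter> e' \<noteq> {} \<Longrightarrow> e = e'" using F_matching[OF i] .
  show "\<And>S. S \<subseteq> Y i \<Longrightarrow> S \<noteq> {} \<Longrightarrow> card S \<le> k \<Longrightarrow>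
      2 * card S < card {u \<in> Y i - S - \<Union>(F i). \<exists>v\<in>S. {u, v} \<in> H i}" using expansion[OF i] .
  fix S assume S: "S \<subseteq> Y i" "S \<noteq> {}" "k < card (Y i - S)"
  show "\<exists>x\<in>S. \<exists>y\<in>Y i - S - \<Union>(F i). {x, y} \<in> H i"
  proof (cases "card S \<le> k")
    case True
    then have "{u \<in> Y i - S - \<Union>(F i). \<exists>v\<in>S. {u, v} \<in> H i} \<noteq> {}"
      using expansion[OF i S(1,2)] by (metis card.empty not_less0)
    then obtain u v where uv: "u \<in> Y i - S - \<Union>(F i)" "v \<in> S" "{u, v} \<in> H i" by blast
    have "{v, u} \<in> H i" using uv(3) by (simp add: insert_commute)
    then show ?thesis using uv(1,2) by blast
  next
    case False
    let ?S = "Y i - S - \<Union>(F i)"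
    have fU: "finite (\<Union>(F i))" using Union_F[of i] finite_ends finite_subset by (metis finite.emptyI finite.insertI finite_UnI)
    have "card (\<Union>(F i)) \<le> card (ends \<union> {junction i, junction (succ_colour i)})"
      using Union_F finite_ends by (intro card_mono) auto
    also have "\<dots> \<le> card ends + card {junction i, junction (succ_colour i)}" by (rule card_Un_le)
    also have "\<dots> \<le> 2 * card X + 2" using card_ends by (simp add: card_insert_if)
    finally have "s \<le> card ?S" using diff_card_le_card_Diff[OF fU, of "Y i - S"] S(3) k_large by linarith
    moreover have "s \<le> card S" using False k_large by linarith
    ultimately obtain x y where xy: "x \<in> S" "y \<in> ?S" "f {x, y} = i"
      using crossing[of S ?S i] Y_sub[OF i] S(1) i by blast
    then have "x \<noteq> y" by auto
    then have "{x, y} \<in> all_edges n" unfolding all_edges_def using xy S(1) Y_sub[OF i] by auto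
    then have "{x, y} \<in> H i" unfolding H_def using xy S(1) by auto
    then show ?thesis using xy by blast
  qed
qed

text \<open>\<open>g\<close> is the state after both rounds. Cutting the cycle at the junction edge
  and subdividing the other forced edges leaves only edges of colour \<open>i\<close>.\<close>

lemma class_path:
  assumes i: "i \<in> {1..r}" and ext: "\<And>e. f e \<noteq> 0 \<Longrightarrow> g e = f e"
    and ham: "forced_ham (Y i) (F i) (H i \<union> {e \<in> all_edges n. f e = 0 \<and> g e = i})"
  shows "\<exists>ps. distinct ps \<and> ps \<noteq> [] \<and> set ps = V i \<union> {junction (succ_colour i)} \<and> hd ps = junction i \<and>
    last ps = junction (succ_colour i) \<and> set (path_edges ps) \<subseteq> {e \<in> all_edges n. g e = i}"
proof -
  let ?a = "junction i" and ?b = "junction (succ_colour i)"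
  let ?G = "{e \<in> all_edges n. g e = i}"
  have "\<exists>ps. distinct ps \<and> set ps = Y i \<and> ps \<noteq> [] \<and> hd ps = ?a \<and> last ps = ?b \<and>
    set (path_edges ps) \<subseteq> (H i \<union> {e \<in> all_edges n. f e = 0 \<and> g e = i}) \<union> (F i - {{?a, ?b}}) \<and>
    F i - {{?a, ?b}} \<subseteq> set (path_edges ps)"
  proof (rule forced_ham_cut[OF ham])
    show "{?a, ?b} \<in> F i" unfolding F_def by simp
    fix e assume "e \<in> F i"
    then show "e \<noteq> {} \<and> e \<subseteq> Y i" using F_pair[OF i, of e] by auto
  qed
  then obtain ps where ps: "distinct ps" "set ps = Y i" "ps \<noteq> []" "hd ps = ?a" "last ps = ?b"
    and pe: "set (path_edges ps) \<subseteq> (H i \<union> {e \<in> all_edges n. f e = 0 \<and> g e = i}) \<union> (F i - {{?a, ?b}})"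
    "F i - {{?a, ?b}} \<subseteq> set (path_edges ps)" by blast
  have HG: "H i \<union> {e \<in> all_edges n. f e = 0 \<and> g e = i} \<subseteq> ?G"
    using ext i unfolding H_def by auto
  have j: "?a \<notin> ends" using junction(2)[OF i] by auto
  have FF: "F i - {{?a, ?b}} = (\<lambda>v. {cx v, cy v}) ` owned i"
  proof -
    have "{cx v, cy v} \<noteq> {?a, ?b}" if "v \<in> owned i" for v
    proof
      assume eq: "{cx v, cy v} = {?a, ?b}"
      have "?a \<in> {cx v, cy v}" unfolding eq by simp
      then show False using owned_ends[OF that] j by auto
    qed
    then show ?thesis unfolding F_def by auto
  qed
  have "\<exists>qs. distinct qs \<and> qs \<noteq> [] \<and> set qs = set ps \<union> owned i \<and> hd qs = hd ps \<and> last qs = last ps \<and>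
    set (path_edges qs) \<subseteq> (set (path_edges ps) - (\<lambda>v. {cx v, cy v}) ` owned i) \<union> (\<Union>v\<in>owned i. {{v, cx v}, {v, cy v}})"
  proof (rule subdivide_path[OF finite_owned ps(1,3)])
    show "owned i \<inter> set ps = {}" using ps(2) Y_sub[OF i] owned_sub[of i] by auto
    show "\<And>v. v \<in> owned i \<Longrightarrow> {cx v, cy v} \<in> set (path_edges ps)" using pe(2) FF by auto
    fix v w assume "v \<in> owned i" "w \<in> owned i" "{cx v, cy v} = {cx w, cy w}"
    then show "v = w" using cherry_ends_owner[of v w] unfolding owned_def by auto
  qed
  then obtain qs where qs: "distinct qs" "qs \<noteq> []" "set qs = set ps \<union> owned i" "hd qs = hd ps" "last qs = last ps"
    and qe: "set (path_edges qs) \<subseteq> (set (path_edges ps) - (\<lambda>v. {cx v, cy v}) ` owned i) \<union> (\<Union>v\<in>owned i. {{v, cx v}, {v, cy v}})"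
    by blast
  have ch: "{v, cx v} \<in> ?G \<and> {v, cy v} \<in> ?G" if "v \<in> owned i" for v
  proof -
    have v: "v \<in> X" "cc v = i" using that unfolding owned_def by auto
    have c: "z \<in> {1..n} \<and> z \<noteq> v \<and> v \<in> {1..n}" if "z \<in> private_nbrs v" for z
    proof -
      have "z \<in> N v" using that unfolding private_nbrs_def by simp
      then show ?thesis using v(1) X_sub unfolding nbrs_def by auto
    qed
    have "{v, cx v} \<in> all_edges n" "{v, cy v} \<in> all_edges n"
      using c[OF cherry(3)[OF v(1)]] c[OF cherry(4)[OF v(1)]] unfolding all_edges_def by auto
    moreover have "g {v, cx v} = i" "g {v, cy v} = i"
      using cherry(5,6)[OF v(1)] v(2) ext i by auto
    ultimately show ?thesis by auto
  qed
  have "set (path_edges ps) - (\<lambda>v. {cx v, cy v}) ` owned i \<subseteq> ?G"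
    using pe(1) HG unfolding FF by auto
  moreover have "(\<Union>v\<in>owned i. {{v, cx v}, {v, cy v}}) \<subseteq> ?G"
  proof (rule UN_least)
    fix v assume "v \<in> owned i"
    from ch[OF this] show "{{v, cx v}, {v, cy v}} \<subseteq> ?G" by simp
  qed
  ultimately have "set (path_edges qs) \<subseteq> ?G" using order_trans[OF qe] by simp
  moreover have "set qs = V i \<union> {?b}"
    using qs(3) ps(2) owned_V[OF i] unfolding Y_def by auto
  ultimately show ?thesis using qs(1,2,4,5) ps(4,5) by (intro exI[of _ qs]) simp
qed

text \<open>The class paths are glued in the order of the colours. \<open>Q i\<close> has
  \<open>m i + 1\<close> vertices, hence \<open>m i\<close> edges; its last vertex is the next
  junction and belongs to the next class, so \<open>butlast (Q i)\<close> runs exactly through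
  \<open>V i\<close>.\<close>

lemma profile_attained:
  assumes m: "m \<in> profiles n r" "\<And>i. i \<in> {1..r} \<Longrightarrow> card (V i) = m i"
    and ext: "\<And>e. f e \<noteq> 0 \<Longrightarrow> g e = f e"
    and ham: "\<And>i. i \<in> {1..r} \<Longrightarrow> forced_ham (Y i) (F i) (H i \<union> {e \<in> all_edges n. f e = 0 \<and> g e = i})"
  shows "m \<in> hcp n r ({e \<in> all_edges n. g e \<noteq> 0}, g)"
proof -
  define Q where "Q i = (SOME ps. distinct ps \<and> ps \<noteq> [] \<and> set ps = V i \<union> {junction (succ_colour i)} \<and> hd ps = junction i \<and>
    last ps = junction (succ_colour i) \<and> set (path_edges ps) \<subseteq> {e \<in> all_edges n. g e = i})" for i
  have Q: "distinct (Q i)" "Q i \<noteq> []" "set (Q i) = V i \<union> {junction (succ_colour i)}" "hd (Q i) = junction i"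
    "last (Q i) = junction (succ_colour i)" "set (path_edges (Q i)) \<subseteq> {e \<in> all_edges n. g e = i}" if "i \<in> {1..r}" for i
    using someI_ex[OF class_path[OF that ext ham[OF that]]] unfolding Q_def by blast+
  have jn: "junction (succ_colour i) \<notin> V i" if i: "i \<in> {1..r}" for i
    using junction_V[OF succ_colour(1)[OF i]] V_disj[OF succ_colour(1)[OF i] i succ_colour(2)[OF i]] by auto
  have len: "length (Q i) = Suc (m i)" if i: "i \<in> {1..r}" for i
  proof -
    have "finite (V i)" using finite_V[OF i] .
    then have "card (set (Q i)) = Suc (m i)" using Q(3)[OF i] jn[OF i] m(2)[OF i] by simp
    then show ?thesis using distinct_card[OF Q(1)[OF i]] by simp
  qed
  have bl: "butlast (Q i) @ [junction (succ_colour i)] = Q i" if "i \<in> {1..r}" for i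
    using Q(2,5)[OF that] append_butlast_last_id[of "Q i"] by simp
  have sb: "set (butlast (Q i)) = V i" if i: "i \<in> {1..r}" for i
  proof -
    have "distinct (butlast (Q i) @ [junction (succ_colour i)])" using bl[OF i] Q(1)[OF i] by simp
    moreover have "set (butlast (Q i) @ [junction (succ_colour i)]) = V i \<union> {junction (succ_colour i)}"
      using bl[OF i] Q(3)[OF i] by simp
    ultimately have "junction (succ_colour i) \<notin> set (butlast (Q i))"
      "insert (junction (succ_colour i)) (set (butlast (Q i))) = insert (junction (succ_colour i)) (V i)"
      by simp_all
    then show ?thesis using iffD1[OF insert_ident[OF _ jn[OF i]]] by blast
  qed
  \<comment> \<open>Each class contains its junction, so no segment is empty; gluing needs paths
    with at least two vertices.\<close>
  have m1: "1 \<le> m i" if i: "i \<in> {1..r}" for i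
  proof -
    have "finite (V i)" using finite_V[OF i] .
    then show ?thesis using m(2)[OF i] junction_V[OF i] by (metis One_nat_def Suc_leI card_gt_0_iff empty_iff)
  qed
  define L where "L = [1..<Suc r]"
  have setL: "set L = {1..r}" unfolding L_def by auto
  define vs where "vs = concat (map (\<lambda>i. butlast (Q i)) L)"
  have svs: "set vs = {1..n}" unfolding vs_def using sb setL V_union by auto
  have dvs: "distinct vs"
  proof -
    have "distinct (concat (map (\<lambda>i. butlast (Q i)) xs))" if "distinct xs" "set xs \<subseteq> {1..r}" for xs
      using that
    proof (induction xs)
      case (Cons x xs)
      have "set (butlast (Q x)) \<inter> set (concat (map (\<lambda>i. butlast (Q i)) xs)) = {}"
      proof (rule ccontr)
        assume "\<not> ?thesis"
        then obtain z y where "y \<in> set xs" "z \<in> set (butlast (Q x))" "z \<in> set (butlast (Q y))" by auto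
        then have "z \<in> V x \<inter> V y" "x \<noteq> y" "y \<in> {1..r}" "x \<in> {1..r}" using sb Cons.prems by auto
        then show False using V_disj by blast
      qed
      moreover have "distinct (butlast (Q x))" using Q(1)[of x] Cons.prems by (auto intro: distinct_butlast)
      ultimately show ?case using Cons by auto
    qed auto
    then show ?thesis unfolding vs_def using setL by (simp add: L_def)
  qed
  have lvs: "length vs = n" using distinct_card[OF dvs] svs by simp
  define P where "P i = path_edges (Q i)" for i
  have lenP: "length (path_edges xs) = length xs - 1" for xs :: "nat list"
    by (induction xs rule: path_edges.induct) auto
  have hdvs: "hd vs = junction 1"
  proof -
    have 1: "1 \<in> {1..r}" using r2 by auto
    have "butlast (Q 1) \<noteq> []" using len[OF 1] m1[OF 1] by (cases "Q 1") auto
    moreover have "hd (butlast (Q 1)) = hd (Q 1)" using calculation by (cases "Q 1") auto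
    moreover have "L = 1 # [2..<Suc r]" unfolding L_def using r2 by (simp add: upt_conv_Cons numeral_2_eq_2)
    ultimately show ?thesis unfolding vs_def using Q(4)[OF 1] by simp
  qed
  have ce: "cycle_edges vs = concat (map P [1..<Suc r])"
  proof -
    have "path_edges (concat (map butlast (map Q L)) @ [last (last (map Q L))]) = concat (map path_edges (map Q L))"
    proof (rule path_edges_concat)
      show "map Q L \<noteq> []" using r2 unfolding L_def by auto
      fix p assume "p \<in> set (map Q L)"
      then obtain i where "i \<in> {1..r}" "p = Q i" using setL by auto
      then show "2 \<le> length p" using len m1 by fastforce
    next
      fix j assume "Suc j < length (map Q L)"
      then have j: "Suc j < r" unfolding L_def by (simp del: upt_Suc)
      have "L ! j = Suc j" "L ! Suc j = Suc (Suc j)" unfolding L_def using j by (auto simp del: upt_Suc)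
      moreover have "succ_colour (Suc j) = Suc (Suc j)" using j unfolding succ_colour_def by auto
      ultimately show "last (map Q L ! j) = hd (map Q L ! Suc j)"
        using Q(5)[of "Suc j"] Q(4)[of "Suc (Suc j)"] j by (auto simp: L_def simp del: upt_Suc)
    qed
    moreover have "last (map Q L) = Q r" unfolding L_def using r2 by simp
    moreover have "last (Q r) = junction 1" using Q(5)[of r] r2 unfolding succ_colour_def by auto
    ultimately have "path_edges (vs @ [hd vs]) = concat (map P L)"
      unfolding vs_def[symmetric] P_def hdvs by (simp add: vs_def comp_def)
    moreover have "vs \<noteq> []" using lvs n3 by auto
    ultimately show ?thesis using cycle_edges_eq[of vs] unfolding L_def by simp
  qed
  have "set (cycle_edges vs) \<subseteq> {e \<in> all_edges n. g e \<noteq> 0}"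
  proof
    fix e assume "e \<in> set (cycle_edges vs)"
    then obtain i where "i \<in> set L" "e \<in> set (P i)" unfolding ce L_def[symmetric] by auto
    then have "i \<in> {1..r}" "e \<in> set (P i)" using setL by simp_all
    then show "e \<in> {e \<in> all_edges n. g e \<noteq> 0}" using Q(6)[of i] unfolding P_def by auto
  qed
  then have "hamilton_cycle n {e \<in> all_edges n. g e \<noteq> 0} vs"
    unfolding hamilton_cycle_def using lvs n3 dvs svs by auto
  moreover have "\<forall>i\<in>{1..r}. length (P i) = m i \<and> (\<forall>e\<in>set (P i). g e = i)"
    using len lenP Q(6) unfolding P_def by fastforce
  ultimately show ?thesis unfolding hcp_def using m(1) ce by blast
qed

end

text \<open>The interface to the second round. \<open>Y\<close>, \<open>F\<close> and
  \<open>H\<close> depend on \<open>f\<close> and \<open>m\<close> only, so for a fixed profile the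
  failure is covered by \<open>r\<close> events about the random extension \<open>g\<close>, each
  belonging to a fixed \<open>posa\<close> instance.\<close>

lemma (in good_colouring) profile_reduction:
  assumes "m \<in> profiles n r" "\<And>i. i \<in> {1..r} \<Longrightarrow> b \<le> m i"
  shows "\<exists>Y F H. (\<forall>i\<in>{1..r}. posa (Y i) (F i) (H i) k \<and> Y i \<subseteq> {1..n}) \<and>
    (\<forall>g. (\<forall>e. f e \<noteq> 0 \<longrightarrow> g e = f e) \<longrightarrow>
      (\<forall>i\<in>{1..r}. forced_ham (Y i) (F i) (H i \<union> {e \<in> all_edges n. f e = 0 \<and> g e = i})) \<longrightarrow>
      m \<in> hcp n r ({e \<in> all_edges n. g e \<noteq> 0}, g))"
proof -
  obtain V where V: "\<forall>i\<in>{1..r}. base i \<subseteq> V i \<and> card (V i) = m i" "(\<Union>i\<in>{1..r}. V i) = {1..n}"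
    "\<forall>i\<in>{1..r}. \<forall>j\<in>{1..r}. i \<noteq> j \<longrightarrow> V i \<inter> V j = {}"
    using classes_exist[OF assms(1)] assms(2) by blast
  interpret good_classes n r f U X K1 K2 d k b s V
    by unfold_locales (use V in auto)
  have "Y i \<subseteq> {1..n}" if "i \<in> {1..r}" for i using Y_sub[OF that] by auto
  then show ?thesis
    using posa profile_attained[OF assms(1)] V(1) by (intro exI[of _ Y] exI[of _ F] exI[of _ H]) auto
qed

section \<open>Independent edge states\<close>

lemma finite_all_edges [simp]: "finite (all_edges n)"
proof -
  have "all_edges n \<subseteq> Pow {1..n}" unfolding all_edges_def by auto
  then show ?thesis using finite_subset by blast
qed

lemma card_pairs_le:
  assumes "finite T"
  shows "card {e. e \<subseteq> T \<and> card e = 2} \<le> card T * card T"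
proof -
  have "{e. e \<subseteq> T \<and> card e = 2} \<subseteq> (\<lambda>(x, y). {x, y}) ` (T \<times> T)"
  proof
    fix e assume "e \<in> {e. e \<subseteq> T \<and> card e = 2}"
    then obtain x y where "e = {x, y}" "x \<in> T" "y \<in> T" unfolding card_2_iff by auto
    then show "e \<in> (\<lambda>(x, y). {x, y}) ` (T \<times> T)" by auto
  qed
  then have "card {e. e \<subseteq> T \<and> card e = 2} \<le> card (T \<times> T)" using assms by (intro surj_card_le) auto
  then show ?thesis by (simp add: card_cartesian_product)
qed

lemma card_all_edges_le: "card (all_edges n) \<le> n * n"
  using card_pairs_le[of "{1..n}"] unfolding all_edges_def by simp

text \<open>Presence and colour merged into one variable, so that the coloured graph becomes a
  product of independent, identically distributed states.\<close>

definition edge_state :: "nat \<Rightarrow> (nat \<Rightarrow> real) \<Rightarrow> real \<Rightarrow> nat pmf" where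
  "edge_state r \<alpha> p = bind_pmf (bernoulli_pmf p) (\<lambda>b. if b then colour_pmf r \<alpha> else return_pmf 0)"

lemma set_colour_pmf:
  assumes "\<And>i. i \<in> {1..r} \<Longrightarrow> \<alpha> i > 0" "(\<Sum>i=1..r. \<alpha> i) = 1"
  shows "set_pmf (colour_pmf r \<alpha>) = {1..r}"
proof -
  have "pmf (colour_pmf r \<alpha>) i = (if i \<in> {1..r} then \<alpha> i else 0)" for i
    by (rule pmf_colour_pmf) (use assms less_imp_le in auto)
  then show ?thesis using assms(1) unfolding set_pmf_eq by force
qed

text \<open>The colouring is positive on the edge set and 0 elsewhere, so the edge set can be read
  off from its support.\<close>

lemma coloured_gnp_eq:
  assumes "\<And>i. i \<in> {1..r} \<Longrightarrow> \<alpha> i > 0" "(\<Sum>i=1..r. \<alpha> i) = 1"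
  shows "coloured_gnp n p r \<alpha> =
    map_pmf (\<lambda>c. ({e \<in> all_edges n. c e \<noteq> 0}, c)) (Pi_pmf (all_edges n) 0 (\<lambda>_. edge_state r \<alpha> p))"
proof -
  let ?A = "all_edges n" and ?C = "\<lambda>_. colour_pmf r \<alpha>"
  have "Pi_pmf ?A 0 (\<lambda>_. edge_state r \<alpha> p) =
    bind_pmf (Pi_pmf ?A False (\<lambda>_. bernoulli_pmf p)) (\<lambda>b. Pi_pmf ?A 0 (\<lambda>e. if b e then colour_pmf r \<alpha> else return_pmf 0))"
    unfolding edge_state_def by (rule Pi_pmf_bind) simp
  also have "\<dots> = bind_pmf (Pi_pmf ?A False (\<lambda>_. bernoulli_pmf p)) (\<lambda>b. Pi_pmf {e \<in> ?A. b e} 0 ?C)"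
    by (subst Pi_pmf_if_set) simp_all
  finally have 1: "Pi_pmf ?A 0 (\<lambda>_. edge_state r \<alpha> p) =
    bind_pmf (Pi_pmf ?A False (\<lambda>_. bernoulli_pmf p)) (\<lambda>b. Pi_pmf {e \<in> ?A. b e} 0 ?C)" .
  have 2: "map_pmf (\<lambda>c. ({e \<in> ?A. c e \<noteq> 0}, c)) (Pi_pmf {e \<in> ?A. b e} 0 ?C) =
      map_pmf (\<lambda>c. ({e \<in> ?A. b e}, c)) (Pi_pmf {e \<in> ?A. b e} 0 ?C)" for b
  proof (rule map_pmf_cong[OF HOL.refl])
    fix c assume "c \<in> set_pmf (Pi_pmf {e \<in> ?A. b e} 0 ?C)"
    then have "c \<in> PiE_dflt {e \<in> ?A. b e} 0 (\<lambda>_. {1..r})"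
      using set_Pi_pmf[of "{e \<in> ?A. b e}" 0 ?C] set_colour_pmf[OF assms] by (simp add: comp_def)
    then have "{e \<in> ?A. c e \<noteq> 0} = {e \<in> ?A. b e}" unfolding PiE_dflt_def by fastforce
    then show "({e \<in> ?A. c e \<noteq> 0}, c) = ({e \<in> ?A. b e}, c)" by simp
  qed
  show ?thesis
    unfolding coloured_gnp_def gnp_def 1 map_bind_pmf 2 bind_map_pmf
    by (simp add: map_pmf_def)
qed

lemma pmf_edge_state:
  assumes "0 \<le> p" "p \<le> 1"
  shows "pmf (edge_state r \<alpha> p) x = p * pmf (colour_pmf r \<alpha>) x + (1 - p) * indicator {0} x"
  unfolding edge_state_def pmf_bind using assms by (simp add: pmf_return indicator_def)

lemma set_edge_state:
  assumes "\<And>i. i \<in> {1..r} \<Longrightarrow> \<alpha> i > 0" "(\<Sum>i=1..r. \<alpha> i) = 1"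
  shows "set_pmf (edge_state r \<alpha> p) \<subseteq> {0..r}"
  using set_colour_pmf[OF assms] unfolding edge_state_def by (auto split: if_splits)

lemma prob_edge_state_colour:
  assumes "\<And>i. i \<in> {1..r} \<Longrightarrow> \<alpha> i > 0" "(\<Sum>i=1..r. \<alpha> i) = 1" "0 \<le> p" "p \<le> 1" "i \<in> {1..r}"
  shows "measure_pmf.prob (edge_state r \<alpha> p) {i} = \<alpha> i * p"
proof -
  have "pmf (colour_pmf r \<alpha>) i = (if i \<in> {1..r} then \<alpha> i else 0)"
    by (rule pmf_colour_pmf) (use assms less_imp_le in auto)
  then show ?thesis using assms by (simp add: measure_pmf_single pmf_edge_state)
qed

lemma prob_edge_state_present:
  assumes "\<And>i. i \<in> {1..r} \<Longrightarrow> \<alpha> i > 0" "(\<Sum>i=1..r. \<alpha> i) = 1" "0 \<le> p" "p \<le> 1"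
  shows "measure_pmf.prob (edge_state r \<alpha> p) (-{0}) = p"
proof -
  have "pmf (colour_pmf r \<alpha>) 0 = (if 0 \<in> {1..r} then \<alpha> 0 else 0)"
    by (rule pmf_colour_pmf) (use assms less_imp_le in auto)
  then have "measure_pmf.prob (edge_state r \<alpha> p) {0} = 1 - p"
    using assms by (simp add: measure_pmf_single pmf_edge_state)
  then show ?thesis using measure_pmf.prob_compl[of "{0}" "edge_state r \<alpha> p"] by (simp add: Compl_eq_Diff_UNIV)
qed

text \<open>Both rounds use the same colour distribution, so keeping a first-round colour and
  drawing again only for absent edges does not disturb it; an edge stays absent with probability
  \<open>(1 - p1) * (1 - p2)\<close>.\<close>

lemma edge_state_split:
  assumes "\<And>i. i \<in> {1..r} \<Longrightarrow> \<alpha> i > 0" "(\<Sum>i=1..r. \<alpha> i) = 1"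
    and "0 \<le> p1" "p1 \<le> 1" "0 \<le> p2" "p2 \<le> 1" "1 - p = (1 - p1) * (1 - p2)"
  shows "edge_state r \<alpha> p = bind_pmf (edge_state r \<alpha> p1) (\<lambda>s. if s \<noteq> 0 then return_pmf s else edge_state r \<alpha> p2)"
proof (rule pmf_eqI)
  fix x
  let ?g = "\<lambda>s. if s \<noteq> 0 then return_pmf s else edge_state r \<alpha> p2"
  have p: "0 \<le> p" "p \<le> 1"
  proof -
    have "0 \<le> (1 - p1) * (1 - p2)" "(1 - p1) * (1 - p2) \<le> 1" using assms by (auto intro: mult_le_one)
    then show "0 \<le> p" "p \<le> 1" using assms(7) by linarith+
  qed
  have c: "bind_pmf (colour_pmf r \<alpha>) ?g = colour_pmf r \<alpha>"
  proof -
    have "bind_pmf (colour_pmf r \<alpha>) ?g = bind_pmf (colour_pmf r \<alpha>) return_pmf"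
      using set_colour_pmf[OF assms(1,2)] by (intro bind_pmf_cong) auto
    then show ?thesis by (simp add: bind_return_pmf')
  qed
  have "bind_pmf (edge_state r \<alpha> p1) ?g =
    bind_pmf (bernoulli_pmf p1) (\<lambda>b. if b then colour_pmf r \<alpha> else edge_state r \<alpha> p2)"
    unfolding edge_state_def[of r \<alpha> p1] bind_assoc_pmf
    using c by (intro bind_pmf_cong) (auto simp: bind_return_pmf)
  then have "pmf (bind_pmf (edge_state r \<alpha> p1) ?g) x =
      p1 * pmf (colour_pmf r \<alpha>) x + (1 - p1) * pmf (edge_state r \<alpha> p2) x"
    using assms by (simp add: pmf_bind)
  also have "\<dots> = (1 - (1 - p1) * (1 - p2)) * pmf (colour_pmf r \<alpha>) x + (1 - p1) * (1 - p2) * indicator {0} x"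
    unfolding pmf_edge_state[OF assms(5,6)] by algebra
  also have "\<dots> = pmf (edge_state r \<alpha> p) x"
    unfolding pmf_edge_state[OF p] assms(7)[symmetric] by simp
  finally show "pmf (edge_state r \<alpha> p) x = pmf (bind_pmf (edge_state r \<alpha> p1) ?g) x" by simp
qed

section \<open>Bounds for unions, counts and product measures\<close>

text \<open>Either the first draw leaves the good set \<open>G\<close>, or the conditional
  probability of failure is at most \<open>c\<close>.\<close>

lemma prob_bind_le:
  assumes "\<And>x. x \<in> G \<Longrightarrow> x \<in> set_pmf M \<Longrightarrow> measure_pmf.prob (N x) E \<le> c" "0 \<le> c"
  shows "measure_pmf.prob (bind_pmf M N) E \<le> measure_pmf.prob M (- G) + c"
proof -
  have "emeasure (bind_pmf M N) E = (\<integral>\<^sup>+x. emeasure (N x) E \<partial>M)" by simp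
  also have "\<dots> \<le> (\<integral>\<^sup>+x. indicator (- G) x + ennreal c \<partial>M)"
  proof (intro nn_integral_mono_AE, simp add: AE_measure_pmf_iff, intro ballI)
    fix x assume x: "x \<in> set_pmf M"
    show "emeasure (measure_pmf (N x)) E \<le> indicator (- G) x + ennreal c"
    proof (cases "x \<in> G")
      case True
      then show ?thesis using assms(1)[OF True x] assms(2)
        by (simp add: measure_pmf.emeasure_eq_measure ennreal_leI)
    next
      case False
      have "emeasure (measure_pmf (N x)) E \<le> 1" by (rule measure_pmf.emeasure_le_1)
      also have "\<dots> \<le> 1 + ennreal c" by (simp add: add_increasing2)
      finally show ?thesis using False by simp
    qed
  qed
  also have "\<dots> = emeasure M (- G) + ennreal c"
    by (subst nn_integral_add) (auto simp: measure_pmf.emeasure_space_1)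
  also have "\<dots> = ennreal (measure_pmf.prob M (- G) + c)"
    using assms(2) by (simp add: measure_pmf.emeasure_eq_measure ennreal_plus)
  finally have "ennreal (measure_pmf.prob (bind_pmf M N) E) \<le> ennreal (measure_pmf.prob M (- G) + c)"
    by (simp only: measure_pmf.emeasure_eq_measure)
  moreover have "0 \<le> measure_pmf.prob M (- G) + c" using assms(2) by simp
  ultimately show ?thesis by (simp only: ennreal_le_iff)
qed

lemma prob_union_le:
  assumes "finite I" "E \<subseteq> (\<Union>i\<in>I. F i)" "\<And>i. i \<in> I \<Longrightarrow> measure_pmf.prob M (F i) \<le> c"
  shows "measure_pmf.prob M E \<le> real (card I) * c"
proof -
  have "measure_pmf.prob M E \<le> measure_pmf.prob M (\<Union>i\<in>I. F i)"
    using assms(2) by (intro measure_pmf.finite_measure_mono) auto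
  also have "\<dots> \<le> (\<Sum>i\<in>I. measure_pmf.prob M (F i))"
    using assms(1) by (intro measure_pmf.finite_measure_subadditive_finite) auto
  also have "\<dots> \<le> (\<Sum>i\<in>I. c)" using assms(3) by (intro sum_mono) auto
  finally show ?thesis by simp
qed

lemma prob_card_ge:
  assumes "finite I" "0 < c" "\<And>i. i \<in> I \<Longrightarrow> measure_pmf.prob M {f. P i f} \<le> b"
  shows "measure_pmf.prob M {f. c \<le> real (card {i \<in> I. P i f})} \<le> real (card I) * b / c"
proof -
  let ?u = "\<lambda>f. \<Sum>i\<in>I. indicator {f. P i f} f :: real"
  have u: "?u f = real (card {i \<in> I. P i f})" for f
    using assms(1) by (simp add: indicator_def sum.If_cases Int_def)
  have "integrable (measure_pmf M) (\<lambda>f. indicator S f :: real)" for S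
    by (rule measure_pmf.integrable_const_bound[where B = 1]) (auto simp: indicator_def)
  note ind = this
  then have int: "integrable (measure_pmf M) ?u" by (rule Bochner_Integration.integrable_sum)
  have "measure_pmf.prob M {f \<in> space (measure_pmf M). c \<le> ?u f} \<le> measure_pmf.expectation M ?u / c"
    using assms(2) by (intro integral_Markov_inequality_measure[OF int]) (auto intro: sum_nonneg)
  also have "measure_pmf.expectation M ?u = (\<Sum>i\<in>I. measure_pmf.prob M {f. P i f})"
    by (subst Bochner_Integration.integral_sum[OF ind]) auto
  also have "\<dots> \<le> (\<Sum>i\<in>I. b)" using assms(3) by (intro sum_mono) auto
  finally show ?thesis using assms(2) by (simp add: u divide_right_mono)
qed

lemma prob_Pi_pmf_all:
  assumes "finite A" "S \<subseteq> A"
  shows "measure_pmf.prob (Pi_pmf A d q) {f. \<forall>e\<in>S. f e \<in> Q e} = (\<Prod>e\<in>S. measure_pmf.prob (q e) (Q e))"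
proof -
  have "{f. \<forall>e\<in>S. f e \<in> Q e} = Pi A (\<lambda>e. if e \<in> S then Q e else UNIV)"
    using assms(2) unfolding Pi_def by fastforce
  then have "measure_pmf.prob (Pi_pmf A d q) {f. \<forall>e\<in>S. f e \<in> Q e} =
      (\<Prod>e\<in>A. measure_pmf.prob (q e) (if e \<in> S then Q e else UNIV))"
    using measure_Pi_pmf_Pi[OF assms(1)] by metis
  also have "\<dots> = (\<Prod>e\<in>S. measure_pmf.prob (q e) (Q e))"
    using assms by (intro prod.mono_neutral_cong_right) (auto simp: measure_pmf.prob_space)
  finally show ?thesis .
qed

text \<open>Markov's inequality for a weight that factorises over the coordinates; independence
  turns the expectation of the product into a product of expectations.\<close>

lemma prob_Pi_pmf_le_prod:
  fixes h :: "'a \<Rightarrow> 'b \<Rightarrow> real"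
  assumes "finite A" "\<And>e. e \<in> A \<Longrightarrow> finite (set_pmf (q e))" "\<And>e s. 0 \<le> h e s"
    and "\<And>f. f \<in> E \<Longrightarrow> 1 \<le> w * (\<Prod>e\<in>A. h e (f e))" "0 \<le> w"
  shows "measure_pmf.prob (Pi_pmf A d q) E \<le> w * (\<Prod>e\<in>A. measure_pmf.expectation (q e) (h e))"
proof -
  let ?P = "Pi_pmf A d q"
  have fin: "finite (set_pmf ?P)"
    using assms(1,2) by (subst set_Pi_pmf) (auto intro!: finite_PiE_dflt)
  have "measure_pmf.prob ?P E = measure_pmf.expectation ?P (indicator E)" by simp
  also have "\<dots> \<le> measure_pmf.expectation ?P (\<lambda>f. w * (\<Prod>e\<in>A. h e (f e)))"
  proof (intro integral_mono integrable_measure_pmf_finite[OF fin])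
    fix f
    have "0 \<le> w * (\<Prod>e\<in>A. h e (f e))" using assms(3,5) by (intro mult_nonneg_nonneg prod_nonneg) auto
    then show "indicator E f \<le> w * (\<Prod>e\<in>A. h e (f e))" using assms(4)[of f] by (auto simp: indicator_def)
  qed
  also have "\<dots> = w * (\<Prod>e\<in>A. measure_pmf.expectation (q e) (h e))"
    using assms by (subst integral_mult_right_zero, subst expectation_prod_Pi_pmf)
      (auto intro: integrable_measure_pmf_finite)
  finally show ?thesis .
qed

text \<open>Chernoff's method, applied simultaneously to disjoint blocks of coordinates.\<close>

lemma prob_present_and_deficient:
  fixes q :: "nat pmf" and z t :: "'v \<Rightarrow> real"
  assumes fin: "finite A" "finite (set_pmf q)" "finite D" and A0: "A0 \<subseteq> A"
    and S: "\<And>x. x \<in> D \<Longrightarrow> S x \<subseteq> A" "\<And>x. x \<in> D \<Longrightarrow> S x \<inter> A0 = {}"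
      "\<And>x y. x \<in> D \<Longrightarrow> y \<in> D \<Longrightarrow> x \<noteq> y \<Longrightarrow> S x \<inter> S y = {}"
    and z: "\<And>x. x \<in> D \<Longrightarrow> 0 < z x \<and> z x \<le> 1"
  shows "measure_pmf.prob (Pi_pmf A d (\<lambda>_. q))
      {f. (\<forall>e\<in>A0. f e \<noteq> 0) \<and> (\<forall>x\<in>D. real (card {e \<in> S x. f e \<in> Q x}) \<le> t x)}
    \<le> measure_pmf.prob q (-{0}) ^ card A0 *
      (\<Prod>x\<in>D. z x powr (- t x) * exp (- ((1 - z x) * measure_pmf.prob q (Q x) * real (card (S x)))))"
proof -
  \<comment> \<open>Each hit in \<open>S x\<close> contributes \<open>z x\<close> to the weight, and
    an absent edge of \<open>A0\<close> contributes 0. Since \<open>z x \<le> 1\<close> and there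
    are at most \<open>t x\<close> hits, \<open>w\<close> lifts the weight to at least 1 on the
    event.\<close>
  define g where "g e s x = (if e \<in> S x \<and> s \<in> Q x then z x else 1)" for e s x
  define h where "h e s = (if e \<in> A0 \<and> s = 0 then 0 else 1) * (\<Prod>x\<in>D. g e s x)" for e and s :: nat
  define w where "w = (\<Prod>x\<in>D. z x powr (- t x))"
  let ?E = "{f. (\<forall>e\<in>A0. f e \<noteq> 0) \<and> (\<forall>x\<in>D. real (card {e \<in> S x. f e \<in> Q x}) \<le> t x)}"
  let ?p = "measure_pmf.prob q (-{0})"
  let ?b = "\<lambda>x. exp (- ((1 - z x) * measure_pmf.prob q (Q x)))"
  have g0: "0 \<le> g e s x" if "x \<in> D" for e s x using z[OF that] unfolding g_def by auto
  have "measure_pmf.prob (Pi_pmf A d (\<lambda>_. q)) ?E \<le> w * (\<Prod>e\<in>A. measure_pmf.expectation q (h e))"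
  proof (rule prob_Pi_pmf_le_prod[OF fin(1)])
    show "finite (set_pmf q)" by (rule fin)
    show "0 \<le> h e s" for e s unfolding h_def using g0 by (auto intro!: prod_nonneg)
    show "0 \<le> w" unfolding w_def by (intro prod_nonneg) auto
    fix f assume f: "f \<in> ?E"
    have "(\<Prod>e\<in>A. h e (f e)) = (\<Prod>e\<in>A. \<Prod>x\<in>D. g e (f e) x)"
      unfolding h_def using f by (intro prod.cong) auto
    also have "\<dots> = (\<Prod>x\<in>D. \<Prod>e\<in>A. g e (f e) x)" by (rule prod.swap)
    also have "\<dots> = (\<Prod>x\<in>D. z x ^ card {e \<in> S x. f e \<in> Q x})"
    proof (intro prod.cong HOL.refl)
      fix x assume x: "x \<in> D"
      have "(\<Prod>e\<in>A. g e (f e) x) = (\<Prod>e\<in>{e \<in> S x. f e \<in> Q x}. z x)"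
        using S(1)[OF x] fin(1) unfolding g_def by (intro prod.mono_neutral_cong_right) auto
      then show "(\<Prod>e\<in>A. g e (f e) x) = z x ^ card {e \<in> S x. f e \<in> Q x}" by simp
    qed
    finally have "w * (\<Prod>e\<in>A. h e (f e)) = (\<Prod>x\<in>D. z x powr (- t x) * z x ^ card {e \<in> S x. f e \<in> Q x})"
      unfolding w_def by (simp add: prod.distrib)
    moreover have "1 \<le> (\<Prod>x\<in>D. z x powr (- t x) * z x ^ card {e \<in> S x. f e \<in> Q x})"
    proof (intro prod_ge_1)
      fix x assume x: "x \<in> D"
      have "z x powr (- t x) * z x ^ card {e \<in> S x. f e \<in> Q x} = z x powr (- t x + real (card {e \<in> S x. f e \<in> Q x}))"
        using z[OF x] unfolding powr_add by (simp add: powr_realpow)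
      moreover have "1 \<le> z x powr (- t x + real (card {e \<in> S x. f e \<in> Q x}))"
      proof -
        have "- t x + real (card {e \<in> S x. f e \<in> Q x}) \<le> 0" using f x by auto
        then have "z x powr 0 \<le> z x powr (- t x + real (card {e \<in> S x. f e \<in> Q x}))"
          using z[OF x] by (intro powr_mono') auto
        then show ?thesis using z[OF x] by simp
      qed
      ultimately show "1 \<le> z x powr (- t x) * z x ^ card {e \<in> S x. f e \<in> Q x}" by simp
    qed
    ultimately show "1 \<le> w * (\<Prod>e\<in>A. h e (f e))" by simp
  qed
  also have "(\<Prod>e\<in>A. measure_pmf.expectation q (h e)) \<le>
      (\<Prod>e\<in>A. (if e \<in> A0 then ?p else 1) * (\<Prod>x\<in>D. if e \<in> S x then ?b x else 1))"
  proof (intro prod_mono conjI)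
    fix e assume e: "e \<in> A"
    show "0 \<le> measure_pmf.expectation q (h e)"
      unfolding h_def using g0 by (intro integral_nonneg_AE AE_I2 mult_nonneg_nonneg prod_nonneg) auto
    \<comment> \<open>Disjointness of the blocks leaves at most one nontrivial factor for each
      edge.\<close>
    consider "e \<in> A0" | x where "x \<in> D" "e \<in> S x" "e \<notin> A0" | "e \<notin> A0" "\<forall>x\<in>D. e \<notin> S x" by blast
    then show "measure_pmf.expectation q (h e) \<le> (if e \<in> A0 then ?p else 1) * (\<Prod>x\<in>D. if e \<in> S x then ?b x else 1)"
    proof cases
      case 1
      then have nS: "\<And>x. x \<in> D \<Longrightarrow> e \<notin> S x" using S(2) by auto
      then have "(\<Prod>x\<in>D. g e s x) = 1" for s unfolding g_def by (intro prod.neutral) auto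
      then have "h e = indicator (-{0})" unfolding h_def using 1 by (auto simp: indicator_def fun_eq_iff)
      moreover have "(\<Prod>x\<in>D. if e \<in> S x then ?b x else 1) = 1" using nS by (intro prod.neutral) auto
      ultimately show ?thesis using 1 by simp
    next
      case (2 x)
      have oth: "\<And>y. y \<in> D - {x} \<Longrightarrow> e \<notin> S y" using 2 S(3) by blast
      have "(\<Prod>y\<in>D. g e s y) = g e s x * (\<Prod>y\<in>D - {x}. g e s y)" for s
        using fin(3) 2 by (simp add: prod.remove)
      moreover have "(\<Prod>y\<in>D - {x}. g e s y) = 1" for s unfolding g_def using oth by (intro prod.neutral) auto
      ultimately have "h e = (\<lambda>s. 1 - (1 - z x) * indicator (Q x) s)"
        unfolding h_def g_def using 2 by (auto simp: indicator_def fun_eq_iff)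
      then have "measure_pmf.expectation q (h e) = 1 - (1 - z x) * measure_pmf.prob q (Q x)"
        using fin(2) by (subst \<open>h e = _\<close>, subst Bochner_Integration.integral_diff)
          (auto intro: integrable_measure_pmf_finite simp: measure_pmf.prob_space)
      also have "\<dots> \<le> ?b x" using exp_ge_add_one_self[of "- ((1 - z x) * measure_pmf.prob q (Q x))"] by simp
      also have "\<dots> = (\<Prod>y\<in>D. if e \<in> S y then ?b y else 1)"
      proof -
        have "(\<Prod>y\<in>D - {x}. if e \<in> S y then ?b y else 1) = 1" using oth by (intro prod.neutral) auto
        then show ?thesis using fin(3) 2 by (subst prod.remove[of D x]) auto
      qed
      finally show ?thesis using 2 by simp
    next
      case 3
      then have "h e = (\<lambda>_. 1)" unfolding h_def g_def by (auto simp: fun_eq_iff intro!: prod.neutral)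
      moreover have "(\<Prod>x\<in>D. if e \<in> S x then ?b x else 1) = 1" using 3 by (intro prod.neutral) auto
      ultimately show ?thesis using 3 by (simp add: measure_pmf.prob_space)
    qed
  qed
  also have "(\<Prod>e\<in>A. (if e \<in> A0 then ?p else 1) * (\<Prod>x\<in>D. if e \<in> S x then ?b x else 1)) =
      ?p ^ card A0 * (\<Prod>x\<in>D. ?b x ^ card (S x))"
  proof -
    have "(\<Prod>e\<in>A. if e \<in> A0 then ?p else 1) = (\<Prod>e\<in>A0. ?p)"
      using A0 fin(1) by (intro prod.mono_neutral_cong_right) auto
    moreover have "(\<Prod>e\<in>A. \<Prod>x\<in>D. if e \<in> S x then ?b x else 1) = (\<Prod>x\<in>D. \<Prod>e\<in>A. if e \<in> S x then ?b x else 1)"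
      by (rule prod.swap)
    moreover have "(\<Prod>e\<in>A. if e \<in> S x then ?b x else 1) = ?b x ^ card (S x)" if x: "x \<in> D" for x
    proof -
      have "(\<Prod>e\<in>A. if e \<in> S x then ?b x else 1) = (\<Prod>e\<in>S x. ?b x)"
        using S(1)[OF x] fin(1) by (intro prod.mono_neutral_cong_right) auto
      then show ?thesis by simp
    qed
    ultimately show ?thesis by (simp add: prod.distrib)
  qed
  finally have "measure_pmf.prob (Pi_pmf A d (\<lambda>_. q)) ?E \<le> w * (?p ^ card A0 * (\<Prod>x\<in>D. ?b x ^ card (S x)))"
    unfolding w_def by (simp add: mult_left_mono prod_nonneg)
  also have "\<dots> = ?p ^ card A0 * (\<Prod>x\<in>D. z x powr (- t x) * exp (- ((1 - z x) * measure_pmf.prob q (Q x) * real (card (S x)))))"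
    unfolding w_def by (simp add: prod.distrib exp_of_nat_mult[symmetric] mult_ac)
  finally show ?thesis .
qed

text \<open>For \<open>x \<in> D\<close> only the edges from \<open>x\<close> to vertices outside
  \<open>Z\<close> are used. As \<open>D \<subseteq> Z\<close> and the edges of \<open>A0\<close>
  lie inside \<open>Z\<close>, these blocks are disjoint from each other and from \<open>A0\<close>,
  at the price of up to \<open>card Z\<close> possible neighbours.\<close>

lemma prob_vertex_deficits:
  fixes q :: "nat pmf" and z t :: "nat \<Rightarrow> real"
  assumes q: "finite (set_pmf q)" and Z: "Z \<subseteq> {1..n}" "D \<subseteq> Z"
    and A0: "A0 \<subseteq> all_edges n" "\<Union>A0 \<subseteq> Z"
    and W: "\<And>x. x \<in> D \<Longrightarrow> W x \<subseteq> {1..n}" and z: "\<And>x. x \<in> D \<Longrightarrow> 0 < z x \<and> z x \<le> 1"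
  shows "measure_pmf.prob (Pi_pmf (all_edges n) 0 (\<lambda>_. q))
      {f. (\<forall>e\<in>A0. f e \<noteq> 0) \<and> (\<forall>x\<in>D. real (card {u \<in> W x. u \<noteq> x \<and> f {x, u} \<in> Q x}) \<le> t x)}
    \<le> measure_pmf.prob q (-{0}) ^ card A0 *
      (\<Prod>x\<in>D. z x powr (- t x) * exp (- ((1 - z x) * measure_pmf.prob q (Q x) * (real (card (W x)) - real (card Z)))))"
proof -
  define S where "S x = (\<lambda>u. {x, u}) ` (W x - Z)" for x
  have finZ: "finite Z" using Z(1) finite_subset by blast
  have finD: "finite D" using Z(2) finZ by (rule finite_subset)
  have fW: "finite (W x)" if "x \<in> D" for x using W[OF that] finite_subset by blast
  have inj: "inj_on (\<lambda>u. {x, u}) B" for x :: nat and B by (auto simp: inj_on_def doubleton_eq_iff)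
  have S1: "S x \<subseteq> all_edges n" if x: "x \<in> D" for x
    unfolding S_def all_edges_def using x W[OF x] Z by (auto simp: card_insert_if)
  have S2: "S x \<inter> A0 = {}" if x: "x \<in> D" for x
    unfolding S_def using A0(2) by auto
  have S3: "S x \<inter> S y = {}" if "x \<in> D" "y \<in> D" "x \<noteq> y" for x y
    unfolding S_def using that Z by (auto simp: doubleton_eq_iff)
  have cS: "real (card (W x)) - real (card Z) \<le> real (card (S x))" if x: "x \<in> D" for x
  proof -
    have "card (S x) = card (W x - Z)" unfolding S_def by (rule card_image[OF inj])
    moreover have "card (W x) - card Z \<le> card (W x - Z)" by (rule diff_card_le_card_Diff[OF finZ])
    ultimately show ?thesis by linarith
  qed
  have "measure_pmf.prob (Pi_pmf (all_edges n) 0 (\<lambda>_. q))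
      {f. (\<forall>e\<in>A0. f e \<noteq> 0) \<and> (\<forall>x\<in>D. real (card {u \<in> W x. u \<noteq> x \<and> f {x, u} \<in> Q x}) \<le> t x)}
     \<le> measure_pmf.prob (Pi_pmf (all_edges n) 0 (\<lambda>_. q))
      {f. (\<forall>e\<in>A0. f e \<noteq> 0) \<and> (\<forall>x\<in>D. real (card {e \<in> S x. f e \<in> Q x}) \<le> t x)}"
  proof (intro measure_pmf.finite_measure_mono subsetI CollectI conjI ballI)
    fix f x assume f: "f \<in> {f. (\<forall>e\<in>A0. f e \<noteq> 0) \<and> (\<forall>x\<in>D. real (card {u \<in> W x. u \<noteq> x \<and> f {x, u} \<in> Q x}) \<le> t x)}"
      and x: "x \<in> D"
    have "{e \<in> S x. f e \<in> Q x} \<subseteq> (\<lambda>u. {x, u}) ` {u \<in> W x. u \<noteq> x \<and> f {x, u} \<in> Q x}"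
      unfolding S_def using x Z by auto
    then have "card {e \<in> S x. f e \<in> Q x} \<le> card {u \<in> W x. u \<noteq> x \<and> f {x, u} \<in> Q x}"
      using fW[OF x] by (intro surj_card_le) auto
    then show "real (card {e \<in> S x. f e \<in> Q x}) \<le> t x" using f x by fastforce
  qed auto
  also have "\<dots> \<le> measure_pmf.prob q (-{0}) ^ card A0 *
      (\<Prod>x\<in>D. z x powr (- t x) * exp (- ((1 - z x) * measure_pmf.prob q (Q x) * real (card (S x)))))"
    using finD q A0 S1 S2 S3 z by (intro prob_present_and_deficient) auto
  also have "\<dots> \<le> measure_pmf.prob q (-{0}) ^ card A0 *
      (\<Prod>x\<in>D. z x powr (- t x) * exp (- ((1 - z x) * measure_pmf.prob q (Q x) * (real (card (W x)) - real (card Z)))))"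
    using z cS by (intro mult_left_mono prod_mono conjI mult_left_mono iffD2[OF exp_le_cancel_iff])
      (auto intro!: mult_left_mono mult_nonneg_nonneg)
  finally show ?thesis .
qed

lemma sum_Pow_power: "finite A \<Longrightarrow> (\<Sum>T\<in>Pow A. y ^ card T) = (1 + y :: real) ^ card A"
proof (induction A rule: finite_induct)
  case (insert a A)
  have inj: "inj_on (insert a) (Pow A)" using insert.hyps by (auto simp: inj_on_def)
  have "(\<Sum>T\<in>Pow (insert a A). y ^ card T) = (\<Sum>T\<in>Pow A. y ^ card T) + (\<Sum>T\<in>insert a ` Pow A. y ^ card T)"
    unfolding Pow_insert using insert.hyps by (intro sum.union_disjoint) auto
  also have "(\<Sum>T\<in>insert a ` Pow A. y ^ card T) = (\<Sum>T\<in>Pow A. y ^ card (insert a T))"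
    using inj by (simp add: sum.reindex)
  also have "\<dots> = (\<Sum>T\<in>Pow A. y * y ^ card T)"
  proof (intro sum.cong HOL.refl)
    fix T assume "T \<in> Pow A"
    then have "finite T" "a \<notin> T" using insert.hyps finite_subset by auto
    then show "y ^ card (insert a T) = y * y ^ card T" by simp
  qed
  also have "\<dots> = y * (\<Sum>T\<in>Pow A. y ^ card T)" by (simp add: sum_distrib_left)
  finally show ?case using insert by (simp add: algebra_simps)
qed simp

text \<open>If the second round fails, then it contains a set \<open>T\<close> of at most \<open>n\<close> boosters used one after
  the other and avoids all boosters of \<open>H \<union> T\<close>; the union bound over \<open>T\<close> is weighted by \<open>x\<close>.\<close>

lemma prob_not_forced_ham:
  fixes q :: "nat pmf" and x :: real
  assumes posa: "posa Y F H k" and Y: "Y \<subseteq> {1..n}" and q: "qi = measure_pmf.prob q {i}"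
    and M: "2 * M + 2 * real (card {e \<in> all_edges n. f e \<noteq> 0}) \<le> real (k * k)"
    and x: "0 < x" "x \<le> 1" "x * (real n)\<^sup>2 \<le> M / 2"
  shows "measure_pmf.prob (Pi_pmf (all_edges n) 0 (\<lambda>e. if f e \<noteq> 0 then return_pmf (f e) else q))
      {g. \<not> forced_ham Y F (H \<union> {e \<in> all_edges n. f e = 0 \<and> g e = i})} \<le> (1 / x) ^ n * exp (- (qi * M / 2))"
proof -
  have cancel: "\<And>a b c M :: real. a \<le> 2 * (b + c) \<Longrightarrow> 2 * M + 2 * c \<le> a \<Longrightarrow> M \<le> b" by simp
  interpret posa Y F H k by (rule posa)
  let ?A = "all_edges n"
  let ?P = "Pi_pmf ?A 0 (\<lambda>e. if f e \<noteq> 0 then return_pmf (f e) else q)"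
  define A0 where "A0 = {e \<in> ?A. f e = 0}"
  \<comment> \<open>Boosters that the first round has already exposed cannot be supplied again;
    \<open>M\<close> is a lower bound for what is left of \<open>k * k / 2\<close> boosters without
    them.\<close>
  define B where "B T = boosters (H \<union> T) \<inter> A0" for T
  define TT where "TT = {T \<in> Pow A0. card T \<le> n \<and> T \<inter> B T = {}}"
  let ?Q = "\<lambda>T e. if e \<in> T then {i} else - {i}"
  have finA0: "finite A0" unfolding A0_def by auto
  have finTT: "finite TT" unfolding TT_def using finA0 by auto
  have qi: "0 \<le> qi" "qi \<le> 1" unfolding q by auto
  have cB: "M \<le> real (card (B T))" for T
  proof -
    interpret T: posa Y F "H \<union> T" k by (rule posa_mono) auto
    have bs: "boosters (H \<union> T) \<subseteq> ?A" unfolding boosters_def all_edges_def using Y by auto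
    have "boosters (H \<union> T) \<subseteq> B T \<union> {e \<in> ?A. f e \<noteq> 0}" unfolding B_def A0_def using bs by auto
    then have "card (boosters (H \<union> T)) \<le> card (B T \<union> {e \<in> ?A. f e \<noteq> 0})"
      using finA0 by (intro card_mono) (auto simp: B_def)
    also have "\<dots> \<le> card (B T) + card {e \<in> ?A. f e \<noteq> 0}" by (rule card_Un_le)
    finally have "2 * card (boosters (H \<union> T)) \<le> 2 * (card (B T) + card {e \<in> ?A. f e \<noteq> 0})"
      by (rule mult_le_mono2)
    with T.card_boosters have "k * k \<le> 2 * (card (B T) + card {e \<in> ?A. f e \<noteq> 0})"
      by (rule order_trans)
    then have "real (k * k) \<le> 2 * (real (card (B T)) + real (card {e \<in> ?A. f e \<noteq> 0}))"
      by (metis of_nat_add of_nat_le_iff of_nat_mult of_nat_numeral)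
    then show ?thesis using M cancel by blast
  qed
  have "card Y \<le> n" using card_mono[OF _ Y] by simp
  have "{g. \<not> forced_ham Y F (H \<union> {e \<in> ?A. f e = 0 \<and> g e = i})} \<subseteq>
      (\<Union>T\<in>TT. {g. \<forall>e\<in>T \<union> B T. g e \<in> ?Q T e})"
  proof
    fix g assume "g \<in> {g. \<not> forced_ham Y F (H \<union> {e \<in> ?A. f e = 0 \<and> g e = i})}"
    then have nf: "\<not> forced_ham Y F (H \<union> {e \<in> ?A. f e = 0 \<and> g e = i})" by simp
    obtain T where T: "T \<subseteq> {e \<in> ?A. f e = 0 \<and> g e = i}" "card T \<le> card Y"
      "{e \<in> ?A. f e = 0 \<and> g e = i} \<inter> boosters (H \<union> T) = {}"
      using booster_chain[OF _ nf] by auto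
    have "T \<in> TT" unfolding TT_def A0_def B_def using T \<open>card Y \<le> n\<close> by auto
    moreover have "\<forall>e\<in>T \<union> B T. g e \<in> ?Q T e" using T unfolding B_def A0_def by auto
    ultimately show "g \<in> (\<Union>T\<in>TT. {g. \<forall>e\<in>T \<union> B T. g e \<in> ?Q T e})" by blast
  qed
  then have "measure_pmf.prob ?P {g. \<not> forced_ham Y F (H \<union> {e \<in> ?A. f e = 0 \<and> g e = i})} \<le>
      measure_pmf.prob ?P (\<Union>T\<in>TT. {g. \<forall>e\<in>T \<union> B T. g e \<in> ?Q T e})"
    by (intro measure_pmf.finite_measure_mono) auto
  also have "\<dots> \<le> (\<Sum>T\<in>TT. measure_pmf.prob ?P {g. \<forall>e\<in>T \<union> B T. g e \<in> ?Q T e})"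
    using finTT by (intro measure_pmf.finite_measure_subadditive_finite) auto
  also have "\<dots> \<le> (\<Sum>T\<in>TT. (1 / x) ^ n * exp (- (qi * M)) * (qi * x) ^ card T)"
  proof (intro sum_mono)
    fix T assume T: "T \<in> TT"
    then have fT: "finite T" "T \<subseteq> A0" "T \<inter> B T = {}" "card T \<le> n" unfolding TT_def using finA0 finite_subset by auto
    have fB: "finite (B T)" "B T \<subseteq> A0" unfolding B_def using finA0 by auto
    have "measure_pmf.prob ?P {g. \<forall>e\<in>T \<union> B T. g e \<in> ?Q T e} =
      (\<Prod>e\<in>T \<union> B T. measure_pmf.prob (if f e \<noteq> 0 then return_pmf (f e) else q) (?Q T e))"
      using fT fB unfolding A0_def by (intro prob_Pi_pmf_all) auto
    also have "\<dots> = (\<Prod>e\<in>T \<union> B T. measure_pmf.prob q (?Q T e))"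
      using fT fB unfolding A0_def by (intro prod.cong) auto
    also have "\<dots> = (\<Prod>e\<in>T. measure_pmf.prob q (?Q T e)) * (\<Prod>e\<in>B T. measure_pmf.prob q (?Q T e))"
      using fT fB by (intro prod.union_disjoint) auto
    also have "(\<Prod>e\<in>T. measure_pmf.prob q (?Q T e)) = qi ^ card T"
      unfolding q by (simp add: prod.If_cases)
    also have "(\<Prod>e\<in>B T. measure_pmf.prob q (?Q T e)) = (\<Prod>e\<in>B T. 1 - qi)"
    proof (intro prod.cong HOL.refl)
      fix e assume "e \<in> B T"
      then have "e \<notin> T" using fT by auto
      then show "measure_pmf.prob q (?Q T e) = 1 - qi"
        using measure_pmf.prob_compl[of "{i}" q] unfolding q by (simp add: Compl_eq_Diff_UNIV)
    qed
    also have "\<dots> = (1 - qi) ^ card (B T)" by simp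
    also have "\<dots> \<le> exp (- qi) ^ card (B T)"
      using qi exp_ge_add_one_self[of "- qi"] by (intro power_mono) auto
    also have "\<dots> = exp (- (qi * real (card (B T))))" by (simp add: exp_of_nat_mult[symmetric] mult_ac)
    also have "\<dots> \<le> exp (- (qi * M))" using cB[of T] qi by (simp add: mult_left_mono)
    finally have 1: "measure_pmf.prob ?P {g. \<forall>e\<in>T \<union> B T. g e \<in> ?Q T e} \<le> qi ^ card T * exp (- (qi * M))"
      using qi by (simp add: mult_left_mono)
    \<comment> \<open>As \<open>card T \<le> n\<close>, this weight is at least 1. It turns the sum
      over \<open>T\<close> into \<open>(1 + qi * x) ^ card A0\<close>, which by the choice of
      \<open>x\<close> uses up only half of the exponent \<open>qi * M\<close>.\<close>
    have "1 \<le> (1 / x) ^ n * x ^ card T"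
    proof -
      have "x ^ n \<le> x ^ card T" using x fT by (intro power_decreasing) auto
      then show ?thesis using x by (simp add: power_one_over field_simps)
    qed
    then have "qi ^ card T * exp (- (qi * M)) * 1 \<le> qi ^ card T * exp (- (qi * M)) * ((1 / x) ^ n * x ^ card T)"
      using qi by (intro mult_left_mono) auto
    then show "measure_pmf.prob ?P {g. \<forall>e\<in>T \<union> B T. g e \<in> ?Q T e} \<le>
        (1 / x) ^ n * exp (- (qi * M)) * (qi * x) ^ card T"
      using 1 by (simp add: power_mult_distrib mult_ac)
  qed
  also have "\<dots> \<le> (\<Sum>T\<in>Pow A0. (1 / x) ^ n * exp (- (qi * M)) * (qi * x) ^ card T)"
    using finA0 qi x by (intro sum_mono2) (auto simp: TT_def)
  also have "\<dots> = (1 / x) ^ n * exp (- (qi * M)) * (1 + qi * x) ^ card A0"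
    using sum_Pow_power[OF finA0] by (simp add: sum_distrib_left[symmetric])
  also have "(1 + qi * x) ^ card A0 \<le> exp (qi * x) ^ card A0"
    using qi x exp_ge_add_one_self[of "qi * x"] by (intro power_mono) auto
  also have "exp (qi * x) ^ card A0 = exp (qi * (x * real (card A0)))"
    by (simp add: exp_of_nat_mult[symmetric] mult_ac)
  also have "\<dots> \<le> exp (qi * (M / 2))"
  proof -
    have "card A0 \<le> n * n"
      using card_mono[of ?A A0] card_all_edges_le[of n] unfolding A0_def by (simp add: order_trans)
    then have "real (card A0) \<le> (real n)\<^sup>2" by (metis of_nat_le_iff of_nat_mult power2_eq_square)
    then have "x * real (card A0) \<le> M / 2" using x by (meson mult_left_mono less_imp_le order_trans)
    then have "qi * (x * real (card A0)) \<le> qi * (M / 2)" using qi(1) by (rule mult_left_mono)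
    then show ?thesis by (simp only: exp_le_cancel_iff)
  qed
  finally have "measure_pmf.prob ?P {g. \<not> forced_ham Y F (H \<union> {e \<in> ?A. f e = 0 \<and> g e = i})} \<le>
      (1 / x) ^ n * exp (- (qi * M)) * exp (qi * (M / 2))"
    using x by (simp add: mult_left_mono)
  also have "\<dots> = (1 / x) ^ n * exp (- (qi * M / 2))"
  proof -
    have "exp (- (qi * M)) * exp (qi * (M / 2)) = exp (- (qi * M / 2))"
      by (simp add: exp_add[symmetric])
    then show ?thesis by (simp add: mult.assoc)
  qed
  finally show ?thesis .
qed

section \<open>The first round\<close>

text \<open>The left side is one term of the exponential series at \<open>m\<close>.\<close>

lemma power_div_fact_le_exp: "real m ^ m / fact m \<le> exp (real m)"
proof -
  have s: "(\<lambda>n. real m ^ n /\<^sub>R fact n) sums exp (real m)" by (rule exp_converges)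
  have "(\<Sum>n\<in>{m}. real m ^ n /\<^sub>R fact n) \<le> (\<Sum>n. real m ^ n /\<^sub>R fact n)"
    by (rule sum_le_suminf) (use s in \<open>auto simp: sums_iff\<close>)
  then show ?thesis using s by (simp add: sums_iff divide_inverse mult.commute)
qed

lemma binomial_times_power_le:
  assumes "0 < m" "0 \<le> (p::real)"
  shows "real (N choose m) * p ^ m \<le> (exp 1 * real N * p / real m) ^ m"
proof -
  have "real ((N choose m) * fact m) \<le> real (N ^ m)"
    using binomial_fact_pow[of N m] by (simp only: of_nat_le_iff)
  then have "real (N choose m) \<le> real N ^ m / fact m" by (simp add: field_simps)
  also have "\<dots> = real N ^ m / real m ^ m * (real m ^ m / fact m)" using assms by simp
  also have "\<dots> \<le> real N ^ m / real m ^ m * exp (real m)"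
    by (intro mult_left_mono power_div_fact_le_exp) auto
  also have "exp (real m) = exp 1 ^ m" by (simp add: exp_of_nat_mult[symmetric])
  finally have "real (N choose m) \<le> real N ^ m / real m ^ m * exp 1 ^ m" .
  then have "real (N choose m) * p ^ m \<le> (real N ^ m / real m ^ m * exp 1 ^ m) * p ^ m"
    using assms by (intro mult_right_mono) auto
  also have "\<dots> = (exp 1 * real N * p / real m) ^ m" by (simp add: power_mult_distrib power_divide)
  finally show ?thesis .
qed

lemma card_subsets_le: "card {D. D \<subseteq> {1..n} \<and> card D = k} \<le> n ^ k"
proof (cases "k \<le> n")
  case True
  have "card {D. D \<subseteq> {1..n} \<and> card D = k} = n choose k" using n_subsets[of "{1..n}" k] by simp
  then show ?thesis using binomial_le_pow[OF True] by simp
next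
  case False
  then have e: "{D. D \<subseteq> {1..n} \<and> card D = k} = {}" using card_mono[of "{1..n}"] by fastforce
  show ?thesis unfolding e by simp
qed

section \<open>Setting of the first round and the cost of deficient vertices\<close>

text \<open>\<open>a\<close> bounds all colour probabilities from below. The upper bound on
  \<open>p\<close> keeps expected degrees logarithmic, as the estimates for small configurations and
  small sets require.\<close>

locale first_round =
  fixes r :: nat and \<beta> a :: real and q :: "nat \<Rightarrow> nat pmf" and p w :: "nat \<Rightarrow> real"
  assumes r2: "2 \<le> r" and \<beta>: "0 < \<beta>" "real r * \<beta> \<le> 1" and a: "0 < a" "a \<le> 1"
    and q_set: "\<And>n. set_pmf (q n) \<subseteq> {0..r}"
    and q_present: "\<And>n. measure_pmf.prob (q n) (-{0}) = p n"
    and q_colour: "\<And>n i. i \<in> {1..r} \<Longrightarrow> a * p n \<le> measure_pmf.prob (q n) {i}"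
    and w_top: "filterlim w at_top sequentially"
    and p_lower: "eventually (\<lambda>n. (ln (real n) + real r * ln (ln (real n)) + w n) / real n \<le> p n) sequentially"
    and p_upper: "eventually (\<lambda>n. p n \<le> 2 * ln (real n) / real n) sequentially"
begin

definition "\<mu> n = Pi_pmf (all_edges n) 0 (\<lambda>_. q n)"
text \<open>Half of the least admissible class size; the other half leaves room for vertices of
  \<open>X\<close>, their paths and the junction.\<close>

definition "width n = nat \<lfloor>\<beta> * real n / 2\<rfloor>"
definition "U n i = {(i - 1) * width n + 1..i * width n}"
text \<open>A vertex expects at least about
  \<open>a * \<beta> / 2 * ln n = 8 * \<epsilon> * ln n\<close> neighbours of a given colour in a
  reservoir, so being in \<open>X\<close> means having at most about an eighth of that in some
  colour.\<close>

definition "\<epsilon> = a * \<beta> / 16"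
definition "X n f = {v \<in> {1..n}. \<exists>i\<in>{1..r}. real (card (cnbrs n f i v \<inter> U n i)) \<le> \<epsilon> * ln (real n)}"

lemma \<epsilon>_pos: "0 < \<epsilon>" unfolding \<epsilon>_def using a \<beta> by simp

lemma \<beta>_le: "\<beta> \<le> 1 / 2"
proof -
  have "2 * \<beta> \<le> real r * \<beta>" using r2 \<beta> by (intro mult_right_mono) auto
  then have "2 * \<beta> \<le> 1" using \<beta>(2) by linarith
  then show ?thesis by simp
qed

lemma p_nonneg: "0 \<le> p n" using q_present[of n] measure_nonneg by metis

lemma q_finite: "finite (set_pmf (q n))" using q_set finite_subset by blast

lemma card_U: "1 \<le> i \<Longrightarrow> card (U n i) = width n"
  unfolding U_def by (cases i) auto

lemma width_bounds: "\<beta> * real n / 2 - 1 \<le> real (width n)" "real (width n) \<le> \<beta> * real n / 2"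
  unfolding width_def using \<beta> by (auto simp: of_nat_nat) linarith

lemma U_sub: "i \<in> {1..r} \<Longrightarrow> U n i \<subseteq> {1..n}"
proof -
  assume i: "i \<in> {1..r}"
  have "real (i * width n) \<le> real r * (\<beta> * real n / 2)"
    unfolding of_nat_mult using i width_bounds[of n] by (intro mult_mono) auto
  also have "\<dots> = (real r * \<beta>) * (real n / 2)" by simp
  also have "\<dots> \<le> 1 * (real n / 2)" using \<beta> by (intro mult_right_mono) auto
  also have "\<dots> \<le> real n" by simp
  finally have "i * width n \<le> n" by (simp only: of_nat_le_iff)
  then show ?thesis unfolding U_def by auto
qed

lemma U_disj:
  assumes "i \<in> {1..r}" "j \<in> {1..r}" "i \<noteq> j"
  shows "U n i \<inter> U n j = {}"
proof -
  have *: "U n i \<inter> U n j = {}" if "i < j" for i j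
  proof -
    have "i * width n \<le> (j - 1) * width n" using that by (intro mult_right_mono) auto
    then have "False" if "z \<in> U n i" "z \<in> U n j" for z using that unfolding U_def atLeastAtMost_iff by linarith
    then show ?thesis by blast
  qed
  show ?thesis using *[of i j] *[of j i] assms(3) by (cases "i < j") auto
qed

lemma w_nonneg: "eventually (\<lambda>n. 0 \<le> w n) sequentially"
  using w_top unfolding filterlim_at_top by blast

lemma p_ge: "eventually (\<lambda>n. ln (real n) / real n \<le> p n) sequentially"
proof -
  have "eventually (\<lambda>n. 0 \<le> ln (ln (real n))) sequentially" by real_asymp
  then show ?thesis using p_lower w_nonneg eventually_gt_at_top[of 0]
  proof eventually_elim
    case (elim n)
    have "ln (real n) / real n \<le> (ln (real n) + real r * ln (ln (real n)) + w n) / real n"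
      using elim by (intro divide_right_mono) auto
    then show ?case using elim by linarith
  qed
qed

definition "null E \<longleftrightarrow> (\<lambda>n. measure_pmf.prob (\<mu> n) (E n)) \<longlonglongrightarrow> 0"

lemma nullI:
  assumes "eventually (\<lambda>n. measure_pmf.prob (\<mu> n) (E n) \<le> b n) sequentially" "b \<longlonglongrightarrow> 0"
  shows "null E"
  unfolding null_def by (rule tendsto_sandwich[OF _ assms(1) tendsto_const assms(2)]) simp

lemma null_Un: "null E \<Longrightarrow> null F \<Longrightarrow> null (\<lambda>n. E n \<union> F n)"
proof -
  assume "null E" "null F"
  then have "(\<lambda>n. measure_pmf.prob (\<mu> n) (E n) + measure_pmf.prob (\<mu> n) (F n)) \<longlonglongrightarrow> 0 + 0"
    unfolding null_def by (rule tendsto_add)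
  then have "(\<lambda>n. measure_pmf.prob (\<mu> n) (E n) + measure_pmf.prob (\<mu> n) (F n)) \<longlonglongrightarrow> 0" by simp
  moreover have "measure_pmf.prob (\<mu> n) (E n \<union> F n) \<le> measure_pmf.prob (\<mu> n) (E n) + measure_pmf.prob (\<mu> n) (F n)" for n
    by (rule measure_Un_le) auto
  ultimately show ?thesis by (intro nullI[OF always_eventually]) auto
qed

text \<open>Chernoff with parameter 1/2 for one deficient colour: the exponential gains at least
  \<open>2 * \<epsilon> * ln n\<close>, the factor in front loses at most
  \<open>\<epsilon> * ln n\<close>. The \<open>z0\<close> vertices of a pattern, excluded as
  neighbours, are absorbed for large \<open>n\<close>.\<close>

lemma colour_cost:
  "eventually (\<lambda>n. \<forall>i\<in>{1..r}. (1 / 2) powr (- (\<epsilon> * ln (real n))) *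
     exp (- ((1 - 1 / 2) * measure_pmf.prob (q n) {i} * (real (card (U n i)) - real z0))) \<le> real n powr (- \<epsilon>)) sequentially"
proof -
  have "eventually (\<lambda>n. \<beta> * real n / 2 - 1 - real z0 \<ge> \<beta> * real n / 4) sequentially"
    using \<beta>(1) by real_asymp
  then show ?thesis using p_ge eventually_ge_at_top[of 3]
  proof eventually_elim
    case (elim n)
    show ?case
    proof
      fix i assume i: "i \<in> {1..r}"
      let ?P = "measure_pmf.prob (q n) {i}"
      have l: "0 \<le> ln (real n)" using elim by simp
      have "a * (ln (real n) / real n) \<le> a * p n" using elim a by (intro mult_left_mono) auto
      then have P: "a * (ln (real n) / real n) \<le> ?P" using q_colour[OF i, of n] by linarith
      have c: "\<beta> * real n / 4 \<le> real (card (U n i)) - real z0"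
        using card_U[of i n] i width_bounds(1)[of n] elim by simp
      have "4 * (\<epsilon> * ln (real n)) = a * (ln (real n) / real n) * (\<beta> * real n / 4)"
        unfolding \<epsilon>_def using elim by simp
      also have "\<dots> \<le> ?P * (real (card (U n i)) - real z0)"
        using P c \<beta> by (intro mult_mono) auto
      finally have e: "2 * (\<epsilon> * ln (real n)) \<le> (1 - 1 / 2) * ?P * (real (card (U n i)) - real z0)" by simp
      have "(1 / 2) powr (- (\<epsilon> * ln (real n))) = exp ((\<epsilon> * ln (real n)) * ln 2)"
        by (simp add: powr_def ln_div)
      also have "\<dots> \<le> exp ((\<epsilon> * ln (real n)) * 1)"
        using l \<epsilon>_pos ln_le_minus_one[of 2] by (intro iffD2[OF exp_le_cancel_iff] mult_left_mono) auto
      finally have "(1 / 2) powr (- (\<epsilon> * ln (real n))) * exp (- ((1 - 1 / 2) * ?P * (real (card (U n i)) - real z0)))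
         \<le> exp (\<epsilon> * ln (real n)) * exp (- (2 * (\<epsilon> * ln (real n))))"
        using e by (intro mult_mono) auto
      also have "\<dots> = real n powr (- \<epsilon>)" using elim by (simp add: powr_def exp_add[symmetric])
      finally show "(1 / 2) powr (- (\<epsilon> * ln (real n))) * exp (- ((1 - 1 / 2) * ?P * (real (card (U n i)) - real z0)))
         \<le> real n powr (- \<epsilon>)" .
    qed
  qed
qed

text \<open>Chernoff bound, with parameter \<open>1 / ln n\<close>, for the event that a vertex has at most \<open>Q\<close> neighbours
  outside a set of \<open>z0\<close> vertices. This choice loses only a constant factor.\<close>

definition "degree_weight Q z0 n = (1 / ln (real n)) powr (- real Q) * exp (- ((1 - 1 / ln (real n)) * p n * (real n - real z0)))"

text \<open>\<open>exp 3\<close> collects the losses in the exponent: at most 1 from the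
  \<open>z0\<close> excluded vertices and at most 2 from the parameter \<open>1 / ln n\<close>,
  since \<open>p n * n \<le> 2 * ln n\<close>.\<close>

lemma degree_weight_le:
  "eventually (\<lambda>n. degree_weight Q z0 n \<le>
     exp 3 * ln (real n) ^ Q * exp (- (ln (real n) + real r * ln (ln (real n)) + w n))) sequentially"
proof -
  have "eventually (\<lambda>n. real z0 * (2 * ln (real n) / real n) \<le> 1) sequentially" by real_asymp
  moreover have "eventually (\<lambda>n. 1 \<le> ln (real n)) sequentially" by real_asymp
  ultimately show ?thesis using p_lower p_upper eventually_gt_at_top[of 0]
  proof eventually_elim
    case (elim n)
    let ?l = "ln (real n)" and ?L = "ln (real n) + real r * ln (ln (real n)) + w n"
    have 1: "?L \<le> p n * real n" using elim by (simp add: field_simps)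
    have "p n * real z0 \<le> (2 * ln (real n) / real n) * real z0" using elim by (intro mult_right_mono) auto
    then have 2: "p n * real z0 \<le> 1" using elim(1) by (simp add: mult.commute)
    have "p n * real n \<le> 2 * ?l" using elim by (simp add: field_simps)
    then have 3: "1 / ?l * (p n * real n) \<le> 2" using elim(2) by (simp add: divide_le_eq)
    have 4: "0 \<le> 1 / ?l * (p n * real z0)" using elim p_nonneg by simp
    have "(1 - c) * p n * (real n - real z0) =
      p n * real n - p n * real z0 - c * (p n * real n) + c * (p n * real z0)" for c
      by (simp add: algebra_simps)
    from this[of "1 / ?l"] have "(1 - 1 / ?l) * p n * (real n - real z0) =
      p n * real n - p n * real z0 - 1 / ?l * (p n * real n) + 1 / ?l * (p n * real z0)" .
    then have "?L - 3 \<le> (1 - 1 / ?l) * p n * (real n - real z0)" using 1 2 3 4 by linarith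
    then have "exp (- ((1 - 1 / ?l) * p n * (real n - real z0))) \<le> exp (3 + - ?L)" by simp
    also have "\<dots> = exp 3 * exp (- ?L)" by (rule exp_add)
    finally have e: "exp (- ((1 - 1 / ?l) * p n * (real n - real z0))) \<le> exp 3 * exp (- ?L)" .
    have pos: "0 < 1 / ?l" using elim(2) by simp
    have "(1 / ?l) powr (- real Q) = ?l ^ Q"
      unfolding powr_minus powr_realpow[OF pos] by (simp add: power_one_over)
    then have "degree_weight Q z0 n \<le> ?l ^ Q * (exp 3 * exp (- ?L))"
      unfolding degree_weight_def using e elim by (auto intro: mult_left_mono)
    then show ?case by (simp add: mult_ac)
  qed
qed

text \<open>A cruder form for patterns that also contain an atypical vertex, whose factor
  \<open>n powr (- \<epsilon>)\<close> beats any power of the logarithm.\<close>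

lemma degree_weight_small:
  "eventually (\<lambda>n. degree_weight Q z0 n \<le> exp 3 * ln (real n) ^ Q / real n) sequentially"
proof -
  have "eventually (\<lambda>n. 0 \<le> ln (ln (real n))) sequentially" by real_asymp
  then show ?thesis using degree_weight_le[of Q z0] w_nonneg eventually_gt_at_top[of 3]
  proof eventually_elim
    case (elim n)
    have "0 \<le> real r * ln (ln (real n))" using elim(1) by (rule mult_nonneg_nonneg[rotated]) simp
    then have "- (ln (real n) + real r * ln (ln (real n)) + w n) \<le> - ln (real n)" using elim(3) by linarith
    then have "exp (- (ln (real n) + real r * ln (ln (real n)) + w n)) \<le> exp (- ln (real n))"
      by (simp only: exp_le_cancel_iff)
    also have "\<dots> = 1 / real n" using elim by (simp add: exp_minus divide_inverse)
    finally have "exp 3 * ln (real n) ^ Q * exp (- (ln (real n) + real r * ln (ln (real n)) + w n)) \<le>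
      exp 3 * ln (real n) ^ Q * (1 / real n)"
      using elim by (intro mult_left_mono mult_nonneg_nonneg zero_le_power) auto
    then show ?case using elim by simp
  qed
qed

text \<open>The local properties of the first round below are union bounds over such patterns: the
  edges \<open>A0\<close> are present, the vertices in \<open>D\<close> are atypical and those in \<open>S\<close> have small degree.\<close>

lemma pattern_prob:
  "eventually (\<lambda>n. \<forall>Z D S A0. Z \<subseteq> {1..n} \<longrightarrow> card Z \<le> z0 \<longrightarrow> D \<subseteq> Z \<longrightarrow> S \<subseteq> Z \<longrightarrow> D \<inter> S = {} \<longrightarrow>
     A0 \<subseteq> all_edges n \<longrightarrow> \<Union>A0 \<subseteq> Z \<longrightarrow>
     measure_pmf.prob (\<mu> n) {f. (\<forall>e\<in>A0. f e \<noteq> 0) \<and> D \<subseteq> X n f \<and> (\<forall>s\<in>S. card (nbrs n f s) \<le> Q)}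
     \<le> p n ^ card A0 * (real r * real n powr (- \<epsilon>)) ^ card D * degree_weight Q z0 n ^ card S) sequentially"
proof -
  have "eventually (\<lambda>n. 1 < ln (real n)) sequentially" by real_asymp
  then show ?thesis using colour_cost[of z0]
  proof eventually_elim
    case (elim n)
    note l = elim(1) and cost = elim(2)
    show ?case
    proof (intro allI impI)
    fix Z D S A0
    assume Z: "Z \<subseteq> {1..n}" "card Z \<le> z0" and D: "D \<subseteq> Z" and S: "S \<subseteq> Z" and DS: "D \<inter> S = {}"
      and A0: "A0 \<subseteq> all_edges n" "\<Union>A0 \<subseteq> Z"
    let ?E = "{f. (\<forall>e\<in>A0. f e \<noteq> 0) \<and> D \<subseteq> X n f \<and> (\<forall>s\<in>S. card (nbrs n f s) \<le> Q)}"
    have finZ: "finite Z" using Z finite_subset by blast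
    have fin: "finite D" "finite S" using D S finZ finite_subset by blast+
    \<comment> \<open>\<open>\<iota>\<close> guesses a deficient colour for every vertex of
      \<open>D\<close>, at the cost of a factor \<open>r\<close> each. With \<open>\<iota>\<close>
      fixed, a vertex of \<open>D\<close> looks into its reservoir with parameter 1/2, a vertex of
      \<open>S\<close> at all vertices with parameter \<open>1 / ln n\<close>.\<close>
    define W where "W \<iota> x = (if x \<in> D then U n (\<iota> x) else {1..n})" for \<iota> :: "nat \<Rightarrow> nat" and x
    define R where "R \<iota> x = (if x \<in> D then {\<iota> x} else - {0})" for \<iota> :: "nat \<Rightarrow> nat" and x
    define t where "t x = (if x \<in> D then \<epsilon> * ln (real n) else real Q)" for x
    define z where "z x = (if x \<in> D then 1 / 2 else 1 / ln (real n))" for x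
    define F where "F \<iota> = {f. (\<forall>e\<in>A0. f e \<noteq> 0) \<and>
       (\<forall>x\<in>D \<union> S. real (card {u \<in> W \<iota> x. u \<noteq> x \<and> f {x, u} \<in> R \<iota> x}) \<le> t x)}" for \<iota>
    let ?I = "PiE D (\<lambda>_. {1..r})"
    have sub: "?E \<subseteq> (\<Union>\<iota>\<in>?I. F \<iota>)"
    proof
      fix f assume f: "f \<in> ?E"
      define \<iota> where "\<iota> = restrict (\<lambda>x. SOME i. i \<in> {1..r} \<and> real (card (cnbrs n f i x \<inter> U n i)) \<le> \<epsilon> * ln (real n)) D"
      have \<iota>: "\<iota> x \<in> {1..r} \<and> real (card (cnbrs n f (\<iota> x) x \<inter> U n (\<iota> x))) \<le> \<epsilon> * ln (real n)" if x: "x \<in> D" for x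
      proof -
        have "x \<in> X n f" using f x by auto
        then have "\<exists>i. i \<in> {1..r} \<and> real (card (cnbrs n f i x \<inter> U n i)) \<le> \<epsilon> * ln (real n)"
          unfolding X_def by blast
        from someI_ex[OF this] show ?thesis unfolding \<iota>_def using x by simp
      qed
      have "\<iota> \<in> ?I" using \<iota> unfolding \<iota>_def by (intro restrict_PiE_iff[THEN iffD2] ballI) fastforce
      moreover have "f \<in> F \<iota>"
        unfolding F_def
      proof (intro CollectI conjI ballI)
        show "f e \<noteq> 0" if "e \<in> A0" for e using f that by auto
        fix x assume x: "x \<in> D \<union> S"
        show "real (card {u \<in> W \<iota> x. u \<noteq> x \<and> f {x, u} \<in> R \<iota> x}) \<le> t x"
        proof (cases "x \<in> D")
          case True
          have "{u \<in> W \<iota> x. u \<noteq> x \<and> f {x, u} \<in> R \<iota> x} = cnbrs n f (\<iota> x) x \<inter> U n (\<iota> x)"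
            unfolding W_def R_def cnbrs_def using True U_sub[of "\<iota> x" n] \<iota>[OF True] by auto
          then show ?thesis using \<iota>[OF True] True unfolding t_def by simp
        next
          case False
          then have "{u \<in> W \<iota> x. u \<noteq> x \<and> f {x, u} \<in> R \<iota> x} = nbrs n f x"
            unfolding W_def R_def nbrs_def by auto
          then show ?thesis using False x f unfolding t_def by auto
        qed
      qed
      ultimately show "f \<in> (\<Union>\<iota>\<in>?I. F \<iota>)" by blast
    qed
    have finI: "finite ?I" using fin by (intro finite_PiE) auto
    have cI: "card ?I = r ^ card D" using fin by (simp add: card_PiE)
    have bound: "measure_pmf.prob (\<mu> n) (F \<iota>) \<le> p n ^ card A0 * ((real n powr (- \<epsilon>)) ^ card D * degree_weight Q z0 n ^ card S)"
      if \<iota>: "\<iota> \<in> ?I" for \<iota>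
    proof -
      let ?c = "\<lambda>x z0. z x powr (- t x) * exp (- ((1 - z x) * measure_pmf.prob (q n) (R \<iota> x) * (real (card (W \<iota> x)) - real z0)))"
      have \<iota>D: "\<iota> x \<in> {1..r}" if "x \<in> D" for x using \<iota> that by auto
      have z01: "0 < z x \<and> z x \<le> 1" for x unfolding z_def using l by auto
      have "measure_pmf.prob (\<mu> n) (F \<iota>) \<le> measure_pmf.prob (q n) (-{0}) ^ card A0 * (\<Prod>x\<in>D \<union> S. ?c x (card Z))"
        unfolding F_def \<mu>_def
      proof (rule prob_vertex_deficits[OF q_finite Z(1) _ A0])
        show "D \<union> S \<subseteq> Z" using D S by auto
        show "W \<iota> x \<subseteq> {1..n}" if "x \<in> D \<union> S" for x
          using U_sub \<iota>D unfolding W_def by auto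
        show "0 < z x \<and> z x \<le> 1" for x by (rule z01)
      qed
      also have "\<dots> \<le> measure_pmf.prob (q n) (-{0}) ^ card A0 * (\<Prod>x\<in>D \<union> S. ?c x z0)"
      proof (rule mult_left_mono, rule prod_mono, rule conjI)
        fix x assume "x \<in> D \<union> S"
        have "(1 - z x) * measure_pmf.prob (q n) (R \<iota> x) * (real (card (W \<iota> x)) - real z0) \<le>
          (1 - z x) * measure_pmf.prob (q n) (R \<iota> x) * (real (card (W \<iota> x)) - real (card Z))"
          using z01[of x] Z(2) by (intro mult_left_mono mult_nonneg_nonneg) auto
        then show "?c x (card Z) \<le> ?c x z0" by (intro mult_left_mono) auto
      qed auto
      also have "(\<Prod>x\<in>D \<union> S. ?c x z0) = (\<Prod>x\<in>D. ?c x z0) * (\<Prod>x\<in>S. ?c x z0)"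
        using fin DS by (rule prod.union_disjoint)
      also have "(\<Prod>x\<in>S. ?c x z0) = (\<Prod>x\<in>S. degree_weight Q z0 n)"
      proof (intro prod.cong HOL.refl)
        fix x assume "x \<in> S"
        then have "x \<notin> D" using DS by auto
        then show "?c x z0 = degree_weight Q z0 n"
          unfolding degree_weight_def z_def t_def R_def W_def by (simp add: q_present)
      qed
      also have "measure_pmf.prob (q n) (-{0}) ^ card A0 * ((\<Prod>x\<in>D. ?c x z0) * (\<Prod>x\<in>S. degree_weight Q z0 n))
        \<le> p n ^ card A0 * ((\<Prod>x\<in>D. real n powr (- \<epsilon>)) * (\<Prod>x\<in>S. degree_weight Q z0 n))"
        unfolding q_present
      proof (intro mult_left_mono mult_right_mono prod_mono conjI)
        fix x assume x: "x \<in> D"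
        show "?c x z0 \<le> real n powr (- \<epsilon>)"
          using cost[rule_format, OF \<iota>D[OF x]] x unfolding z_def t_def R_def W_def by simp
      qed (auto simp: p_nonneg degree_weight_def intro!: prod_nonneg)
      finally show ?thesis by simp
    qed
    have "measure_pmf.prob (\<mu> n) ?E \<le> real (card ?I) *
        (p n ^ card A0 * ((real n powr (- \<epsilon>)) ^ card D * degree_weight Q z0 n ^ card S))"
      by (rule prob_union_le[OF finI sub bound])
    also have "\<dots> = p n ^ card A0 * (real r * real n powr (- \<epsilon>)) ^ card D * degree_weight Q z0 n ^ card S"
      unfolding cI by (simp add: power_mult_distrib mult_ac)
    finally show "measure_pmf.prob (\<mu> n) ?E \<le>
      p n ^ card A0 * (real r * real n powr (- \<epsilon>)) ^ card D * degree_weight Q z0 n ^ card S" .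
    qed
  qed
qed

end

lemma pair_in_all_edges: "u \<in> {1..n} \<Longrightarrow> v \<in> {1..n} \<Longrightarrow> u \<noteq> v \<Longrightarrow> {u, v} \<in> all_edges n"
  unfolding all_edges_def by auto

section \<open>Rare configurations around atypical vertices\<close>

context first_round
begin

text \<open>Stars and spiders with \<open>K\<close> legs have one vertex more than edges, so their
  expected number is \<open>n\<close> times a power of the logarithm, times
  \<open>n powr (- \<epsilon>)\<close> up to a constant for each of the \<open>K\<close> atypical
  vertices. With \<open>K * \<epsilon> \<ge> 2\<close> the latter win.\<close>

lemma powr_\<epsilon>_power:
  assumes "2 \<le> real K * \<epsilon>" "1 \<le> n" "0 \<le> c"
  shows "real n * (c * real n powr (- \<epsilon>)) ^ K \<le> c ^ K / real n"
proof -
  have "(real n powr (- \<epsilon>)) ^ K = real n powr (- (real K * \<epsilon>))"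
    using assms by (simp add: powr_realpow[symmetric] powr_powr mult.commute)
  also have "\<dots> \<le> real n powr (- 2)" using assms by (intro powr_mono) auto
  also have "\<dots> = 1 / (real n * real n)" using assms by (simp add: powr_minus_divide power2_eq_square powr_numeral)
  finally have "(real n powr (- \<epsilon>)) ^ K \<le> 1 / (real n * real n)" .
  then have "real n * (c ^ K * (real n powr (- \<epsilon>)) ^ K) \<le> real n * (c ^ K * (1 / (real n * real n)))"
    using assms by (intro mult_left_mono) auto
  then show ?thesis using assms by (simp add: power_mult_distrib)
qed

lemma star_edges_card: "v \<notin> D \<Longrightarrow> card ((\<lambda>u. {v, u}) ` D) = card D"
  by (intro card_image) (auto simp: inj_on_def doubleton_eq_iff)

definition "crowded K n = {f. \<exists>v\<in>{1..n}. K \<le> card (nbrs n f v \<inter> X n f)}"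

lemma null_crowded:
  assumes K: "2 \<le> real K * \<epsilon>"
  shows "null (crowded K)"
proof (rule nullI)
  have c: "0 < 2 * real r" using r2 by simp
  have "(\<lambda>n. (2 * real r * ln (real n)) ^ K / real n) \<longlonglongrightarrow> 0" using c by real_asymp
  then show "(\<lambda>n. (2 * real r * ln (real n)) ^ K / real n) \<longlonglongrightarrow> 0" .
  show "eventually (\<lambda>n. measure_pmf.prob (\<mu> n) (crowded K n)
      \<le> (2 * real r * ln (real n)) ^ K / real n) sequentially"
    using pattern_prob[of "K + 1" 0] p_upper eventually_ge_at_top[of 1]
  proof eventually_elim
    case (elim n)
    define I where "I = {1..n} \<times> {D. D \<subseteq> {1..n} \<and> card D = K}"
    define F where "F = (\<lambda>(v, D). {f. v \<notin> D \<and> (\<forall>e\<in>(\<lambda>u. {v, u}) ` D. f e \<noteq> 0) \<and> D \<subseteq> X n f})"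
    let ?b = "(2 * ln (real n) / real n) ^ K * (real r * real n powr (- \<epsilon>)) ^ K"
    have l: "0 \<le> ln (real n)" using elim(3) by simp
    have finI: "finite I" unfolding I_def by auto
    have cI: "card I \<le> n * n ^ K" unfolding I_def card_cartesian_product using card_subsets_le[of n K] by simp
    have sub: "crowded K n \<subseteq> (\<Union>x\<in>I. F x)"
    proof
      fix f assume "f \<in> crowded K n"
      then obtain v where v: "v \<in> {1..n}" "K \<le> card (nbrs n f v \<inter> X n f)" unfolding crowded_def by auto
      obtain D where D: "D \<subseteq> nbrs n f v \<inter> X n f" "card D = K"
        using obtain_subset_with_card_n[OF v(2)] by metis
      have "D \<subseteq> {1..n}" "v \<notin> D" "\<forall>u\<in>D. f {v, u} \<noteq> 0" using D unfolding nbrs_def by auto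
      then have "(v, D) \<in> I" "f \<in> F (v, D)" using v D unfolding I_def F_def by auto
      then show "f \<in> (\<Union>x\<in>I. F x)" by blast
    qed
    have b0: "0 \<le> ?b" using l by simp
    have "measure_pmf.prob (\<mu> n) (crowded K n) \<le> real (card I) * ?b"
    proof (rule prob_union_le[OF finI sub])
      fix x assume "x \<in> I"
      then obtain v D where x: "x = (v, D)" "v \<in> {1..n}" "D \<subseteq> {1..n}" "card D = K" unfolding I_def by auto
      show "measure_pmf.prob (\<mu> n) (F x) \<le> ?b"
      proof (cases "v \<in> D")
        case True
        then have "F x = {}" unfolding F_def x by simp
        then show ?thesis using b0 by simp
      next
        case False
        let ?A = "(\<lambda>u. {v, u}) ` D"
        have "finite D" using x finite_subset by blast
        then have "card (insert v D) = K + 1" using False x by simp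
        moreover have "?A \<subseteq> all_edges n" using x False by (auto intro!: pair_in_all_edges)
        ultimately have "measure_pmf.prob (\<mu> n) {f. (\<forall>e\<in>?A. f e \<noteq> 0) \<and> D \<subseteq> X n f \<and> (\<forall>s\<in>{}. card (nbrs n f s) \<le> 0)}
          \<le> p n ^ card ?A * (real r * real n powr (- \<epsilon>)) ^ card D * degree_weight 0 (K + 1) n ^ card ({} :: nat set)"
          using x by (intro elim(1)[rule_format, of "insert v D"]) auto
        also have "\<dots> = p n ^ K * (real r * real n powr (- \<epsilon>)) ^ K"
          using star_edges_card[OF False] x by simp
        also have "\<dots> \<le> ?b" using elim(2) p_nonneg by (intro mult_right_mono power_mono) auto
        finally show ?thesis using False unfolding F_def x by simp
      qed
    qed
    also have "\<dots> \<le> real (n * n ^ K) * ?b" using cI b0 by (intro mult_right_mono) (simp_all only: of_nat_le_iff)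
    also have "\<dots> = real n * (2 * real r * ln (real n) * real n powr (- \<epsilon>)) ^ K"
    proof -
      have 1: "real n ^ K * (2 * ln (real n) / real n) ^ K = (2 * ln (real n)) ^ K"
        unfolding power_mult_distrib[symmetric] using elim(3) by simp
      have "real (n * n ^ K) * ?b = real n * ((real n ^ K * (2 * ln (real n) / real n) ^ K) * (real r * real n powr (- \<epsilon>)) ^ K)"
        by (simp only: of_nat_mult of_nat_power mult.assoc)
      also have "\<dots> = real n * ((2 * ln (real n)) * (real r * real n powr (- \<epsilon>))) ^ K"
        unfolding 1 by (simp only: power_mult_distrib)
      finally show ?thesis by (simp only: mult_ac)
    qed
    also have "\<dots> \<le> (2 * real r * ln (real n)) ^ K / real n"
      using elim(3) l by (intro powr_\<epsilon>_power[OF K]) auto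
    finally show ?case .
  qed
qed

definition "high_codegree n = {f. \<exists>v\<in>{1..n}. \<exists>x\<in>{1..n}. v \<noteq> x \<and>
   3 \<le> card (nbrs n f v \<inter> nbrs n f x)}"

text \<open>Two vertices with three common neighbours span five vertices and six edges, so the
  expected number of such configurations is a power of the logarithm divided by
  \<open>n\<close>.\<close>

lemma null_high_codegree:
  "null high_codegree"
proof (rule nullI)
  show "(\<lambda>n. 64 * ln (real n) ^ 6 / real n) \<longlonglongrightarrow> 0" by real_asymp
  show "eventually (\<lambda>n. measure_pmf.prob (\<mu> n) (high_codegree n)
      \<le> 64 * ln (real n) ^ 6 / real n) sequentially"
    using pattern_prob[of "5" 0] p_upper eventually_ge_at_top[of 1]
  proof eventually_elim
    case (elim n)
    define I where "I = {1..n} \<times> {1..n} \<times> {D. D \<subseteq> {1..n} \<and> card D = 3}"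
    define A where "A v x D = (\<lambda>u. {v, u}) ` D \<union> (\<lambda>u. {x, u}) ` D" for v x :: nat and D
    define F where "F = (\<lambda>(v, x, D). {f. v \<noteq> x \<and> v \<notin> D \<and> x \<notin> D \<and> (\<forall>e\<in>A v x D. f e \<noteq> (0::nat))})"
    let ?b = "(2 * ln (real n) / real n) ^ 6"
    have l: "0 \<le> ln (real n)" using elim(3) by simp
    have finI: "finite I" unfolding I_def by auto
    have cI: "card I \<le> n * (n * n ^ 3)" unfolding I_def card_cartesian_product using card_subsets_le[of n 3] by simp
    have sub: "high_codegree n \<subseteq> (\<Union>x\<in>I. F x)"
    proof
      fix f assume "f \<in> high_codegree n"
      then obtain v x where v: "v \<in> {1..n}" "x \<in> {1..n}" "v \<noteq> x" "3 \<le> card (nbrs n f v \<inter> nbrs n f x)" unfolding high_codegree_def by auto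
      obtain D where D: "D \<subseteq> nbrs n f v \<inter> nbrs n f x" "card D = 3"
        using obtain_subset_with_card_n[OF v(4)] by metis
      have "D \<subseteq> {1..n}" "v \<notin> D" "x \<notin> D" "\<forall>u\<in>D. f {v, u} \<noteq> 0 \<and> f {x, u} \<noteq> 0" using D unfolding nbrs_def by auto
      then have "(v, x, D) \<in> I" "f \<in> F (v, x, D)" using v D unfolding I_def F_def A_def by auto
      then show "f \<in> (\<Union>x\<in>I. F x)" by blast
    qed
    have b0: "0 \<le> ?b" using l by simp
    have "measure_pmf.prob (\<mu> n) (high_codegree n) \<le> real (card I) * ?b"
    proof (rule prob_union_le[OF finI sub])
      fix y assume "y \<in> I"
      then obtain v x D where x: "y = (v, x, D)" "v \<in> {1..n}" "x \<in> {1..n}" "D \<subseteq> {1..n}" "card D = 3" unfolding I_def by auto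
      show "measure_pmf.prob (\<mu> n) (F y) \<le> ?b"
      proof (cases "v \<noteq> x \<and> v \<notin> D \<and> x \<notin> D")
        case False
        then have "F y = {}" unfolding F_def x by auto
        then show ?thesis using b0 by simp
      next
        case True
        have fD: "finite D" using x finite_subset by blast
        have "card (insert v (insert x D)) = 5" using True x fD by simp
        moreover have "A v x D \<subseteq> all_edges n" unfolding A_def using x True by (auto intro!: pair_in_all_edges)
        ultimately have "measure_pmf.prob (\<mu> n) {f. (\<forall>e\<in>A v x D. f e \<noteq> 0) \<and> {} \<subseteq> X n f \<and> (\<forall>s\<in>{}. card (nbrs n f s) \<le> 0)}
          \<le> p n ^ card (A v x D) * (real r * real n powr (- \<epsilon>)) ^ card ({} :: nat set) * degree_weight 0 5 n ^ card ({} :: nat set)"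
          using x by (intro elim(1)[rule_format, of "insert v (insert x D)"]) (auto simp: A_def)
        also have "card (A v x D) = 6"
        proof -
          have "(\<lambda>u. {v, u}) ` D \<inter> (\<lambda>u. {x, u}) ` D = {}" using True by (auto simp: doubleton_eq_iff)
          then have "card (A v x D) = card ((\<lambda>u. {v, u}) ` D) + card ((\<lambda>u. {x, u}) ` D)"
            unfolding A_def using fD by (intro card_Un_disjoint) auto
          then show ?thesis using True x by (simp add: star_edges_card)
        qed
        also have "p n ^ 6 * (real r * real n powr (- \<epsilon>)) ^ card ({} :: nat set) * degree_weight 0 5 n ^ card ({} :: nat set) = p n ^ 6"
          by simp
        also have "p n ^ 6 \<le> ?b" using elim(2) p_nonneg by (intro power_mono) auto
        finally show ?thesis using True unfolding F_def x by simp
      qed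
    qed
    also have "\<dots> \<le> real (n * (n * n ^ 3)) * ?b" using cI b0 by (intro mult_right_mono) (simp_all only: of_nat_le_iff)
    also have "\<dots> = 64 * ln (real n) ^ 6 / real n"
      using elim(3) by (simp add: power_divide power_mult_distrib field_simps eval_nat_numeral)
    finally show ?case .
  qed
qed

text \<open>Lists index the legs from \<open>v\<close> through \<open>zs ! j\<close> to
  \<open>xs ! j\<close>. All \<open>2 * K + 1\<close> vertices are distinct, hence so are the
  \<open>2 * K\<close> edges.\<close>

definition "spiders K n = {f. \<exists>v\<in>{1..n}. \<exists>zs xs. length zs = K \<and> length xs = K \<and>
   set xs \<subseteq> X n f \<and> set zs \<subseteq> {1..n} \<and> distinct (v # zs @ xs) \<and>
   (\<forall>j<K. f {v, zs ! j} \<noteq> 0 \<and> f {zs ! j, xs ! j} \<noteq> 0)}"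

lemma null_spiders:
  assumes K: "2 \<le> real K * \<epsilon>"
  shows "null (spiders K)"
proof (rule nullI)
  have c: "0 < 4 * real r" using r2 by simp
  show "(\<lambda>n. (4 * real r * ln (real n) ^ 2) ^ K / real n) \<longlonglongrightarrow> 0" using c by real_asymp
  show "eventually (\<lambda>n. measure_pmf.prob (\<mu> n) (spiders K n)
      \<le> (4 * real r * ln (real n) ^ 2) ^ K / real n) sequentially"
    using pattern_prob[of "2 * K + 1" 0] p_upper eventually_ge_at_top[of 1]
  proof eventually_elim
    case (elim n)
    let ?L = "{xs. set xs \<subseteq> {1..n} \<and> length xs = K}"
    define I where "I = {1..n} \<times> ?L \<times> ?L"
    define A where "A v zs xs = (\<lambda>j. {v, zs ! j}) ` {..<K} \<union> (\<lambda>j. {zs ! j, xs ! j}) ` {..<K}" for v :: nat and zs xs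
    define F where "F = (\<lambda>(v, zs, xs). {f. distinct (v # zs @ xs) \<and> (\<forall>e\<in>A v zs xs. f e \<noteq> 0) \<and> set xs \<subseteq> X n f})"
    let ?b = "(2 * ln (real n) / real n) ^ (2 * K) * (real r * real n powr (- \<epsilon>)) ^ K"
    let ?E = "spiders K n"
    have l: "0 \<le> ln (real n)" using elim(3) by simp
    have finI: "finite I" unfolding I_def by (auto intro: finite_lists_length_eq)
    have cI: "card I = n * (n ^ K * n ^ K)"
      unfolding I_def card_cartesian_product by (simp add: card_lists_length_eq)
    have sub: "?E \<subseteq> (\<Union>x\<in>I. F x)"
    proof
      fix f assume "f \<in> ?E"
      then obtain v zs xs where v: "v \<in> {1..n}" "length zs = K" "length xs = K" "set xs \<subseteq> X n f" "set zs \<subseteq> {1..n}"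
        "distinct (v # zs @ xs)" "\<forall>j<K. f {v, zs ! j} \<noteq> 0 \<and> f {zs ! j, xs ! j} \<noteq> 0" unfolding spiders_def by blast
      have "set xs \<subseteq> {1..n}" using v(4) unfolding X_def by auto
      then have "(v, zs, xs) \<in> I" "f \<in> F (v, zs, xs)" using v unfolding I_def F_def A_def by auto
      then show "f \<in> (\<Union>x\<in>I. F x)" by blast
    qed
    have b0: "0 \<le> ?b" using l by simp
    have "measure_pmf.prob (\<mu> n) ?E \<le> real (card I) * ?b"
    proof (rule prob_union_le[OF finI sub])
      fix y assume "y \<in> I"
      then obtain v zs xs where x: "y = (v, zs, xs)" "v \<in> {1..n}" "set zs \<subseteq> {1..n}" "length zs = K"
        "set xs \<subseteq> {1..n}" "length xs = K" unfolding I_def by auto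
      show "measure_pmf.prob (\<mu> n) (F y) \<le> ?b"
      proof (cases "distinct (v # zs @ xs)")
        case False
        then have "F y = {}" unfolding F_def x by auto
        then show ?thesis using b0 by simp
      next
        case d: True
        let ?Z = "set (v # zs @ xs)"
        have mem: "zs ! j \<in> set zs" "xs ! j \<in> set xs" if "j < K" for j using that x by auto
        have ne: "zs ! j \<noteq> v" "zs ! j \<noteq> xs ! j'" "xs ! j \<noteq> v" if "j < K" "j' < K" for j j'
          using d mem[OF that(1)] mem[OF that(2)] by auto
        have "card ?Z = 2 * K + 1" using distinct_card[OF d] x by simp
        moreover have "A v zs xs \<subseteq> all_edges n"
        proof
          fix e assume "e \<in> A v zs xs"
          then obtain j where j: "j < K" "e = {v, zs ! j} \<or> e = {zs ! j, xs ! j}" unfolding A_def by auto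
          then show "e \<in> all_edges n" unfolding all_edges_def using x mem[OF j(1)] ne[OF j(1) j(1)] by auto
        qed
        moreover have "\<Union>(A v zs xs) \<subseteq> ?Z" unfolding A_def using mem by auto
        ultimately have "measure_pmf.prob (\<mu> n) {f. (\<forall>e\<in>A v zs xs. f e \<noteq> 0) \<and> set xs \<subseteq> X n f \<and> (\<forall>s\<in>{}. card (nbrs n f s) \<le> 0)}
          \<le> p n ^ card (A v zs xs) * (real r * real n powr (- \<epsilon>)) ^ card (set xs) * degree_weight 0 (2 * K + 1) n ^ card ({} :: nat set)"
          using x by (intro elim(1)[rule_format, of ?Z]) auto
        also have "card (A v zs xs) = 2 * K"
        proof -
          have dz: "distinct zs" "distinct xs" using d by auto
          have inj1: "inj_on (\<lambda>j. {v, zs ! j}) {..<K}"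
            using dz x by (auto simp: inj_on_def doubleton_eq_iff nth_eq_iff_index_eq)
          have inj2: "inj_on (\<lambda>j. {zs ! j, xs ! j}) {..<K}"
          proof (rule inj_onI)
            fix i j assume ij: "i \<in> {..<K}" "j \<in> {..<K}" "{zs ! i, xs ! i} = {zs ! j, xs ! j}"
            then have "zs ! i = zs ! j" using ne(2)[of i j] by (auto simp: doubleton_eq_iff)
            then show "i = j" using ij dz x by (simp add: nth_eq_iff_index_eq)
          qed
          have "(\<lambda>j. {v, zs ! j}) ` {..<K} \<inter> (\<lambda>j. {zs ! j, xs ! j}) ` {..<K} = {}"
          proof (rule ccontr)
            assume "\<not> ?thesis"
            then obtain i j where ij: "i < K" "j < K" "{v, zs ! i} = {zs ! j, xs ! j}" by auto
            then have "v \<in> {zs ! j, xs ! j}" by blast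
            then show False using ne(1,3)[OF ij(2) ij(2)] by auto
          qed
          then have "card (A v zs xs) = card ((\<lambda>j. {v, zs ! j}) ` {..<K}) + card ((\<lambda>j. {zs ! j, xs ! j}) ` {..<K})"
            unfolding A_def by (intro card_Un_disjoint) auto
          then show ?thesis using card_image[OF inj1] card_image[OF inj2] by simp
        qed
        also have "card (set xs) = K" using d x distinct_card[of xs] by simp
        also have "p n ^ (2 * K) * (real r * real n powr (- \<epsilon>)) ^ K * degree_weight 0 (2 * K + 1) n ^ card ({} :: nat set)
          \<le> ?b" using elim(2) p_nonneg by (simp only: card.empty power_0 mult_1_right) (intro mult_right_mono power_mono, auto)
        finally show ?thesis using d unfolding F_def x by simp
      qed
    qed
    also have "\<dots> = real n * (4 * real r * ln (real n) ^ 2 * real n powr (- \<epsilon>)) ^ K"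
    proof -
      have "real n ^ (2 * K) * (2 * ln (real n) / real n) ^ (2 * K) = (2 * ln (real n)) ^ (2 * K)"
        unfolding power_mult_distrib[symmetric] using elim(3) by simp
      also have "\<dots> = (4 * ln (real n) ^ 2) ^ K" by (simp add: power_mult power_mult_distrib)
      finally have 1: "real n ^ (2 * K) * (2 * ln (real n) / real n) ^ (2 * K) = (4 * ln (real n) ^ 2) ^ K" .
      have "real (card I) = real n * real n ^ (2 * K)" unfolding cI by (simp add: mult_2 power_add)
      then have "real (card I) * ?b = real n * ((real n ^ (2 * K) * (2 * ln (real n) / real n) ^ (2 * K)) * (real r * real n powr (- \<epsilon>)) ^ K)"
        by (simp only: mult.assoc)
      also have "\<dots> = real n * ((4 * ln (real n) ^ 2) * (real r * real n powr (- \<epsilon>))) ^ K"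
        unfolding 1 by (simp only: power_mult_distrib)
      finally show ?thesis by (simp only: mult_ac)
    qed
    also have "\<dots> \<le> (4 * real r * ln (real n) ^ 2) ^ K / real n"
      using elim(3) l by (intro powr_\<epsilon>_power[OF K]) auto
    finally show ?case .
  qed
qed

definition "small_adjacent Q n = {f. \<exists>v\<in>{1..n}. card (nbrs n f v) \<le> Q \<and>
   (\<exists>x\<in>X n f. x \<noteq> v \<and> f {v, x} \<noteq> 0)}"

text \<open>Two vertices against one edge and one small degree cancel up to logarithms, and the
  atypical vertex contributes \<open>n powr (- \<epsilon>)\<close>.\<close>

lemma null_small_adjacent:
  "null (small_adjacent Q)"
proof (rule nullI)
  have c: "0 < real r" using r2 by simp
  show "(\<lambda>n. 2 * real r * exp 3 * ln (real n) ^ (Q + 1) * real n powr (- \<epsilon>)) \<longlonglongrightarrow> 0"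
    using c \<epsilon>_pos by real_asymp
  show "eventually (\<lambda>n. measure_pmf.prob (\<mu> n) (small_adjacent Q n)
      \<le> 2 * real r * exp 3 * ln (real n) ^ (Q + 1) * real n powr (- \<epsilon>)) sequentially"
    using pattern_prob[of 2 Q] p_upper degree_weight_small[of Q 2] eventually_ge_at_top[of 1]
  proof eventually_elim
    case (elim n)
    define I where "I = {1..n} \<times> {1..n}"
    define F where "F = (\<lambda>(v, x). {f. v \<noteq> x \<and> (\<forall>e\<in>{{v, x}}. f e \<noteq> 0) \<and> {x} \<subseteq> X n f \<and> (\<forall>s\<in>{v}. card (nbrs n f s) \<le> Q)})"
    let ?b = "2 * ln (real n) / real n * (real r * real n powr (- \<epsilon>)) * (exp 3 * ln (real n) ^ Q / real n)"
    let ?E = "small_adjacent Q n"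
    have l: "0 \<le> ln (real n)" using elim(4) by simp
    have dw: "0 \<le> degree_weight Q 2 n" unfolding degree_weight_def by simp
    have finI: "finite I" unfolding I_def by auto
    have sub: "?E \<subseteq> (\<Union>x\<in>I. F x)"
    proof
      fix f assume "f \<in> ?E"
      then obtain v x where v: "v \<in> {1..n}" "card (nbrs n f v) \<le> Q" "x \<in> X n f" "x \<noteq> v" "f {v, x} \<noteq> 0" unfolding small_adjacent_def by blast
      then have "(v, x) \<in> I" "f \<in> F (v, x)" unfolding I_def F_def X_def by auto
      then show "f \<in> (\<Union>x\<in>I. F x)" by blast
    qed
    have b0: "0 \<le> ?b" using l by simp
    have "measure_pmf.prob (\<mu> n) ?E \<le> real (card I) * ?b"
    proof (rule prob_union_le[OF finI sub])
      fix y assume "y \<in> I"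
      then obtain v x where y: "y = (v, x)" "v \<in> {1..n}" "x \<in> {1..n}" unfolding I_def by auto
      show "measure_pmf.prob (\<mu> n) (F y) \<le> ?b"
      proof (cases "v = x")
        case True
        then have "F y = {}" unfolding F_def y by auto
        then show ?thesis using b0 by simp
      next
        case False
        have e: "{v, x} \<in> all_edges n" unfolding all_edges_def using y False by auto
        have "measure_pmf.prob (\<mu> n) {f. (\<forall>e\<in>{{v, x}}. f e \<noteq> 0) \<and> {x} \<subseteq> X n f \<and> (\<forall>s\<in>{v}. card (nbrs n f s) \<le> Q)}
          \<le> p n ^ card {{v, x}} * (real r * real n powr (- \<epsilon>)) ^ card {x} * degree_weight Q 2 n ^ card {v}"
          using y False e by (intro elim(1)[rule_format, of "{v, x}"]) auto
        also have "\<dots> = p n * (real r * real n powr (- \<epsilon>)) * degree_weight Q 2 n" by simp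
        also have "\<dots> \<le> ?b" using elim(2,3) p_nonneg dw l by (intro mult_mono) auto
        finally show ?thesis using False unfolding F_def y by simp
      qed
    qed
    also have "\<dots> = 2 * real r * exp 3 * ln (real n) ^ (Q + 1) * real n powr (- \<epsilon>)"
      unfolding I_def using elim(4) by (simp add: field_simps)
    finally show ?case .
  qed
qed

definition "small_distance_two Q n = {f. \<exists>v\<in>{1..n}. card (nbrs n f v) \<le> Q \<and>
   (\<exists>z\<in>{1..n}. \<exists>x\<in>X n f. z \<noteq> v \<and> x \<noteq> v \<and> x \<noteq> z \<and>
   f {v, z} \<noteq> 0 \<and> f {z, x} \<noteq> 0)}"

text \<open>Compared with adjacency, the additional vertex \<open>z\<close> and the additional edge
  cancel up to a logarithm.\<close>

lemma null_small_distance_two: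
  "null (small_distance_two Q)"
proof (rule nullI)
  have c: "0 < real r" using r2 by simp
  show "(\<lambda>n. 4 * real r * exp 3 * ln (real n) ^ (Q + 2) * real n powr (- \<epsilon>)) \<longlonglongrightarrow> 0"
    using c \<epsilon>_pos by real_asymp
  show "eventually (\<lambda>n. measure_pmf.prob (\<mu> n) (small_distance_two Q n)
      \<le> 4 * real r * exp 3 * ln (real n) ^ (Q + 2) * real n powr (- \<epsilon>)) sequentially"
    using pattern_prob[of 3 Q] p_upper degree_weight_small[of Q 3] eventually_ge_at_top[of 1]
  proof eventually_elim
    case (elim n)
    define I where "I = {1..n} \<times> {1..n} \<times> {1..n}"
    define F where "F = (\<lambda>(v, z, x). {f. (v \<noteq> z \<and> v \<noteq> x \<and> x \<noteq> z) \<and> (\<forall>e\<in>{{v, z}, {z, x}}. f e \<noteq> 0) \<and> {x} \<subseteq> X n f \<and> (\<forall>s\<in>{v}. card (nbrs n f s) \<le> Q)})"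
    let ?b = "(2 * ln (real n) / real n) ^ 2 * (real r * real n powr (- \<epsilon>)) * (exp 3 * ln (real n) ^ Q / real n)"
    let ?E = "small_distance_two Q n"
    have l: "0 \<le> ln (real n)" using elim(4) by simp
    have dw: "0 \<le> degree_weight Q 3 n" unfolding degree_weight_def by simp
    have finI: "finite I" unfolding I_def by auto
    have sub: "?E \<subseteq> (\<Union>x\<in>I. F x)"
    proof
      fix f assume "f \<in> ?E"
      then obtain v z x where v: "v \<in> {1..n}" "card (nbrs n f v) \<le> Q" "z \<in> {1..n}" "x \<in> X n f" "z \<noteq> v" "x \<noteq> v" "x \<noteq> z"
        "f {v, z} \<noteq> 0" "f {z, x} \<noteq> 0" unfolding small_distance_two_def by blast
      then have "(v, z, x) \<in> I" "f \<in> F (v, z, x)" unfolding I_def F_def X_def by auto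
      then show "f \<in> (\<Union>x\<in>I. F x)" by blast
    qed
    have b0: "0 \<le> ?b" using l by simp
    have "measure_pmf.prob (\<mu> n) ?E \<le> real (card I) * ?b"
    proof (rule prob_union_le[OF finI sub])
      fix y assume "y \<in> I"
      then obtain v z x where y: "y = (v, z, x)" "v \<in> {1..n}" "z \<in> {1..n}" "x \<in> {1..n}" unfolding I_def by auto
      show "measure_pmf.prob (\<mu> n) (F y) \<le> ?b"
      proof (cases "v \<noteq> z \<and> v \<noteq> x \<and> x \<noteq> z")
        case False
        then have "F y = {}" unfolding F_def y by auto
        then show ?thesis using b0 by simp
      next
        case True
        have e: "{{v, z}, {z, x}} \<subseteq> all_edges n" unfolding all_edges_def using y True by auto
        have c2: "card {{v, z}, {z, x}} = 2" using True by (auto simp: card_insert_if doubleton_eq_iff)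
        have c3: "card {v, z, x} = 3" using True by auto
        have "measure_pmf.prob (\<mu> n) {f. (\<forall>e\<in>{{v, z}, {z, x}}. f e \<noteq> 0) \<and> {x} \<subseteq> X n f \<and> (\<forall>s\<in>{v}. card (nbrs n f s) \<le> Q)}
          \<le> p n ^ card {{v, z}, {z, x}} * (real r * real n powr (- \<epsilon>)) ^ card {x} * degree_weight Q 3 n ^ card {v}"
          using y True e c3 by (intro elim(1)[rule_format, of "{v, z, x}"]) auto
        also have "\<dots> = p n ^ 2 * (real r * real n powr (- \<epsilon>)) * degree_weight Q 3 n" unfolding c2 by simp
        also have "\<dots> \<le> ?b" using elim(2,3) p_nonneg dw l by (intro mult_mono power_mono) auto
        finally show ?thesis using True unfolding F_def y by simp
      qed
    qed
    also have "\<dots> = 4 * real r * exp 3 * ln (real n) ^ (Q + 2) * real n powr (- \<epsilon>)"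
      unfolding I_def using elim(4) by (simp add: field_simps power2_eq_square)
    finally show ?case .
  qed
qed

section \<open>Minimum degree and global counts\<close>

definition "low_degree n = {f. \<exists>v\<in>{1..n}. card (nbrs n f v) \<le> r}"

text \<open>Here the lower bound on \<open>p\<close> is used in full: the term
  \<open>r * ln (ln n)\<close> cancels the factor \<open>ln n ^ r\<close> of the Chernoff bound, and
  summing over the vertices leaves \<open>exp (- w n)\<close> up to a constant.\<close>

lemma null_low_degree: "null low_degree"
proof (rule nullI)
  have "(\<lambda>n. exp 3 * exp (- w n)) \<longlonglongrightarrow> exp 3 * 0"
    by (intro tendsto_mult tendsto_const filterlim_compose[OF exp_at_bot] filterlim_uminus_at_bot_at_top[THEN filterlim_compose] w_top)
  then show "(\<lambda>n. exp 3 * exp (- w n)) \<longlonglongrightarrow> 0" by simp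
  have "eventually (\<lambda>n. 0 < ln (real n)) sequentially" by real_asymp
  then show "eventually (\<lambda>n. measure_pmf.prob (\<mu> n) (low_degree n) \<le> exp 3 * exp (- w n)) sequentially"
    using pattern_prob[of 1 r] degree_weight_le[of r 1] eventually_ge_at_top[of 1]
  proof eventually_elim
    case (elim n)
    let ?F = "\<lambda>v. {f. card (nbrs n f v) \<le> r}"
    let ?b = "exp 3 * ln (real n) ^ r * exp (- (ln (real n) + real r * ln (ln (real n)) + w n))"
    have "measure_pmf.prob (\<mu> n) (low_degree n) \<le> real (card {1..n}) * ?b"
    proof (rule prob_union_le[where F = ?F])
      fix v assume v: "v \<in> {1..n}"
      have "measure_pmf.prob (\<mu> n) {f. (\<forall>e\<in>{}. f e \<noteq> 0) \<and> {} \<subseteq> X n f \<and> (\<forall>s\<in>{v}. card (nbrs n f s) \<le> r)}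
        \<le> p n ^ card ({} :: nat set set) * (real r * real n powr (- \<epsilon>)) ^ card ({} :: nat set) * degree_weight r 1 n ^ card {v}"
        using v by (intro elim(2)[rule_format, of "{v}"]) auto
      then show "measure_pmf.prob (\<mu> n) (?F v) \<le> ?b" using elim(3) by simp
    qed (auto simp: low_degree_def)
    also have "?b = exp 3 * exp (- w n) / real n"
    proof -
      have "exp (ln (real n) + real r * ln (ln (real n)) + w n) = real n * ln (real n) ^ r * exp (w n)"
        using elim(1,4) by (simp add: exp_add exp_of_nat_mult)
      then have "exp (- (ln (real n) + real r * ln (ln (real n)) + w n)) = exp (- w n) / (real n * ln (real n) ^ r)"
        by (simp only: exp_minus) (simp add: field_simps)
      then show ?thesis using elim(1) by simp
    qed
    finally show ?case using elim(4) by simp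
  qed
qed

definition "many_atypical \<eta> n = {f. \<eta> * real n \<le> real (card (X n f))}"

lemma null_many_atypical:
  assumes "0 < \<eta>"
  shows "null (many_atypical \<eta>)"
proof (rule nullI)
  have c: "0 < real r" using r2 by simp
  show "(\<lambda>n. real r * real n powr (- \<epsilon>) / \<eta>) \<longlonglongrightarrow> 0" using c \<epsilon>_pos assms by real_asymp
  show "eventually (\<lambda>n. measure_pmf.prob (\<mu> n) (many_atypical \<eta> n) \<le> real r * real n powr (- \<epsilon>) / \<eta>) sequentially"
    using pattern_prob[of 1 0] eventually_ge_at_top[of 1]
  proof eventually_elim
    case (elim n)
    let ?b = "real r * real n powr (- \<epsilon>)"
    have X: "X n f = {v \<in> {1..n}. v \<in> X n f}" for f unfolding X_def by auto
    have "measure_pmf.prob (\<mu> n) {f. \<eta> * real n \<le> real (card {v \<in> {1..n}. v \<in> X n f})} \<le> real (card {1..n}) * ?b / (\<eta> * real n)"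
    proof (rule prob_card_ge)
      show "0 < \<eta> * real n" using assms elim by simp
      fix v assume v: "v \<in> {1..n}"
      have "measure_pmf.prob (\<mu> n) {f. (\<forall>e\<in>{}. f e \<noteq> 0) \<and> {v} \<subseteq> X n f \<and> (\<forall>s\<in>{}. card (nbrs n f s) \<le> 0)}
        \<le> p n ^ card ({} :: nat set set) * (real r * real n powr (- \<epsilon>)) ^ card {v} * degree_weight 0 1 n ^ card ({} :: nat set)"
        using v by (intro elim(1)[rule_format, of "{v}"]) auto
      then show "measure_pmf.prob (\<mu> n) {f. v \<in> X n f} \<le> ?b" by simp
    qed auto
    then show ?case unfolding many_atypical_def using X elim(2) by simp
  qed
qed

definition "many_edges \<eta> n = {f. \<eta> * (real n)\<^sup>2 \<le>
   real (card {e \<in> all_edges n. f e \<noteq> 0})}"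

text \<open>Edges exposed in the first round are lost as boosters, so they must be few compared with
  the quadratically many boosters.\<close>

lemma null_many_edges:
  assumes "0 < \<eta>"
  shows "null (many_edges \<eta>)"
proof (rule nullI)
  show "(\<lambda>n. 2 * ln (real n) / real n / \<eta>) \<longlonglongrightarrow> 0" using assms by real_asymp
  show "eventually (\<lambda>n. measure_pmf.prob (\<mu> n) (many_edges \<eta> n) \<le> 2 * ln (real n) / real n / \<eta>) sequentially"
    using p_upper eventually_ge_at_top[of 1]
  proof eventually_elim
    case (elim n)
    have "measure_pmf.prob (\<mu> n) (many_edges \<eta> n)
      \<le> real (card (all_edges n)) * p n / (\<eta> * (real n)\<^sup>2)"
      unfolding many_edges_def
    proof (rule prob_card_ge)
      show "0 < \<eta> * (real n)\<^sup>2" using assms elim by simp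
      fix e assume "e \<in> all_edges n"
      then have "measure_pmf.prob (\<mu> n) {f. \<forall>e'\<in>{e}. f e' \<in> -{0}} = (\<Prod>e'\<in>{e}. measure_pmf.prob (q n) (-{0}))"
        unfolding \<mu>_def by (intro prob_Pi_pmf_all) auto
      then show "measure_pmf.prob (\<mu> n) {f. f e \<noteq> 0} \<le> p n" using q_present by simp
    qed auto
    also have "\<dots> \<le> (real n)\<^sup>2 * (2 * ln (real n) / real n) / (\<eta> * (real n)\<^sup>2)"
    proof -
      have "real (card (all_edges n)) \<le> real (n * n)" using card_all_edges_le by (simp only: of_nat_le_iff)
      then have "real (card (all_edges n)) * p n \<le> (real n)\<^sup>2 * (2 * ln (real n) / real n)"
        using elim p_nonneg by (intro mult_mono) (auto simp: power2_eq_square)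
      then show ?thesis using assms by (intro divide_right_mono) auto
    qed
    also have "\<dots> = 2 * ln (real n) / real n / \<eta>" using elim assms by (simp add: field_simps)
    finally show ?case .
  qed
qed

end

text \<open>Chosen such that \<open>36 * exp 1 * (3 * density e) / e = exp (- 54 / e)\<close>, which makes the union bound in
  \<open>null_overfull\<close> at most \<open>n\<^sup>t * n\<^sup>-\<^sup>3\<^sup>t\<close> for sets of \<open>t\<close> vertices.\<close>

definition density :: "real \<Rightarrow> real" where
  "density e = e * exp (- 54 / e) / (108 * exp 1)"

lemma density_bounds:
  assumes "0 < e" "e \<le> 1"
  shows "0 < density e" "density e \<le> 1"
proof -
  show "0 < density e" unfolding density_def using assms by simp
  have "e * exp (- 54 / e) \<le> 1 * 1" using assms by (intro mult_mono) auto
  also have "(1::real) * 1 \<le> 108 * exp 1"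
    using mult_mono[of 1 108 1 "exp 1 :: real"] by simp
  finally show "density e \<le> 1" unfolding density_def by (simp add: divide_le_eq)
qed

section \<open>Edges inside and between vertex sets\<close>

context first_round
begin

definition "\<delta> = density \<epsilon>"
text \<open>Half of the threshold in \<open>X\<close>; for large \<open>n\<close> the other half
  pays for the constant \<open>K1 + K2\<close> in \<open>typical\<close>.\<close>

definition "deg n = nat \<lfloor>\<epsilon> * ln (real n) / 2\<rfloor>"

lemma \<delta>: "0 < \<delta>" "\<delta> \<le> 1"
proof -
  have "a * \<beta> \<le> 1 * 1" using a \<beta>(1) \<beta>_le by (intro mult_mono) auto
  then have "\<epsilon> \<le> 1" unfolding \<epsilon>_def by simp
  then show "0 < \<delta>" "\<delta> \<le> 1" unfolding \<delta>_def using density_bounds \<epsilon>_pos by auto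
qed

definition "overfull n = {f. \<exists>T. T \<subseteq> {1..n} \<and> T \<noteq> {} \<and> real (card T) \<le> 3 * \<delta> * real n \<and>
  deg n * card T \<le> 6 * card {e \<in> all_edges n. e \<subseteq> T \<and> f e \<noteq> 0}}"

lemma null_overfull:
  "null overfull"
proof (rule nullI)
  show "(\<lambda>n. 1 / real n) \<longlonglongrightarrow> 0" by real_asymp
  have "eventually (\<lambda>n. \<epsilon> * ln (real n) / 3 \<le> \<epsilon> * ln (real n) / 2 - 1) sequentially"
    using \<epsilon>_pos by real_asymp
  moreover have "eventually (\<lambda>n. 1 \<le> \<epsilon> * ln (real n) / 3) sequentially" using \<epsilon>_pos by real_asymp
  ultimately show "eventually (\<lambda>n. measure_pmf.prob (\<mu> n) (overfull n) \<le> 1 / real n) sequentially"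
    using p_upper eventually_ge_at_top[of 2]
  proof eventually_elim
    case (elim n)
    let ?l = "ln (real n)"
    have l: "0 < ?l" using elim(4) by simp
    have d3: "\<epsilon> * ?l / 3 \<le> real (deg n)"
      unfolding deg_def using elim(1,2) by (simp add: of_nat_nat) linarith
    then have d1: "1 \<le> deg n" using elim(2) by linarith
    \<comment> \<open>Rounded up: an overfull set of \<open>t\<close> vertices spans at least a
      sixth of \<open>deg n * t\<close> edges.\<close>
    define m where "m t = (deg n * t + 5) div 6" for t
    define P where "P T = {e. e \<subseteq> T \<and> card e = 2}" for T :: "nat set"
    define G where "G t T = {f. m t \<le> card {e \<in> P T. f e \<noteq> (0 :: nat)}}" for t T
    define E where "E t = {f. real t \<le> 3 * \<delta> * real n \<and> (\<exists>T. T \<subseteq> {1..n} \<and> card T = t \<and> f \<in> G t T)}" for t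
    have PT: "{e \<in> all_edges n. e \<subseteq> T \<and> f e \<noteq> 0} = {e \<in> P T. f e \<noteq> 0}" if "T \<subseteq> {1..n}" for T and f :: "nat set \<Rightarrow> nat"
      unfolding all_edges_def P_def using that by auto
    have GT: "measure_pmf.prob (\<mu> n) (G t T) \<le> exp (- (3 * real t * ?l))"
      if T: "T \<subseteq> {1..n}" "card T = t" and t: "1 \<le> t" "real t \<le> 3 * \<delta> * real n" for t T
    proof -
      have fT: "finite T" using T finite_subset by blast
      have "P T \<subseteq> Pow T" unfolding P_def by auto
      then have fP: "finite (P T)" using fT finite_subset by blast
      have "card (P T) \<le> t * t" unfolding P_def using card_pairs_le[OF fT] T(2) by simp
      then have cP: "real (card (P T)) \<le> real t * real t" by (metis of_nat_le_iff of_nat_mult)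
      have PA: "P T \<subseteq> all_edges n" unfolding P_def all_edges_def using T by auto
      let ?I = "{A. A \<subseteq> P T \<and> card A = m t}"
      have "1 \<le> deg n * t" using d1 t by (metis mult_le_mono nat_mult_1)
      then have "6 div 6 \<le> m t" unfolding m_def by (intro div_le_mono) linarith
      then have m0: "0 < m t" by simp
      have "deg n * t \<le> 6 * m t" unfolding m_def by simp
      then have "real (deg n * t) \<le> real (6 * m t)" by (simp only: of_nat_le_iff)
      then have "real (deg n) * real t \<le> 6 * real (m t)" by simp
      moreover have "\<epsilon> * ?l / 3 * real t \<le> real (deg n) * real t" using d3 by (intro mult_right_mono) auto
      \<comment> \<open>18 is 6 from \<open>m\<close> times 3 from \<open>d3\<close>. With at most
        \<open>t * t\<close> pairs, the base of the power below is at most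
        \<open>36 * exp 1 * t / (\<epsilon> * n)\<close>, hence at most
        \<open>exp (- 54 / \<epsilon>)\<close>; raised to this \<open>m t\<close> it is at most
        \<open>n\<close> to the power \<open>- 3 * t\<close>.\<close>
      ultimately have m: "\<epsilon> * ?l * real t / 18 \<le> real (m t)" by simp
      have "measure_pmf.prob (\<mu> n) (G t T) \<le> real (card ?I) * p n ^ m t"
      proof (rule prob_union_le)
        show "finite ?I" using fP by auto
        show "G t T \<subseteq> (\<Union>A\<in>?I. {f. \<forall>e\<in>A. f e \<in> - {0}})"
        proof
          fix f assume "f \<in> G t T"
          then have "m t \<le> card {e \<in> P T. f e \<noteq> 0}" unfolding G_def by simp
          from obtain_subset_with_card_n[OF this]
          obtain A where "A \<subseteq> {e \<in> P T. f e \<noteq> 0}" "card A = m t" by metis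
          then show "f \<in> (\<Union>A\<in>?I. {f. \<forall>e\<in>A. f e \<in> - {0}})" by auto
        qed
        fix A assume A: "A \<in> ?I"
        then have "measure_pmf.prob (\<mu> n) {f. \<forall>e\<in>A. f e \<in> - {0}} = (\<Prod>e\<in>A. measure_pmf.prob (q n) (- {0}))"
          unfolding \<mu>_def using PA by (intro prob_Pi_pmf_all) auto
        then show "measure_pmf.prob (\<mu> n) {f. \<forall>e\<in>A. f e \<in> - {0}} \<le> p n ^ m t"
          using A by (simp add: q_present)
      qed
      also have "real (card ?I) * p n ^ m t = real (card (P T) choose m t) * p n ^ m t"
        using n_subsets[OF fP] by simp
      also have "\<dots> \<le> (exp 1 * real (card (P T)) * p n / real (m t)) ^ m t"
        by (rule binomial_times_power_le[OF m0 p_nonneg])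
      also have "\<dots> \<le> exp (- 54 / \<epsilon>) ^ m t"
      proof (rule power_mono)
        have pos: "0 < \<epsilon> * ?l * real t / 18" using \<epsilon>_pos l t by simp
        have "exp 1 * real (card (P T)) * p n \<le> exp 1 * (real t * real t) * (2 * ?l / real n)"
          using cP elim(3) p_nonneg by (intro mult_mono mult_left_mono) auto
        then have "exp 1 * real (card (P T)) * p n / real (m t) \<le>
          exp 1 * (real t * real t) * (2 * ?l / real n) / (\<epsilon> * ?l * real t / 18)"
          using m pos l by (intro frac_le) (auto intro!: mult_nonneg_nonneg divide_nonneg_nonneg)
        also have "\<dots> = 36 * exp 1 / (\<epsilon> * real n) * real t"
          using l t elim(4) \<epsilon>_pos by (simp add: field_simps)
        also have "\<dots> \<le> 36 * exp 1 / (\<epsilon> * real n) * (3 * \<delta> * real n)"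
          using t \<epsilon>_pos by (intro mult_left_mono) auto
        also have "\<dots> = exp (- 54 / \<epsilon>)"
          unfolding \<delta>_def density_def using \<epsilon>_pos elim(4) by (simp add: field_simps)
        finally show "exp 1 * real (card (P T)) * p n / real (m t) \<le> exp (- 54 / \<epsilon>)" .
        show "0 \<le> exp 1 * real (card (P T)) * p n / real (m t)" using p_nonneg by simp
      qed
      also have "\<dots> = exp (- (54 / \<epsilon> * real (m t)))" by (simp add: exp_of_nat_mult[symmetric] mult.commute)
      also have "\<dots> \<le> exp (- (3 * real t * ?l))"
      proof -
        have "54 / \<epsilon> * (\<epsilon> * ?l * real t / 18) \<le> 54 / \<epsilon> * real (m t)"
          using m \<epsilon>_pos by (intro mult_left_mono) auto
        moreover have "54 / \<epsilon> * (\<epsilon> * ?l * real t / 18) = 3 * real t * ?l" using \<epsilon>_pos by (simp add: field_simps)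
        ultimately show ?thesis by simp
      qed
      finally show ?thesis .
    qed
    have Et: "measure_pmf.prob (\<mu> n) (E t) \<le> 1 / (real n * real n)" if t: "t \<in> {1..n}" for t
    proof (cases "real t \<le> 3 * \<delta> * real n")
      case False
      then have "E t = {}" unfolding E_def by auto
      then show ?thesis by simp
    next
      case True
      let ?I = "{T. T \<subseteq> {1..n} \<and> card T = t}"
      have "measure_pmf.prob (\<mu> n) (E t) \<le> real (card ?I) * exp (- (3 * real t * ?l))"
      proof (rule prob_union_le)
        show "finite ?I" by auto
        show "E t \<subseteq> (\<Union>T\<in>?I. G t T)" unfolding E_def by auto
        show "\<And>T. T \<in> ?I \<Longrightarrow> measure_pmf.prob (\<mu> n) (G t T) \<le> exp (- (3 * real t * ?l))"
          using GT t True by auto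
      qed
      also have "\<dots> \<le> real (n ^ t) * exp (- (3 * real t * ?l))"
        by (intro mult_right_mono iffD2[OF of_nat_le_iff] card_subsets_le) auto
      also have "real (n ^ t) = exp (real t * ?l)" using elim(4) by (simp add: exp_of_nat_mult)
      also have "exp (real t * ?l) * exp (- (3 * real t * ?l)) = exp (- (2 * (real t * ?l)))"
        by (simp add: exp_add[symmetric])
      also have "\<dots> \<le> exp (- (2 * (1 * ?l)))"
      proof -
        have "1 * ?l \<le> real t * ?l" using t l by (intro mult_right_mono) auto
        then show ?thesis by simp
      qed
      also have "\<dots> = exp (- ?l) * exp (- ?l)" by (simp add: exp_add[symmetric])
      also have "\<dots> = 1 / (real n * real n)" using elim(4) by (simp add: exp_minus field_simps)
      finally show ?thesis .
    qed
    have "measure_pmf.prob (\<mu> n) (overfull n) \<le> real (card {1..n}) * (1 / (real n * real n))"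
    proof (rule prob_union_le[OF _ _ Et])
      show "overfull n \<subseteq> (\<Union>t\<in>{1..n}. E t)"
      proof
        fix f :: "nat set \<Rightarrow> nat" assume "f \<in> overfull n"
        then obtain T where T: "T \<subseteq> {1..n}" "T \<noteq> {}" "real (card T) \<le> 3 * \<delta> * real n"
          "deg n * card T \<le> 6 * card {e \<in> all_edges n. e \<subseteq> T \<and> f e \<noteq> 0}" unfolding overfull_def by blast
        have fT: "finite T" using T finite_subset by blast
        have "card T \<in> {1..n}" using T fT card_mono[OF _ T(1)] card_gt_0_iff[of T] by auto
        moreover have "m (card T) \<le> card {e \<in> P T. f e \<noteq> 0}"
          using T(4) unfolding m_def PT[OF T(1)] by linarith
        then have "f \<in> E (card T)" unfolding E_def G_def using T by auto
        ultimately show "f \<in> (\<Union>t\<in>{1..n}. E t)" by blast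
      qed
    qed auto
    also have "\<dots> = 1 / real n" using elim(4) by simp
    finally show ?case .
  qed
qed

definition "uncrossed c n = {f. \<exists>i\<in>{1..r}. \<exists>S S'. S \<subseteq> {1..n} \<and> S' \<subseteq> {1..n} \<and> S \<inter> S' = {} \<and>
  c * real n \<le> real (card S) \<and> c * real n \<le> real (card S') \<and> (\<forall>x\<in>S. \<forall>y\<in>S'. f {x, y} \<noteq> i)}"

text \<open>There are at most \<open>4 ^ n\<close> pairs of sets for each colour, against
  \<open>exp (- (a * c\<^sup>2 * n * ln n))\<close> for the absence of that colour from the at least
  \<open>c\<^sup>2 * n\<^sup>2\<close> pairs between them.\<close>

lemma null_uncrossed:
  assumes c: "0 < c"
  shows "null (uncrossed c)"
proof (rule nullI)
  have c': "0 < a * c\<^sup>2" and r0: "0 < real r" using c a r2 by auto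
  show "(\<lambda>n. real r * 4 ^ n * exp (- (a * c\<^sup>2 * real n * ln (real n)))) \<longlonglongrightarrow> 0"
  proof -
    have "(\<lambda>n. r' * 4 ^ n * exp (- (c' * real n * ln (real n)))) \<longlonglongrightarrow> 0" if "0 < c'" "0 < r'" for c' r' :: real
      using that by real_asymp
    from this[OF c' r0] show ?thesis .
  qed
  show "eventually (\<lambda>n. measure_pmf.prob (\<mu> n) (uncrossed c n) \<le> real r * 4 ^ n * exp (- (a * c\<^sup>2 * real n * ln (real n)))) sequentially"
    using p_ge eventually_ge_at_top[of 1]
  proof eventually_elim
    case (elim n)
    let ?E = "uncrossed c n"
    let ?b = "exp (- (a * c\<^sup>2 * real n * ln (real n)))"
    define I where "I = {1..r} \<times> Pow {1..n} \<times> Pow {1..n}"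
    define ES where "ES S S' = (\<lambda>(x, y). {x, y}) ` (S \<times> S')" for S S' :: "nat set"
    define G where "G = (\<lambda>(i, S, S'). {f. (S \<inter> S' = {} \<and> c * real n \<le> real (card S) \<and> c * real n \<le> real (card S')) \<and>
      (\<forall>e\<in>ES S S'. f e \<in> - {i :: nat})})"
    have "card I = r * (2 ^ n * 2 ^ n)" unfolding I_def card_cartesian_product by (simp add: card_Pow)
    then have cI: "real (card I) = real r * 4 ^ n" by (simp add: power_mult_distrib[symmetric])
    have "measure_pmf.prob (\<mu> n) ?E \<le> real (card I) * ?b"
    proof (rule prob_union_le)
      show "finite I" unfolding I_def by auto
      show "?E \<subseteq> (\<Union>x\<in>I. G x)"
      proof
        fix f assume "f \<in> ?E"
        then obtain i S S' where S: "i \<in> {1..r}" "S \<subseteq> {1..n}" "S' \<subseteq> {1..n}" "S \<inter> S' = {}" "c * real n \<le> real (card S)"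
          "c * real n \<le> real (card S')" "\<forall>x\<in>S. \<forall>y\<in>S'. f {x, y} \<noteq> i" unfolding uncrossed_def by blast
        then have "(i, S, S') \<in> I" "f \<in> G (i, S, S')" unfolding I_def G_def ES_def by auto
        then show "f \<in> (\<Union>x\<in>I. G x)" by blast
      qed
      fix y assume "y \<in> I"
      then obtain i S S' where y: "y = (i, S, S')" "i \<in> {1..r}" "S \<subseteq> {1..n}" "S' \<subseteq> {1..n}" unfolding I_def by auto
      show "measure_pmf.prob (\<mu> n) (G y) \<le> ?b"
      proof (cases "S \<inter> S' = {} \<and> c * real n \<le> real (card S) \<and> c * real n \<le> real (card S')")
        case False
        then have "G y = {}" unfolding G_def y by auto
        then show ?thesis by simp
      next
        case True
        let ?P = "measure_pmf.prob (q n) {i}"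
        have inj: "inj_on (\<lambda>(x, y). {x, y}) (S \<times> S')"
        proof (rule inj_onI, clarify)
          fix x y x' y' assume h: "x \<in> S" "y \<in> S'" "x' \<in> S" "y' \<in> S'" "{x, y} = {x', y'}"
          then have "x \<noteq> y'" using True by auto
          then show "x = x' \<and> y = y'" using h(5) by (auto simp: doubleton_eq_iff)
        qed
        have cES: "card (ES S S') = card S * card S'"
          unfolding ES_def card_image[OF inj] by (rule card_cartesian_product)
        have sub: "ES S S' \<subseteq> all_edges n"
        proof
          fix e assume "e \<in> ES S S'"
          then obtain x x' where e: "e = {x, x'}" "x \<in> S" "x' \<in> S'" unfolding ES_def by auto
          then have "x \<noteq> x'" using True by auto
          then show "e \<in> all_edges n" unfolding e(1) using e y by (intro pair_in_all_edges) auto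
        qed
        have "G y \<subseteq> {f. \<forall>e\<in>ES S S'. f e \<in> - {i}}" unfolding G_def y by auto
        then have "measure_pmf.prob (\<mu> n) (G y) \<le> measure_pmf.prob (\<mu> n) {f. \<forall>e\<in>ES S S'. f e \<in> - {i}}"
          by (intro measure_pmf.finite_measure_mono) auto
        also have "\<dots> = (\<Prod>e\<in>ES S S'. measure_pmf.prob (q n) (- {i}))"
          unfolding \<mu>_def by (rule prob_Pi_pmf_all[where Q = "\<lambda>_. - {i}", OF finite_all_edges sub])
        also have "\<dots> = (1 - ?P) ^ (card S * card S')"
          using measure_pmf.prob_compl[of "{i}" "q n"] cES by (simp add: Compl_eq_Diff_UNIV)
        also have "\<dots> \<le> exp (- ?P) ^ (card S * card S')"
          using exp_ge_add_one_self[of "- ?P"] by (intro power_mono) auto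
        also have "\<dots> = exp (- (?P * (real (card S) * real (card S'))))"
          by (simp add: exp_of_nat_mult[symmetric] mult_ac)
        also have "\<dots> \<le> ?b"
        proof -
          have "a * (ln (real n) / real n) \<le> a * p n" using elim(1) a by (intro mult_left_mono) auto
          also have "\<dots> \<le> ?P" by (rule q_colour[OF y(2)])
          finally have P: "a * (ln (real n) / real n) \<le> ?P" .
          have "(c * real n) * (c * real n) \<le> real (card S) * real (card S')"
            using True c by (intro mult_mono) auto
          then have "a * (ln (real n) / real n) * ((c * real n) * (c * real n)) \<le> ?P * (real (card S) * real (card S'))"
            using c by (intro mult_mono[OF P]) simp_all
          moreover have "a * (ln (real n) / real n) * ((c * real n) * (c * real n)) = a * c\<^sup>2 * real n * ln (real n)"
            using elim(2) by (simp add: power2_eq_square field_simps)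
          ultimately show ?thesis by simp
        qed
        finally show ?thesis .
      qed
    qed
    then show ?case unfolding cI by simp
  qed
qed

text \<open>Each counted \<open>z\<close> gets another neighbour \<open>g z\<close> in
  \<open>X\<close>. By the codegree bound \<open>g\<close> is at most two-to-one, so more than
  \<open>2 * K\<close> such \<open>z\<close> would yield \<open>K\<close> different values, and one
  preimage of each makes a spider. Its feet and knees differ because the \<open>z\<close> lie
  outside \<open>X\<close>.\<close>

lemma spider_count:
  assumes v: "v \<in> {1..n}"
    and codegree: "\<And>x. x \<in> {1..n} \<Longrightarrow> v \<noteq> x \<Longrightarrow> card (nbrs n f v \<inter> nbrs n f x) < 3"
    and no_spider: "\<not> (\<exists>zs xs. length zs = K \<and> length xs = K \<and> set xs \<subseteq> X n f \<and> set zs \<subseteq> {1..n} \<and>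
       distinct (v # zs @ xs) \<and> (\<forall>j<K. f {v, zs ! j} \<noteq> 0 \<and> f {zs ! j, xs ! j} \<noteq> 0))"
  shows "card {z \<in> nbrs n f v - X n f. \<exists>x\<in>X n f. x \<noteq> v \<and> z \<in> nbrs n f x} \<le> 2 * K"
proof (rule ccontr)
  define B where "B = {z \<in> nbrs n f v - X n f. \<exists>x\<in>X n f. x \<noteq> v \<and> z \<in> nbrs n f x}"
  assume "\<not> ?thesis"
  then have big: "2 * K < card B" unfolding B_def by simp
  have fN: "finite (nbrs n f u)" for u unfolding nbrs_def by auto
  then have fB: "finite B" unfolding B_def by auto
  have XS: "X n f \<subseteq> {1..n}" unfolding X_def by auto
  define g where "g z = (SOME x. x \<in> X n f \<and> x \<noteq> v \<and> z \<in> nbrs n f x)" for z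
  have g: "g z \<in> X n f \<and> g z \<noteq> v \<and> z \<in> nbrs n f (g z)" if "z \<in> B" for z
  proof -
    have "\<exists>x. x \<in> X n f \<and> x \<noteq> v \<and> z \<in> nbrs n f x" using that unfolding B_def by blast
    from someI_ex[OF this] show ?thesis unfolding g_def .
  qed
  have fibre: "card {z \<in> B. g z = x} \<le> 2" if "x \<in> g ` B" for x
  proof -
    from that obtain z where z: "x = g z" "z \<in> B" by (rule imageE)
    have x: "x \<in> {1..n}" "v \<noteq> x" using g[OF z(2)] XS unfolding z(1) by auto
    have "{z \<in> B. g z = x} \<subseteq> nbrs n f v \<inter> nbrs n f x"
    proof
      fix y assume "y \<in> {z \<in> B. g z = x}"
      then have y: "y \<in> B" "g y = x" by simp_all
      show "y \<in> nbrs n f v \<inter> nbrs n f x" using g[OF y(1)] y unfolding B_def by simp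
    qed
    then have "card {z \<in> B. g z = x} \<le> card (nbrs n f v \<inter> nbrs n f x)" using fN by (intro card_mono) auto
    then show ?thesis using codegree[OF x] by simp
  qed
  have "B = (\<Union>x\<in>g ` B. {z \<in> B. g z = x})" by blast
  then have "card B = card (\<Union>x\<in>g ` B. {z \<in> B. g z = x})" by simp
  also have "\<dots> \<le> (\<Sum>x\<in>g ` B. card {z \<in> B. g z = x})" using fB by (intro card_UN_le) auto
  also have "\<dots> \<le> (\<Sum>x\<in>g ` B. 2)" by (intro sum_mono fibre)
  finally have "K \<le> card (g ` B)" using big by simp
  from obtain_subset_with_card_n[OF this] obtain D where D: "D \<subseteq> g ` B" "card D = K" by blast
  have "finite D" using D fB finite_subset by blast
  then obtain xs where xs: "set xs = D" "distinct xs" using finite_distinct_list by blast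
  have lx: "length xs = K" using distinct_card[OF xs(2)] xs(1) D(2) by simp
  define h where "h x = (SOME z. z \<in> B \<and> g z = x)" for x
  have h: "h x \<in> B \<and> g (h x) = x" if "x \<in> D" for x
  proof -
    have "\<exists>z. z \<in> B \<and> g z = x" using that D(1) by blast
    from someI_ex[OF this] show ?thesis unfolding h_def .
  qed
  have "inj_on h D" using h by (metis inj_onI)
  then have dz: "distinct (map h xs)" using xs by (simp add: distinct_map)
  have sz: "set (map h xs) \<subseteq> B"
  proof
    fix z assume "z \<in> set (map h xs)"
    then obtain x where "x \<in> D" "z = h x" using xs(1) by auto
    then show "z \<in> B" using h[of x] by simp
  qed
  have "x \<in> X n f \<and> x \<noteq> v" if "x \<in> D" for x
  proof -
    have "x \<in> g ` B" using that D(1) by blast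
    then obtain z where z: "x = g z" "z \<in> B" by (rule imageE)
    show ?thesis using g[OF z(2)] unfolding z(1) by simp
  qed
  then have sD: "D \<subseteq> X n f" "v \<notin> D" by auto
  have vB: "v \<notin> B" unfolding B_def nbrs_def by auto
  have "B \<inter> X n f = {}" unfolding B_def by auto
  then have "distinct (v # map h xs @ xs)" using dz xs sz sD vB by auto
  moreover have "f {v, map h xs ! j} \<noteq> 0 \<and> f {map h xs ! j, xs ! j} \<noteq> 0" if j: "j < K" for j
  proof -
    have "xs ! j \<in> D" using j lx xs(1) by auto
    from h[OF this] have b: "h (xs ! j) \<in> B" "g (h (xs ! j)) = xs ! j" by auto
    have "h (xs ! j) \<in> nbrs n f (xs ! j)" using g[OF b(1)] b(2) by simp
    moreover have "h (xs ! j) \<in> nbrs n f v" using b(1) unfolding B_def by simp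
    ultimately show ?thesis using j lx unfolding nbrs_def by (simp add: insert_commute)
  qed
  moreover have "set (map h xs) \<subseteq> {1..n}" using sz unfolding B_def nbrs_def by blast
  ultimately have "length (map h xs) = K \<and> length xs = K \<and> set xs \<subseteq> X n f \<and> set (map h xs) \<subseteq> {1..n} \<and>
       distinct (v # map h xs @ xs) \<and> (\<forall>j<K. f {v, map h xs ! j} \<noteq> 0 \<and> f {map h xs ! j, xs ! j} \<noteq> 0)"
    using lx sD(1) xs(1) length_map[of h xs] by blast
  with no_spider show False by (elim notE) (intro exI)
qed

section \<open>Constants and assembly of the first round\<close>

definition "K = nat \<lceil>2 / \<epsilon>\<rceil>"

lemma K_large: "2 \<le> real K * \<epsilon>"
proof -
  have "2 / \<epsilon> \<le> real K" unfolding K_def by (rule real_nat_ceiling_ge)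
  then show ?thesis using \<epsilon>_pos by (simp add: field_simps)
qed

text \<open>Small against \<open>\<delta>\<close> for \<open>k_large\<close>, and against
  \<open>\<beta>\<close> for \<open>b_large\<close> and \<open>n_large\<close>.\<close>

definition "\<eta> = min \<delta> \<beta> / 16"

lemma \<eta>: "0 < \<eta>" "\<eta> \<le> \<delta> / 16" "\<eta> \<le> \<beta> / 16" unfolding \<eta>_def using \<delta> \<beta> by auto

text \<open>\<open>3 * K + r\<close> is \<open>K1 + K2 + r\<close> for \<open>K1 = K\<close> and
  \<open>K2 = 2 * K\<close>; \<open>\<delta>\<^sup>2 / 16\<close> leaves half of the guaranteed
  \<open>\<delta>\<^sup>2 * n\<^sup>2 / 8\<close> boosters; \<open>\<delta> / 8 * n\<close> lies
  below the rounded value of \<open>\<delta> * n / 4\<close> used for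
  \<open>crossing\<close>.\<close>

definition "bad n = crowded K n \<union> (high_codegree n \<union> (spiders K n \<union> (small_adjacent (3 * K + r) n \<union>
  (small_distance_two (3 * K + r) n \<union> (low_degree n \<union> (many_atypical \<eta> n \<union>
  (many_edges (\<delta>\<^sup>2 / 16) n \<union> (overfull n \<union> uncrossed (\<delta> / 8) n))))))))"

lemma null_bad: "null bad"
proof -
  have "null (\<lambda>n. bad n)"
    unfolding bad_def
    by (intro null_Un null_crowded[OF K_large] null_high_codegree null_spiders[OF K_large] null_small_adjacent
      null_small_distance_two null_low_degree null_many_atypical null_many_edges null_overfull null_uncrossed \<eta>)
      (use \<delta> in auto)
  then show ?thesis .
qed

text \<open>\<open>k\<close> is about \<open>\<delta> * n\<close> because \<open>overfull\<close>
  controls sets of up to \<open>3 * \<delta> * n\<close> vertices; \<open>s\<close> is about a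
  quarter of \<open>k\<close>, which leaves room for the forced vertices; \<open>b\<close> is the
  least class size allowed by \<open>profiles_ge\<close>.\<close>

lemma eventually_good:
  "eventually (\<lambda>n. \<forall>f\<in>set_pmf (\<mu> n) - bad n.
     good_colouring n r f (U n) (X n f) K (2 * K) (deg n) (nat \<lfloor>\<delta> * real n\<rfloor>) (nat \<lceil>\<beta> * real n\<rceil>) (nat \<lfloor>\<delta> * real n / 4\<rfloor>)) sequentially"
proof -
  have e1: "eventually (\<lambda>n. 3 * real K \<le> \<epsilon> * ln (real n) / 2) sequentially" using \<epsilon>_pos by real_asymp
  have e2: "eventually (\<lambda>n. 8 \<le> \<delta> * real n) sequentially" using \<delta>(1) by real_asymp
  have e3: "eventually (\<lambda>n. 4 \<le> \<beta> * real n) sequentially" using \<beta>(1) by real_asymp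
  have e4: "eventually (\<lambda>n. real r \<le> real n / 8) sequentially" by real_asymp
  show ?thesis using e1 e2 e3 e4 eventually_ge_at_top[of 3]
  proof eventually_elim
    case (elim n)
    show ?case
    proof
      fix f assume "f \<in> set_pmf (\<mu> n) - bad n"
      then have fs: "f \<in> set_pmf (\<mu> n)" and nb: "f \<notin> bad n" by auto
      note c1 = nb[unfolded bad_def crowded_def high_codegree_def spiders_def small_adjacent_def small_distance_two_def
        low_degree_def many_atypical_def many_edges_def overfull_def uncrossed_def Un_iff de_Morgan_disj mem_Collect_eq]
      note c2 = c1[THEN conjunct2]
      note c3 = c2[THEN conjunct2]
      note c4 = c3[THEN conjunct2]
      note c5 = c4[THEN conjunct2]
      note c6 = c5[THEN conjunct2]
      note c7 = c6[THEN conjunct2]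
      note c8 = c7[THEN conjunct2]
      note c9 = c8[THEN conjunct2]
      have b1: "\<And>v. v \<in> {1..n} \<Longrightarrow> card (nbrs n f v \<inter> X n f) < K"
        using c1[THEN conjunct1] by (meson not_le)
      have b2: "\<And>v x. v \<in> {1..n} \<Longrightarrow> x \<in> {1..n} \<Longrightarrow> v \<noteq> x \<Longrightarrow> card (nbrs n f v \<inter> nbrs n f x) < 3"
        using c2[THEN conjunct1] by (meson not_le)
      have b3: "\<And>v. v \<in> {1..n} \<Longrightarrow> \<not> (\<exists>zs xs. length zs = K \<and> length xs = K \<and> set xs \<subseteq> X n f \<and> set zs \<subseteq> {1..n} \<and>
        distinct (v # zs @ xs) \<and> (\<forall>j<K. f {v, zs ! j} \<noteq> 0 \<and> f {zs ! j, xs ! j} \<noteq> 0))"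
        using c3[THEN conjunct1] by blast
      have b4: "\<And>v x. v \<in> {1..n} \<Longrightarrow> card (nbrs n f v) \<le> 3 * K + r \<Longrightarrow> x \<in> X n f \<Longrightarrow> x \<noteq> v \<Longrightarrow> f {v, x} = 0"
        using c4[THEN conjunct1] by blast
      have b5: "\<And>v z x. v \<in> {1..n} \<Longrightarrow> card (nbrs n f v) \<le> 3 * K + r \<Longrightarrow> z \<in> {1..n} \<Longrightarrow> x \<in> X n f \<Longrightarrow>
         z \<noteq> v \<Longrightarrow> x \<noteq> v \<Longrightarrow> x \<noteq> z \<Longrightarrow> f {v, z} \<noteq> 0 \<Longrightarrow> f {z, x} = 0"
        using c5[THEN conjunct1] by blast
      have b6: "\<And>v. v \<in> {1..n} \<Longrightarrow> r < card (nbrs n f v)"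
        using c6[THEN conjunct1] by (meson not_le)
      have b7: "real (card (X n f)) < \<eta> * real n"
        using c7[THEN conjunct1] by (simp only: not_le)
      have b9: "\<And>T. T \<subseteq> {1..n} \<Longrightarrow> T \<noteq> {} \<Longrightarrow> real (card T) \<le> 3 * \<delta> * real n \<Longrightarrow>
         6 * card {e \<in> all_edges n. e \<subseteq> T \<and> f e \<noteq> 0} < deg n * card T"
        using c9[THEN conjunct1] by (meson not_le)
      have b10: "\<And>i S S'. i \<in> {1..r} \<Longrightarrow> S \<subseteq> {1..n} \<Longrightarrow> S' \<subseteq> {1..n} \<Longrightarrow> S \<inter> S' = {} \<Longrightarrow> \<delta> / 8 * real n \<le> real (card S) \<Longrightarrow>
         \<delta> / 8 * real n \<le> real (card S') \<Longrightarrow> \<exists>x\<in>S. \<exists>y\<in>S'. f {x, y} = i"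
        using c9[THEN conjunct2] by blast
      have XS: "X n f \<subseteq> {1..n}" unfolding X_def by auto
      let ?k = "nat \<lfloor>\<delta> * real n\<rfloor>" and ?s = "nat \<lfloor>\<delta> * real n / 4\<rfloor>" and ?b = "nat \<lceil>\<beta> * real n\<rceil>"
      have fl: "real (nat \<lfloor>y\<rfloor>) \<le> y" "y - 1 \<le> real (nat \<lfloor>y\<rfloor>)" if "0 \<le> y" for y :: real
        using that of_int_floor_le[of y] real_of_int_floor_gt_diff_one[of y] by (simp_all add: of_nat_nat less_imp_le)
      have k: "real ?k \<le> \<delta> * real n" "\<delta> * real n - 1 \<le> real ?k" using fl[of "\<delta> * real n"] elim(2) by simp_all
      have s: "real ?s \<le> \<delta> * real n / 4" "\<delta> * real n / 4 - 1 \<le> real ?s"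
        using fl[of "\<delta> * real n / 4"] elim(2) by simp_all
      have b: "\<beta> * real n \<le> real ?b" by (rule real_nat_ceiling_ge)
      have x1: "real (card (X n f)) \<le> \<delta> * real n / 16"
      proof -
        have "\<eta> * real n \<le> \<delta> / 16 * real n" using \<eta> by (intro mult_right_mono) auto
        then show ?thesis using b7 by simp
      qed
      have x2: "real (card (X n f)) \<le> \<beta> * real n / 16"
      proof -
        have "\<eta> * real n \<le> \<beta> / 16 * real n" using \<eta> by (intro mult_right_mono) auto
        then show ?thesis using b7 by simp
      qed
      show "good_colouring n r f (U n) (X n f) K (2 * K) (deg n) ?k ?b ?s"
      proof
        show "2 \<le> r" by (rule r2)
        show "3 \<le> n" using elim by simp
        show "f e \<le> r" if "e \<in> all_edges n" for e
        proof -
          have "f \<in> PiE_dflt (all_edges n) 0 (\<lambda>_. set_pmf (q n))"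
            using fs set_Pi_pmf[of "all_edges n" 0 "\<lambda>_. q n"] unfolding \<mu>_def by (simp add: comp_def)
          then have "f e \<in> set_pmf (q n)" using that unfolding PiE_dflt_def by simp
          then show ?thesis using q_set[of n] by auto
        qed
        show "\<And>i. i \<in> {1..r} \<Longrightarrow> U n i \<subseteq> {1..n}" by (rule U_sub)
        show "\<And>i j. i \<in> {1..r} \<Longrightarrow> j \<in> {1..r} \<Longrightarrow> i \<noteq> j \<Longrightarrow> U n i \<inter> U n j = {}" by (rule U_disj)
        show "X n f \<subseteq> {1..n}" by (rule XS)
        show "r + 1 \<le> card (nbrs n f v)" if "v \<in> X n f" for v using b6[of v] that XS by auto
        show "card (nbrs n f v \<inter> X n f) \<le> K" if "v \<in> {1..n}" for v using b1[OF that] by simp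
        show "card {z \<in> nbrs n f v - X n f. \<exists>x\<in>X n f. x \<noteq> v \<and> z \<in> nbrs n f x} \<le> 2 * K" if "v \<in> {1..n}" for v
          by (rule spider_count[OF that b2[OF that] b3[OF that]])
        show "nbrs n f v \<inter> X n f = {} \<and> (\<forall>z\<in>nbrs n f v. \<forall>x\<in>X n f. z \<in> nbrs n f x \<longrightarrow> x = v)"
          if v: "v \<in> X n f" "card (nbrs n f v) < K + 2 * K + r + 1" for v
        proof (intro conjI ballI impI)
          have v': "v \<in> {1..n}" "card (nbrs n f v) \<le> 3 * K + r" using v XS by auto
          show "nbrs n f v \<inter> X n f = {}"
          proof (rule ccontr)
            assume "nbrs n f v \<inter> X n f \<noteq> {}"
            then obtain x where "x \<in> nbrs n f v" "x \<in> X n f" by auto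
            then show False using b4[OF v', of x] unfolding nbrs_def by auto
          qed
          fix z x assume z: "z \<in> nbrs n f v" and x: "x \<in> X n f" and zx: "z \<in> nbrs n f x"
          show "x = v"
          proof (rule ccontr)
            assume "x \<noteq> v"
            then have "f {z, x} = 0" using z zx by (intro b5[OF v' _ x]) (auto simp: nbrs_def)
            then show False using zx unfolding nbrs_def by (simp add: insert_commute)
          qed
        qed
        show "deg n + K + 2 * K \<le> card (cnbrs n f i v \<inter> U n i)" if v: "v \<in> {1..n} - X n f" and i: "i \<in> {1..r}" for v i
        proof -
          have "\<epsilon> * ln (real n) < real (card (cnbrs n f i v \<inter> U n i))" using v i unfolding X_def by force
          moreover have "real (deg n) \<le> \<epsilon> * ln (real n) / 2" unfolding deg_def using \<epsilon>_pos elim(5) by (intro fl) simp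
          ultimately show ?thesis using elim(1) by linarith
        qed
        show "6 * card {e \<in> all_edges n. e \<subseteq> T \<and> f e \<noteq> 0} < deg n * card T"
          if "T \<subseteq> {1..n}" "T \<noteq> {}" "card T \<le> 3 * ?k" for T
        proof (rule b9[OF that(1,2)])
          have "real (card T) \<le> real (3 * ?k)" using that(3) by (simp only: of_nat_le_iff)
          then show "real (card T) \<le> 3 * \<delta> * real n" using k(1) by simp
        qed
        show "\<exists>x\<in>S. \<exists>y\<in>S'. f {x, y} = i"
          if "S \<subseteq> {1..n}" "S' \<subseteq> {1..n}" "S \<inter> S' = {}" "?s \<le> card S" "?s \<le> card S'" "i \<in> {1..r}" for S S' i
        proof (rule b10[OF that(6,1,2,3)])
          show "\<delta> / 8 * real n \<le> real (card S)" using that(4) s(2) elim(2) by linarith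
          show "\<delta> / 8 * real n \<le> real (card S')" using that(5) s(2) elim(2) by linarith
        qed
        show "1 \<le> ?k" using k(2) elim(2) by linarith
        show "?s + 2 * card (X n f) + 2 \<le> ?k" using k(2) s(1) x1 elim(2) by linarith
        show "card (U n i) + 3 * card (X n f) + 1 \<le> ?b" if "i \<in> {1..r}" for i
          using card_U[of i n] that width_bounds(2)[of n] x2 b elim(3) by auto linarith
        have "card (\<Union>i\<in>{1..r}. U n i) \<le> (\<Sum>i\<in>{1..r}. card (U n i))" by (intro card_UN_le) auto
        also have "\<dots> = r * width n" using card_U by simp
        finally have "real (card (\<Union>i\<in>{1..r}. U n i)) \<le> real r * real (width n)"
          by (metis of_nat_le_iff of_nat_mult)
        also have "\<dots> \<le> real r * (\<beta> * real n / 2)" using width_bounds(2)[of n] by (intro mult_left_mono) auto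
        also have "\<dots> = (real r * \<beta>) * (real n / 2)" by simp
        also have "\<dots> \<le> 1 * (real n / 2)" using \<beta> by (intro mult_right_mono) auto
        finally have u: "real (card (\<Union>i\<in>{1..r}. U n i)) \<le> real n / 2" by simp
        have "\<beta> * real n \<le> 1 / 2 * real n" using \<beta>_le by (intro mult_right_mono) auto
        then show "card (\<Union>i\<in>{1..r}. U n i) + 3 * card (X n f) + r \<le> n" using u x2 elim(4) by linarith
      qed
    qed
  qed
qed

text \<open>Edge probability \<open>sprinkle / n\<close> in the second round beats the factor \<open>(32 / \<delta>\<^sup>2)\<^sup>n\<close> in
  \<open>prob_not_forced_ham\<close> by \<open>exp (- n)\<close>, and so also the union bound over all profiles.\<close>

definition "sprinkle = 64 / (a * \<delta>\<^sup>2) * (ln (32 / \<delta>\<^sup>2) + 1)"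

text \<open>The law \<open>q2\<close> is only bounded from below, as \<open>p\<close> may exceed the
  threshold by any amount. For each of at most \<open>(n + 1) ^ r\<close> profiles, failure means
  that one of \<open>r\<close> classes fails.\<close>

lemma second_round:
  "eventually (\<lambda>n. \<forall>f\<in>set_pmf (\<mu> n) - bad n. \<forall>q2. (\<forall>i\<in>{1..r}. a * sprinkle / real n \<le> measure_pmf.prob q2 {i}) \<longrightarrow>
     measure_pmf.prob (Pi_pmf (all_edges n) 0 (\<lambda>e. if f e \<noteq> 0 then return_pmf (f e) else q2))
       {g. \<not> profiles_ge n r \<beta> \<subseteq> hcp n r ({e \<in> all_edges n. g e \<noteq> 0}, g)} \<le> real ((n + 1) ^ r) * (real r * exp (- real n))) sequentially"
proof -
  have e2: "eventually (\<lambda>n. 2 \<le> \<delta> * real n) sequentially" using \<delta>(1) by real_asymp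
  show ?thesis using eventually_good e2 eventually_ge_at_top[of 1]
  proof eventually_elim
    case (elim n)
    show ?case
    proof (intro ballI allI impI)
      fix f q2
      assume f: "f \<in> set_pmf (\<mu> n) - bad n" and q2: "\<forall>i\<in>{1..r}. a * sprinkle / real n \<le> measure_pmf.prob q2 {i}"
      let ?k = "nat \<lfloor>\<delta> * real n\<rfloor>"
      let ?P = "Pi_pmf (all_edges n) 0 (\<lambda>e. if f e \<noteq> 0 then return_pmf (f e) else q2)"
      let ?hcp = "\<lambda>g. hcp n r ({e \<in> all_edges n. g e \<noteq> 0}, g)"
      interpret good_colouring n r f "U n" "X n f" K "2 * K" "deg n" ?k "nat \<lceil>\<beta> * real n\<rceil>" "nat \<lfloor>\<delta> * real n / 4\<rfloor>"
        using elim(1) f by blast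
      \<comment> \<open>As \<open>k\<close> is at least \<open>\<delta> * n / 2\<close>, its square
        is at least \<open>4 * ?M\<close>, and half of this makes up for the first-round edges.
        \<open>?x\<close> is the largest value with
        \<open>?x * n\<^sup>2 \<le> ?M / 2\<close>.\<close>
      let ?M = "\<delta>\<^sup>2 / 16 * (real n)\<^sup>2" and ?x = "\<delta>\<^sup>2 / 32"
      have M: "2 * ?M + 2 * real (card {e \<in> all_edges n. f e \<noteq> 0}) \<le> real (?k * ?k)"
      proof -
        have "f \<notin> bad n" using f by simp
        then have "real (card {e \<in> all_edges n. f e \<noteq> 0}) < ?M"
          unfolding bad_def many_edges_def Un_iff de_Morgan_disj mem_Collect_eq by (simp only: not_le)
        moreover have "\<delta> * real n / 2 \<le> real ?k" using elim(2) by linarith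
        then have "(\<delta> * real n / 2) * (\<delta> * real n / 2) \<le> real ?k * real ?k"
          using \<delta>(1) by (intro mult_mono) auto
        then have "4 * ?M \<le> real (?k * ?k)" by (simp add: power2_eq_square field_simps)
        ultimately show ?thesis by linarith
      qed
      have x: "0 < ?x" "?x \<le> 1" "?x * (real n)\<^sup>2 \<le> ?M / 2"
      proof -
        show "0 < ?x" using \<delta>(1) by simp
        have "\<delta>\<^sup>2 \<le> 1" using \<delta> by (simp add: power_le_one)
        then show "?x \<le> 1" by simp
      qed simp
      have one: "measure_pmf.prob ?P {g. m \<notin> ?hcp g} \<le> real r * exp (- real n)" if m: "m \<in> profiles_ge n r \<beta>" for m
      proof -
        have mp: "m \<in> profiles n r" using m unfolding profiles_ge_def by simp
        have mb: "nat \<lceil>\<beta> * real n\<rceil> \<le> m i" if "i \<in> {1..r}" for i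
        proof -
          have "\<beta> * real n \<le> real (m i)" using m that unfolding profiles_ge_def by simp
          then show ?thesis by (simp add: ceiling_le_iff nat_le_iff)
        qed
        obtain Y F H where po: "\<And>i. i \<in> {1..r} \<Longrightarrow> posa (Y i) (F i) (H i) ?k \<and> Y i \<subseteq> {1..n}"
          and red: "\<And>g. (\<forall>e. f e \<noteq> 0 \<longrightarrow> g e = f e) \<Longrightarrow>
            (\<forall>i\<in>{1..r}. forced_ham (Y i) (F i) (H i \<union> {e \<in> all_edges n. f e = 0 \<and> g e = i})) \<Longrightarrow> m \<in> ?hcp g"
          using profile_reduction[OF mp mb] by blast
        let ?E = "\<lambda>i. {g. \<not> forced_ham (Y i) (F i) (H i \<union> {e \<in> all_edges n. f e = 0 \<and> g e = i})}"
        \<comment> \<open>\<open>red\<close> asks that \<open>g\<close> extend \<open>f\<close>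
          everywhere. This holds on the supports: off \<open>all_edges n\<close> the state
          \<open>f\<close> is 0, and on it present edges keep their state.\<close>
        have "measure_pmf.prob ?P {g. m \<notin> ?hcp g} = measure_pmf.prob ?P ({g. m \<notin> ?hcp g} \<inter> set_pmf ?P)"
          by (rule measure_Int_set_pmf[symmetric])
        also have "\<dots> \<le> real (card {1..r}) * exp (- real n)"
        proof (rule prob_union_le)
          show "{g. m \<notin> ?hcp g} \<inter> set_pmf ?P \<subseteq> (\<Union>i\<in>{1..r}. ?E i)"
          proof
            fix g assume g: "g \<in> {g. m \<notin> ?hcp g} \<inter> set_pmf ?P"
            have "g \<in> PiE_dflt (all_edges n) 0 (\<lambda>e. set_pmf (if f e \<noteq> 0 then return_pmf (f e) else q2))"
              using g set_Pi_pmf[of "all_edges n" 0 "\<lambda>e. if f e \<noteq> 0 then return_pmf (f e) else q2"] by (simp add: comp_def)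
            then have 1: "g e = f e" if "e \<in> all_edges n" "f e \<noteq> 0" for e
              using that unfolding PiE_dflt_def by fastforce
            have "f \<in> PiE_dflt (all_edges n) 0 (\<lambda>_. set_pmf (q n))"
              using f set_Pi_pmf[of "all_edges n" 0 "\<lambda>_. q n"] unfolding \<mu>_def by (simp add: comp_def)
            then have 2: "f e = 0" if "e \<notin> all_edges n" for e using that unfolding PiE_dflt_def by simp
            have ext: "\<forall>e. f e \<noteq> 0 \<longrightarrow> g e = f e"
            proof (intro allI impI)
              fix e assume e: "f e \<noteq> 0"
              then have "e \<in> all_edges n" using 2[of e] by (rule contrapos_np)
              then show "g e = f e" using e by (rule 1)
            qed
            show "g \<in> (\<Union>i\<in>{1..r}. ?E i)"
            proof (rule ccontr)
              assume "g \<notin> (\<Union>i\<in>{1..r}. ?E i)"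
              then have "\<forall>i\<in>{1..r}. forced_ham (Y i) (F i) (H i \<union> {e \<in> all_edges n. f e = 0 \<and> g e = i})" by simp
              then have "m \<in> ?hcp g" by (rule red[OF ext])
              then show False using g by simp
            qed
          qed
          fix i assume i: "i \<in> {1..r}"
          let ?q = "measure_pmf.prob q2 {i}"
          have "measure_pmf.prob ?P (?E i) \<le> (1 / ?x) ^ n * exp (- (?q * ?M / 2))"
            using po[OF i] by (intro prob_not_forced_ham[where k = ?k] M x) auto
          also have "(1 / ?x) ^ n = exp (real n * ln (32 / \<delta>\<^sup>2))" using \<delta>(1) by (simp add: exp_of_nat_mult)
          also have "exp (real n * ln (32 / \<delta>\<^sup>2)) * exp (- (?q * ?M / 2)) \<le> exp (real n * ln (32 / \<delta>\<^sup>2)) * exp (- (real n * (ln (32 / \<delta>\<^sup>2) + 1)))"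
          proof -
            have "a * sprinkle / real n * (?M / 2) \<le> ?q * (?M / 2)" using q2 i by (intro mult_right_mono) auto
            \<comment> \<open>Of the 64 in \<open>sprinkle\<close>, 32 cancels the denominator of
              \<open>?M / 2\<close>; the remaining factor 2 is slack.\<close>
            moreover have "a * sprinkle / real n * (?M / 2) = 2 * (real n * (ln (32 / \<delta>\<^sup>2) + 1))"
            proof -
              have n0: "real n \<noteq> 0" and a0: "a * \<delta>\<^sup>2 \<noteq> 0" using elim(3) a \<delta> by auto
              define L where "L = ln (32 / \<delta>\<^sup>2) + 1"
              have "a * (64 / (a * \<delta>\<^sup>2) * L) / real n * (\<delta>\<^sup>2 / 16 * (real n)\<^sup>2 / 2) = 2 * (real n * L)"
                using n0 a0 by (simp add: power2_eq_square field_simps)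
              then show ?thesis unfolding sprinkle_def L_def .
            qed
            moreover have "0 \<le> real n * (ln (32 / \<delta>\<^sup>2) + 1)"
            proof -
              have "\<delta>\<^sup>2 \<le> 1" "0 < \<delta>\<^sup>2" using \<delta> by (auto simp: power_le_one)
              then have "1 \<le> 32 / \<delta>\<^sup>2" by (simp add: field_simps)
              then have "0 \<le> ln (32 / \<delta>\<^sup>2)" by simp
              then show ?thesis by simp
            qed
            ultimately have "real n * (ln (32 / \<delta>\<^sup>2) + 1) \<le> ?q * ?M / 2" by simp
            then show ?thesis by (intro mult_left_mono) auto
          qed
          also have "\<dots> = exp (- real n)" by (simp add: exp_add[symmetric] algebra_simps)
          finally show "measure_pmf.prob ?P (?E i) \<le> exp (- real n)" .
        qed auto
        finally show ?thesis by simp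
      qed
      have pf: "profiles_ge n r \<beta> \<subseteq> {1..r} \<rightarrow>\<^sub>E {0..n}" unfolding profiles_ge_def profiles_def by auto
      have fpi: "finite ({1..r} \<rightarrow>\<^sub>E {0..n})" by (intro finite_PiE) auto
      have "measure_pmf.prob ?P {g. \<not> profiles_ge n r \<beta> \<subseteq> ?hcp g} \<le> real (card (profiles_ge n r \<beta>)) * (real r * exp (- real n))"
        using finite_subset[OF pf fpi] one by (intro prob_union_le[where F = "\<lambda>m. {g. m \<notin> ?hcp g}"]) auto
      also have "\<dots> \<le> real ((n + 1) ^ r) * (real r * exp (- real n))"
      proof -
        have "card (profiles_ge n r \<beta>) \<le> card ({1..r} \<rightarrow>\<^sub>E {0..n})" by (rule card_mono[OF fpi pf])
        also have "\<dots> = (n + 1) ^ r" by (simp add: card_PiE)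
        finally show ?thesis by (intro mult_right_mono iffD2[OF of_nat_le_iff]) auto
      qed
      finally show "measure_pmf.prob ?P {g. \<not> profiles_ge n r \<beta> \<subseteq> ?hcp g} \<le> real ((n + 1) ^ r) * (real r * exp (- real n))" .
    qed
  qed
qed

end

section \<open>Splitting \<open>p\<close> into two rounds\<close>

theorem theorem1:
  fixes r :: nat and \<beta> :: real and \<alpha> :: "nat \<Rightarrow> real"
    and \<omega> p :: "nat \<Rightarrow> real"
  assumes "r \<ge> 2" and "\<beta> > 0"
    and "\<And>i. i \<in> {1..r} \<Longrightarrow> \<alpha> i > 0"
    and "(\<Sum>i=1..r. \<alpha> i) = 1"
    and "filterlim \<omega> at_top sequentially"
    and "\<And>n. 0 \<le> p n \<and> p n \<le> 1"
    and "eventually (\<lambda>n. p n \<ge> (ln (real n) + real r * ln (ln (real n)) + \<omega> n) / real n) sequentially"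
  shows "(\<lambda>n. measure_pmf.prob (coloured_gnp n (p n) r \<alpha>)
           {G. profiles_ge n r \<beta> \<subseteq> hcp n r G}) \<longlonglongrightarrow> 1"
proof (cases "real r * \<beta> \<le> 1")
  case False
  \<comment> \<open>If \<open>r * \<beta> > 1\<close>, the entries of an admissible profile would
    sum to more than \<open>n\<close>, so there is none.\<close>
  have "eventually (\<lambda>n. measure_pmf.prob (coloured_gnp n (p n) r \<alpha>) {G. profiles_ge n r \<beta> \<subseteq> hcp n r G} = 1) sequentially"
    using eventually_ge_at_top[of 1]
  proof eventually_elim
    case (elim n)
    have "m \<notin> profiles_ge n r \<beta>" for m
    proof
      assume m: "m \<in> profiles_ge n r \<beta>"
      have "1 * real n < real r * \<beta> * real n" using False elim by (intro mult_strict_right_mono) auto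
      also have "\<dots> = (\<Sum>i=1..r. \<beta> * real n)" by simp
      also have "\<dots> \<le> (\<Sum>i=1..r. real (m i))" using m unfolding profiles_ge_def by (intro sum_mono) auto
      also have "\<dots> = real n" using m unfolding profiles_ge_def profiles_def by (simp flip: of_nat_sum)
      finally show False by simp
    qed
    then have "profiles_ge n r \<beta> = {}" by blast
    then show ?case by simp
  qed
  then show ?thesis by (rule tendsto_eventually)
next
  case True
  define a where "a = Min (\<alpha> ` {1..r})"
  have r1: "1 \<in> {1..r}" using assms(1) by simp
  have a_le: "a \<le> \<alpha> i" if "i \<in> {1..r}" for i unfolding a_def using that by simp
  have "a \<in> \<alpha> ` {1..r}" unfolding a_def using r1 by (intro Min_in) auto
  then have a0: "0 < a" using assms(3) by auto
  have "\<alpha> 1 \<le> (\<Sum>i=1..r. \<alpha> i)" using r1 assms(3) by (intro member_le_sum) (auto intro: less_imp_le)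
  then have a1: "a \<le> 1" using a_le[OF r1] assms(4) by simp
  \<comment> \<open>The value of \<open>sprinkle\<close>, needed here already because
    \<open>w\<close> sets \<open>C / n\<close> aside for the second round.\<close>
  define C where "C = 64 / (a * (density (a * \<beta> / 16))\<^sup>2) * (ln (32 / (density (a * \<beta> / 16))\<^sup>2) + 1)"
  \<comment> \<open>Subtracting \<open>C\<close> reserves the second round; the cap keeps
    \<open>p1\<close> below \<open>2 * ln n / n\<close> for large \<open>n\<close>, however large
    \<open>p\<close> is.\<close>
  define w where "w n = min (\<omega> n - C) (ln (ln (real n)))" for n
  define L where "L n = (ln (real n) + real r * ln (ln (real n)) + w n) / real n" for n
  \<comment> \<open>Clamped so that it is a probability for every \<open>n\<close>; from some
    \<open>n\<close> on it equals \<open>L n\<close>.\<close>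
  define p1 where "p1 n = max 0 (min 1 (L n))" for n
  \<comment> \<open>The solution of \<open>1 - p = (1 - p1) * (1 - p2)\<close>; dividing by
    \<open>1 - p1\<close> only enlarges \<open>p - p1\<close>, which is at least
    \<open>C / n\<close> for large \<open>n\<close>.\<close>
  define p2 where "p2 n = (p n - p1 n) / (1 - p1 n)" for n
  have p1_01: "0 \<le> p1 n" "p1 n \<le> 1" for n unfolding p1_def by auto
  have w_top: "filterlim w at_top sequentially"
  proof (subst filterlim_at_top, intro allI)
    fix Z
    have "eventually (\<lambda>n. Z + C \<le> \<omega> n) sequentially" using assms(5) unfolding filterlim_at_top by blast
    moreover have "eventually (\<lambda>n. Z \<le> ln (ln (real n))) sequentially" by real_asymp
    ultimately show "eventually (\<lambda>n. Z \<le> w n) sequentially" unfolding w_def by eventually_elim auto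
  qed
  have w0: "eventually (\<lambda>n. 0 \<le> w n) sequentially" using w_top unfolding filterlim_at_top by blast
  have "eventually (\<lambda>n. ln (real n) + (real r + 1) * ln (ln (real n)) \<le> 2 * ln (real n)) sequentially" by real_asymp
  moreover have "eventually (\<lambda>n. 2 * ln (real n) / real n \<le> 1 / 2) sequentially" by real_asymp
  moreover have "eventually (\<lambda>n. 0 \<le> ln (ln (real n))) sequentially" by real_asymp
  ultimately have L_bounds: "eventually (\<lambda>n. 0 \<le> L n \<and> L n \<le> 2 * ln (real n) / real n \<and> L n \<le> 1 / 2) sequentially"
    using w0 eventually_ge_at_top[of 1]
  proof eventually_elim
    case (elim n)
    have "0 \<le> ln (real n)" using elim(5) by simp
    then have "0 \<le> L n" unfolding L_def using elim by (intro divide_nonneg_nonneg add_nonneg_nonneg mult_nonneg_nonneg) auto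
    moreover have "w n \<le> ln (ln (real n))" unfolding w_def by simp
    then have "ln (real n) + real r * ln (ln (real n)) + w n \<le> 2 * ln (real n)"
      using elim(1) by (simp add: distrib_right)
    then have "L n \<le> 2 * ln (real n) / real n" unfolding L_def by (intro divide_right_mono) auto
    ultimately show ?case using elim(2) by linarith
  qed
  have p1_eq: "eventually (\<lambda>n. p1 n = L n) sequentially"
    using L_bounds by eventually_elim (auto simp: p1_def)
  interpret R: first_round r \<beta> a "\<lambda>n. edge_state r \<alpha> (p1 n)" p1 w
  proof
    show "2 \<le> r" "0 < \<beta>" "real r * \<beta> \<le> 1" "0 < a" "a \<le> 1" using assms True a0 a1 by auto
    show "set_pmf (edge_state r \<alpha> (p1 n)) \<subseteq> {0..r}" for n by (rule set_edge_state[OF assms(3,4)])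
    show "measure_pmf.prob (edge_state r \<alpha> (p1 n)) (-{0}) = p1 n" for n
      by (rule prob_edge_state_present[OF assms(3,4) p1_01])
    show "a * p1 n \<le> measure_pmf.prob (edge_state r \<alpha> (p1 n)) {i}" if i: "i \<in> {1..r}" for n i
    proof -
      have "measure_pmf.prob (edge_state r \<alpha> (p1 n)) {i} = \<alpha> i * p1 n"
        using assms(3,4) p1_01 i by (intro prob_edge_state_colour) auto
      then show ?thesis using a_le[OF i] p1_01[of n] by (simp add: mult_right_mono)
    qed
    show "filterlim w at_top sequentially" by (rule w_top)
    show "eventually (\<lambda>n. (ln (real n) + real r * ln (ln (real n)) + w n) / real n \<le> p1 n) sequentially"
      using p1_eq by eventually_elim (simp add: L_def)
    show "eventually (\<lambda>n. p1 n \<le> 2 * ln (real n) / real n) sequentially"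
      using p1_eq L_bounds by eventually_elim simp
  qed
  have C: "R.sprinkle = C" unfolding C_def R.sprinkle_def R.\<delta>_def R.\<epsilon>_def ..
  have C0: "0 \<le> C"
  proof -
    have "0 < R.\<delta>" "R.\<delta> \<le> 1" by (rule R.\<delta>)+
    then have "R.\<delta>\<^sup>2 \<le> 1" "0 < R.\<delta>\<^sup>2" by (auto simp: power_le_one)
    then have "1 \<le> 32 / R.\<delta>\<^sup>2" by (simp add: field_simps)
    then show ?thesis unfolding C[symmetric] R.sprinkle_def using a0 by (intro mult_nonneg_nonneg) auto
  qed
  let ?bad = "\<lambda>n. {G. \<not> profiles_ge n r \<beta> \<subseteq> hcp n r G}"
  let ?b = "\<lambda>n. measure_pmf.prob (R.\<mu> n) (R.bad n) + (real n + 1) ^ r * (real r * exp (- real n))"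
  have ub: "eventually (\<lambda>n. measure_pmf.prob (coloured_gnp n (p n) r \<alpha>) (?bad n) \<le> ?b n) sequentially"
    using R.second_round L_bounds p1_eq assms(7) eventually_ge_at_top[of 1]
  proof eventually_elim
    case (elim n)
    have p1: "p1 n \<le> 1 / 2" using elim(2,3) by simp
    have "C / real n \<le> p n - p1 n"
    proof -
      have "w n + C \<le> \<omega> n" unfolding w_def by simp
      then have "(ln (real n) + real r * ln (ln (real n)) + w n + C) / real n \<le> p n"
        using elim(4,5) by (intro order_trans[OF divide_right_mono elim(4)]) auto
      then show ?thesis unfolding elim(3) L_def by (simp add: add_divide_distrib)
    qed
    then have pp: "0 \<le> p n - p1 n" "C / real n \<le> p n - p1 n" using divide_nonneg_nonneg[OF C0, of "real n"] by linarith+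
    have p2: "p n - p1 n \<le> p2 n" "0 \<le> p2 n" "p2 n \<le> 1"
    proof -
      have "(p n - p1 n) * (1 - p1 n) \<le> (p n - p1 n) * 1" using pp p1_01 by (intro mult_left_mono) auto
      then show "p n - p1 n \<le> p2 n" unfolding p2_def using p1 by (simp add: pos_le_divide_eq)
      then show "0 \<le> p2 n" using pp by linarith
      show "p2 n \<le> 1" unfolding p2_def using p1 assms(6)[of n] by (simp add: pos_divide_le_eq)
    qed
    have split: "1 - p n = (1 - p1 n) * (1 - p2 n)" unfolding p2_def using p1 by (simp add: field_simps)
    let ?A = "all_edges n"
    let ?N = "\<lambda>f. Pi_pmf ?A 0 (\<lambda>e. if f e \<noteq> 0 then return_pmf (f e) else edge_state r \<alpha> (p2 n))"
    let ?E = "{g. \<not> profiles_ge n r \<beta> \<subseteq> hcp n r ({e \<in> ?A. g e \<noteq> 0}, g)}"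
    have "Pi_pmf ?A 0 (\<lambda>_. edge_state r \<alpha> (p n)) = bind_pmf (R.\<mu> n) ?N"
    proof -
      have "edge_state r \<alpha> (p n) = bind_pmf (edge_state r \<alpha> (p1 n)) (\<lambda>s. if s \<noteq> 0 then return_pmf s else edge_state r \<alpha> (p2 n))"
        using assms(3,4) p1_01 p2(2,3) split by (intro edge_state_split) auto
      then show ?thesis unfolding R.\<mu>_def by (simp only:) (rule Pi_pmf_bind[OF finite_all_edges])
    qed
    moreover have "coloured_gnp n (p n) r \<alpha> =
        map_pmf (\<lambda>c. ({e \<in> ?A. c e \<noteq> 0}, c)) (Pi_pmf ?A 0 (\<lambda>_. edge_state r \<alpha> (p n)))"
      using assms(3,4) by (intro coloured_gnp_eq) auto
    ultimately have "measure_pmf.prob (coloured_gnp n (p n) r \<alpha>) (?bad n) = measure_pmf.prob (bind_pmf (R.\<mu> n) ?N) ?E"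
      by (simp add: vimage_def)
    also have "\<dots> \<le> measure_pmf.prob (R.\<mu> n) (- (- R.bad n)) + real ((n + 1) ^ r) * (real r * exp (- real n))"
    proof (rule prob_bind_le)
      fix f assume f: "f \<in> - R.bad n" "f \<in> set_pmf (R.\<mu> n)"
      have "a * R.sprinkle / real n \<le> measure_pmf.prob (edge_state r \<alpha> (p2 n)) {i}" if i: "i \<in> {1..r}" for i
      proof -
        have "a * (C / real n) \<le> \<alpha> i * p2 n"
          using a_le[OF i] pp(2) p2(1,2) a0 C0 assms(3)[OF i] by (intro mult_mono) auto
        moreover have "measure_pmf.prob (edge_state r \<alpha> (p2 n)) {i} = \<alpha> i * p2 n"
          using assms(3,4) p2(2,3) i by (intro prob_edge_state_colour) auto
        ultimately show ?thesis unfolding C by simp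
      qed
      then show "measure_pmf.prob (?N f) ?E \<le> real ((n + 1) ^ r) * (real r * exp (- real n))"
        using elim(1) f by blast
    qed simp
    finally show ?case by (simp add: add.commute)
  qed
  have lim: "?b \<longlonglongrightarrow> 0"
  proof -
    have "(\<lambda>n. (real n + 1) ^ r * (real r * exp (- real n))) \<longlonglongrightarrow> 0" by real_asymp
    then show ?thesis using R.null_bad unfolding R.null_def by (rule tendsto_add_zero[rotated])
  qed
  have "(\<lambda>n. measure_pmf.prob (coloured_gnp n (p n) r \<alpha>) (?bad n)) \<longlonglongrightarrow> 0"
    by (rule tendsto_sandwich[OF _ ub tendsto_const lim]) simp
  then have "(\<lambda>n. 1 - measure_pmf.prob (coloured_gnp n (p n) r \<alpha>) (?bad n)) \<longlonglongrightarrow> 1 - 0"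
    by (intro tendsto_diff tendsto_const)
  moreover have "1 - measure_pmf.prob (coloured_gnp n (p n) r \<alpha>) (?bad n) =
      measure_pmf.prob (coloured_gnp n (p n) r \<alpha>) {G. profiles_ge n r \<beta> \<subseteq> hcp n r G}" for n
  proof -
    have "UNIV - ?bad n = {G. profiles_ge n r \<beta> \<subseteq> hcp n r G}" by auto
    then show ?thesis using measure_pmf.prob_compl[of "?bad n" "coloured_gnp n (p n) r \<alpha>"] by simp
  qed
  ultimately show ?thesis by simp
qed

end
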